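(* Let $C$ be a rational monomial curve with a unique singular point. Then the canonical model $C'$ of $C$ lies on a surface scroll if and only if $\operatorname{gon}(C)\leq 3$.
   Context: Work over an algebraically closed field $k$; a curve is an integral complete one-dimensional $k$-scheme, and $g$ is the arithmetic genus. A rational monomial curve is the image of a morphism $\mathbb{P}^1\to\mathbb{P}^n$, $(s:t)\mapsto(s^{a_n}:t^{a_1}s^{a_n-a_1}:\ldots:t^{a_{n-1}}s^{a_n-a_{n-1}}:t^{a_n})$, with $0<a_1<\ldots<a_n$; it is denoted $(1:t^{a_1}:\ldots:t^{a_n})$. Canonical model. Let $\omega$ be the dualizing sheaf of $C$ and $\pi:\overline{C}\to C$ the normalization. The sections $H^0(\omega)$ generate the invertible sheaf $\pi^*\omega/\mathrm{Torsion}$ on $\overline{C}$ and so define a morphism $\kappa:\overline{C}\to\mathbb{P}^{g-1}$; the canonical model is $C':=\kappa(\overline{C})$. For a rational monomial curve with a unique singular point, $C'$ is again a rational monomial curve $(1:t^{b_1}:\ldots:t^{b_{g-1}})\subset\mathbb{P}^{g-1}$ in suitable coordinates, and these coordinates are used for $C'$. Gonality. For a torsion free rank $1$ sheaf $\mathcal{F}$ on $C$, $\deg\mathcal{F}=\chi(\mathcal{F})-\chi(\mathcal{O}_C)$; $\operatorname{gon}(C)$ is the smallest $d$ for which there is a torsion free rank $1$ sheaf of degree $d$ with $h^0\geq 2$. Scrolls. A $d$-fold rational normal scroll $S_{m_1,\ldots,m_d}\subset\mathbb{P}^N$, with $m_i\geq 0$, $e=m_1+\ldots+m_d\geq 1$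 and $N=e+d-1$, is the locus where the $2\times e$ matrix obtained by juxtaposing $d$ blocks $$\begin{pmatrix} x_{j} & x_{j+1} & \cdots & x_{j+m_i-1} \\ x_{j+1} & x_{j+2} & \cdots & x_{j+m_i} \end{pmatrix},\qquad j=m_1+\ldots+m_{i-1}+(i-1),\quad i=1,\ldots,d$$ (a block being empty if $m_i=0$), has rank less than $2$, after a suitable choice of coordinates. Surface scrolls are the case $d=2$. Convention for monomial curves: the coordinates defining the scroll are the coordinates in which the monomial curve is given, up to reordering them. If $g\leq 3$, then $C'$ lies on a plane, which is regarded as a surface scroll. *)

theory Defs
  imports
    "HOL-Analysis.Analysis"
    "HOL-Computational_Algebra.Formal_Laurent_Series"
    "HOL-Computational_Algebra.Fraction_Field"
    "HOL-Library.Poly_Mapping"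
    "HOL-Combinatorics.Permutations"
begin

section \<open>Projective space and the function field of the projective line\<close>

text \<open>A point of projective space is the set of its homogeneous coordinate vectors; vectors of
  length \<open>n + 1\<close> are functions on \<open>nat\<close> that vanish beyond \<open>n\<close>.\<close>

type_synonym 'k ppoint = "(nat \<Rightarrow> 'k) set"

definition proj_pt :: "(nat \<Rightarrow> 'k::field) \<Rightarrow> 'k ppoint" where
  "proj_pt v = {(\<lambda>i. c * v i) | c. c \<noteq> 0}"

definition proj_space :: "nat \<Rightarrow> 'k::field ppoint set" where
  "proj_space N = {proj_pt v | v. (\<exists>i. v i \<noteq> 0) \<and> (\<forall>i>N. v i = 0)}"

text \<open>The field \<open>k(t)\<close>.\<close>

type_synonym 'k ratfun = "'k poly fract"

definition const_rf :: "'k::field \<Rightarrow> 'k ratfun" where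
  "const_rf c = Fract [:c:] 1"

definition t_rf :: "'k::field ratfun" where
  "t_rf = Fract [:0, 1:] 1"

definition scale_rf :: "'k::field \<Rightarrow> 'k ratfun \<Rightarrow> 'k ratfun" where
  "scale_rf c f = const_rf c * f"

lemma const_rf_add: "const_rf (a + b) = const_rf a + const_rf b"
  and const_rf_mult: "const_rf (a * b) = const_rf a * const_rf b"
  and const_rf_1: "const_rf 1 = 1"
  by (simp_all add: const_rf_def One_fract_def mult.commute one_pCons)

global_interpretation kt: vector_space "scale_rf :: 'k::field \<Rightarrow> 'k ratfun \<Rightarrow> 'k ratfun"
  by unfold_locales
    (simp_all add: scale_rf_def const_rf_add const_rf_mult const_rf_1 algebra_simps)

text \<open>Points of the projective line are \<open>Some c = (1 : c)\<close> and \<open>None = (0 : 1)\<close>. The expansion of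
  \<open>t\<close> in the local parameter \<open>X\<close> at such a point is \<open>c + X\<close>, respectively \<open>1 / X\<close>; substituting it
  for \<open>t\<close> gives the Laurent expansion of a rational function. The value of \<open>expand\<close> does not
  depend on the fraction chosen.\<close>

fun t_at :: "'k::field option \<Rightarrow> 'k fls" where
  "t_at (Some c) = fls_const c + fls_X"
| "t_at None = fls_X_inv"

definition expand :: "'k::field option \<Rightarrow> 'k ratfun \<Rightarrow> 'k fls" where
  "expand Q f = (THE y. \<exists>p q. q \<noteq> 0 \<and> f = Fract p q \<and>
     y = poly (map_poly fls_const p) (t_at Q) / poly (map_poly fls_const q) (t_at Q))"

text \<open>The residue at \<open>Q\<close> of the differential \<open>f dt\<close>.\<close>

definition residue_dt :: "'k::field option \<Rightarrow> 'k ratfun \<Rightarrow> 'k" where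
  "residue_dt Q f = fls_residue (expand Q f * fls_deriv (t_at Q))"

text \<open>The morphism \<open>(f\<^sub>0 : \<dots> : f\<^sub>N)\<close> from the projective line to projective space: at \<open>Q\<close> the tuple
  is divided by \<open>X ^ m\<close>, \<open>m\<close> the least order of an \<open>f\<^sub>i\<close> at \<open>Q\<close>, and evaluated. All \<open>f\<^sub>i\<close> are
  meant to be nonzero.\<close>

definition rat_map :: "'k::field ratfun list \<Rightarrow> 'k option \<Rightarrow> 'k ppoint" where
  "rat_map fs Q = (let m = Min ((\<lambda>f. fls_subdegree (expand Q f)) ` set fs) in
     proj_pt (\<lambda>i. if i < length fs then fls_nth (expand Q (fs ! i)) m else 0))"


section \<open>Monomial curves\<close>

text \<open>The list \<open>a\<close> is \<open>[a\<^sub>1, \<dots>, a\<^sub>n]\<close>; below, \<open>0 # a\<close> has entries \<open>a\<^sub>0 = 0, a\<^sub>1, \<dots>, a\<^sub>n\<close>.\<close>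

definition monomial_curve :: "nat list \<Rightarrow> 'k::field ppoint set" where
  "monomial_curve a = (let e = 0 # a; n = length a in
     {proj_pt (\<lambda>i. if i \<le> n then t ^ (e ! i) * s ^ (e ! n - e ! i) else 0)
       | s t. (s, t) \<noteq> (0, 0)})"

text \<open>The \<open>a\<^sub>i\<close> need not be coprime. The morphism in \<open>monomial_curve\<close> factors through
  \<open>t \<mapsto> t ^ d\<close> with \<open>d = gcd (a\<^sub>1, \<dots>, a\<^sub>n)\<close>; dividing the exponents by \<open>d\<close> leaves the image unchanged
  and makes the morphism birational, so that it is the normalization of the curve and
  identifies the function field of the curve with \<open>k(t)\<close>.\<close>

definition monomial_normalization :: "nat list \<Rightarrow> 'k::field ratfun list" where
  "monomial_normalization a = map (\<lambda>e. t_rf ^ (e div Gcd (set a))) (0 # a)"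


section \<open>Local rings, sheaves and cohomology on a rational curve\<close>

text \<open>From now on \<open>C\<close> is a curve in projective \<open>n\<close>-space and \<open>\<phi> = [\<phi>\<^sub>0, \<dots>, \<phi>\<^sub>n]\<close> are rational functions
  such that \<open>rat_map \<phi>\<close> is the normalization of \<open>C\<close>. Polynomials in the homogeneous coordinates
  are finitely supported functions on monomials, which are themselves finitely supported
  exponent functions.\<close>

type_synonym 'k mpol = "(nat \<Rightarrow>\<^sub>0 nat) \<Rightarrow>\<^sub>0 'k"

definition mpol_eval :: "('k::zero \<Rightarrow> 'b::comm_semiring_1) \<Rightarrow> (nat \<Rightarrow> 'b) \<Rightarrow> 'k mpol \<Rightarrow> 'b" where
  "mpol_eval h x F = (\<Sum>m\<in>Poly_Mapping.keys F. h (Poly_Mapping.lookup F m) *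
     (\<Prod>i\<in>Poly_Mapping.keys m. x i ^ Poly_Mapping.lookup m i))"

definition form :: "nat \<Rightarrow> nat \<Rightarrow> 'k::zero mpol \<Rightarrow> bool" where
  "form n d F \<longleftrightarrow> (\<forall>m\<in>Poly_Mapping.keys F. Poly_Mapping.keys m \<subseteq> {..n} \<and>
     (\<Sum>i\<in>Poly_Mapping.keys m. Poly_Mapping.lookup m i) = d)"

text \<open>The local ring of \<open>C\<close> at \<open>P\<close> as a subring of \<open>k(t)\<close>: the pullbacks under \<open>\<phi>\<close> of the quotients
  \<open>F / G\<close> of forms of the same degree with \<open>G (P) \<noteq> 0\<close>.\<close>

definition local_ring :: "'k::field ratfun list \<Rightarrow> 'k ppoint \<Rightarrow> 'k ratfun set" where
  "local_ring \<phi> P = {mpol_eval const_rf ((!) \<phi>) F / mpol_eval const_rf ((!) \<phi>) G | F G d.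
     form (length \<phi> - 1) d F \<and> form (length \<phi> - 1) d G \<and> (\<forall>x\<in>P. mpol_eval id x G \<noteq> 0)}"

text \<open>The local rings are Noetherian of dimension one, so regular means that the maximal ideal is
  generated by one element.\<close>

definition singular_at :: "'k::field ratfun list \<Rightarrow> 'k ppoint \<Rightarrow> bool" where
  "singular_at \<phi> P \<longleftrightarrow> (let R = local_ring \<phi> P; M = {x \<in> R. x = 0 \<or> inverse x \<notin> R} in
     \<not> (\<exists>u\<in>R. M = {x * u | x. x \<in> R}))"

text \<open>A coherent torsion free sheaf of rank one on \<open>C\<close> embeds into the constant sheaf \<open>k(t)\<close>. Up to
  isomorphism it is therefore given by its stalks, which are nonzero finitely generated
  submodules of \<open>k(t)\<close> over the local rings and equal to the local ring at almost all points.
  Its sections over an open set are the elements of \<open>k(t)\<close> lying in all stalks over that set.\<close>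

type_synonym 'k fsheaf = "'k ppoint \<Rightarrow> 'k ratfun set"

definition torsion_free_rank1 :: "'k::field ppoint set \<Rightarrow> 'k ratfun list \<Rightarrow> 'k fsheaf \<Rightarrow> bool" where
  "torsion_free_rank1 C \<phi> F \<longleftrightarrow>
     (\<forall>P\<in>C. F P \<noteq> {0} \<and>
       (\<exists>Y. finite Y \<and> F P = {(\<Sum>y\<in>Y. c y * y) | c. \<forall>y\<in>Y. c y \<in> local_ring \<phi> P})) \<and>
     finite {P \<in> C. F P \<noteq> local_ring \<phi> P}"

definition sections :: "'k fsheaf \<Rightarrow> 'k ppoint set \<Rightarrow> 'k ratfun set" where
  "sections F U = (\<Inter>P\<in>U. F P)"

text \<open>The dimension of \<open>V / W\<close> for subspaces \<open>W \<subseteq> V\<close> with \<open>V / W\<close> of finite dimension.\<close>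

definition quot_dim :: "'k::field ratfun set \<Rightarrow> 'k ratfun set \<Rightarrow> nat" where
  "quot_dim V W = (LEAST d. \<exists>B. finite B \<and> card B = d \<and> B \<subseteq> V \<and> V \<subseteq> kt.span (B \<union> W))"

definition h0 :: "'k::field ppoint set \<Rightarrow> 'k fsheaf \<Rightarrow> nat" where
  "h0 C F = kt.dim (sections F C)"

text \<open>Cech cohomology for the affine open sets \<open>x\<^sub>0 \<noteq> 0\<close> and \<open>x\<^sub>n \<noteq> 0\<close>. They cover a monomial curve,
  whose only point with \<open>x\<^sub>0 = 0\<close> is \<open>(0 : \<dots> : 0 : 1)\<close>.\<close>

definition chart :: "'k::field ppoint set \<Rightarrow> nat \<Rightarrow> 'k ppoint set" where
  "chart C i = {P \<in> C. \<forall>x\<in>P. x i \<noteq> 0}"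

definition h1 :: "'k::field ppoint set \<Rightarrow> 'k ratfun list \<Rightarrow> 'k fsheaf \<Rightarrow> nat" where
  "h1 C \<phi> F = (let U = chart C 0; V = chart C (length \<phi> - 1) in
     quot_dim (sections F (U \<inter> V)) {f + g | f g. f \<in> sections F U \<and> g \<in> sections F V})"

definition euler_char :: "'k::field ppoint set \<Rightarrow> 'k ratfun list \<Rightarrow> 'k fsheaf \<Rightarrow> int" where
  "euler_char C \<phi> F = int (h0 C F) - int (h1 C \<phi> F)"

definition sheaf_degree :: "'k::field ppoint set \<Rightarrow> 'k ratfun list \<Rightarrow> 'k fsheaf \<Rightarrow> int" where
  "sheaf_degree C \<phi> F = euler_char C \<phi> F - euler_char C \<phi> (local_ring \<phi>)"

definition arith_genus :: "'k::field ppoint set \<Rightarrow> 'k ratfun list \<Rightarrow> nat" where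
  "arith_genus C \<phi> = h1 C \<phi> (local_ring \<phi>)"

definition gonality :: "'k::field ppoint set \<Rightarrow> 'k ratfun list \<Rightarrow> int" where
  "gonality C \<phi> =
     (LEAST d. \<exists>F. torsion_free_rank1 C \<phi> F \<and> sheaf_degree C \<phi> F = d \<and> 2 \<le> h0 C F)"


section \<open>The canonical model\<close>

text \<open>The dualizing sheaf is Rosenlicht's sheaf of regular differentials; a differential \<open>f dt\<close> is
  represented by \<open>f\<close>. The stalk at \<open>P\<close> consists of the \<open>f dt\<close> such that, for all \<open>u\<close> in the local
  ring, the residues of \<open>u f dt\<close> at the points over \<open>P\<close> add up to \<open>0\<close>.\<close>

definition dualizing_sheaf :: "'k::field ratfun list \<Rightarrow> 'k fsheaf" where
  "dualizing_sheaf \<phi> P =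
     {f. \<forall>u\<in>local_ring \<phi> P. (\<Sum>Q | rat_map \<phi> Q = P. residue_dt Q (u * f)) = 0}"

text \<open>A basis \<open>\<omega>s\<close> of \<open>H\<^sup>0(\<omega>)\<close> such that \<open>\<kappa> = rat_map \<omega>s\<close> is \<open>(1 : t ^ b\<^sub>1 : \<dots> : t ^ b\<^sub>g\<^sub>-\<^sub>1)\<close> with
  \<open>0 < b\<^sub>1 < \<dots>\<close>. Its image is the canonical model in coordinates in which it is monomial.
  (Dividing by a power of the local parameter in \<open>rat_map\<close> trivializes the pullback of \<open>\<omega>\<close> modulo
  torsion at \<open>Q\<close>, because this sheaf is generated by \<open>H\<^sup>0(\<omega>)\<close>.)\<close>

definition monomial_canonical_basis ::
    "'k::field ppoint set \<Rightarrow> 'k ratfun list \<Rightarrow> 'k ratfun list \<Rightarrow> bool" where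
  "monomial_canonical_basis C \<phi> \<omega>s \<longleftrightarrow>
     distinct \<omega>s \<and> kt.independent (set \<omega>s) \<and> kt.span (set \<omega>s) = sections (dualizing_sheaf \<phi>) C \<and>
     (\<exists>b. sorted_wrt (<) (0 # b) \<and> \<omega>s = map (\<lambda>e. \<omega>s ! 0 * t_rf ^ e) (0 # b))"


section \<open>Scrolls\<close>

text \<open>The columns of the matrix of the scroll with block sizes \<open>ms\<close>; in the \<open>i\<close>-th block (counted
  from 0) the first column is \<open>(x\<^sub>j, x\<^sub>j\<^sub>+\<^sub>1)\<close> with \<open>j = sum_list (take i ms) + i\<close>.\<close>

definition scroll_columns :: "nat list \<Rightarrow> (nat \<Rightarrow> 'k::field) \<Rightarrow> ('k ^ 2) set" where
  "scroll_columns ms x =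
     {vector [x j, x (Suc j)] | i l j. i < length ms \<and> l < ms ! i \<and> j = sum_list (take i ms) + i + l}"

text \<open>The scroll with respect to the coordinates reordered by \<open>\<sigma>\<close>; \<open>vec.dim\<close> of the set of
  columns is the rank of the matrix.\<close>

definition scroll :: "nat list \<Rightarrow> (nat \<Rightarrow> nat) \<Rightarrow> 'k::field ppoint set" where
  "scroll ms \<sigma> = {P \<in> proj_space (sum_list ms + length ms - 1).
     \<forall>x\<in>P. vec.dim (scroll_columns ms (x \<circ> \<sigma>)) < 2}"

text \<open>For \<open>N \<le> 2\<close> the ambient space is contained in a plane, which counts as a surface scroll.\<close>

definition on_surface_scroll :: "nat \<Rightarrow> 'k::field ppoint set \<Rightarrow> bool" where
  "on_surface_scroll N X \<longleftrightarrow> N \<le> 2 \<or>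
     (\<exists>m\<^sub>1 m\<^sub>2 \<sigma>. 1 \<le> m\<^sub>1 + m\<^sub>2 \<and> N = m\<^sub>1 + m\<^sub>2 + 1 \<and> \<sigma> permutes {..N} \<and> X \<subseteq> scroll [m\<^sub>1, m\<^sub>2] \<sigma>)"

end

theory Submission
  imports Defs
begin

text \<open>Let \<open>S\<close> be the value semigroup at the singular point. Away from that point a torsion free
  sheaf of rank one is trivial, the complement being an affine line. So the sheaf is given by its
  stalk \<open>M\<close> at the singular point, and its degree counts the orders of elements of \<open>M\<close> that are not
  in \<open>S\<close>, minus the elements of \<open>S\<close> that are not such orders. Two independent sections can be chosen
  with different orders \<open>i < j\<close> there, and then \<open>(S + i) \<union> (S + j)\<close> consists of orders of \<open>M\<close>; with
  \<open>r = j - i\<close> this bounds the degree below by \<open>#(S - (S + r))\<close>. The sheaf \<open>\<O> + t\<^sup>-\<^sup>r \<O>\<close> attains the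
  bound, so the gonality is the minimum of \<open>#(S - (S + r)) = r + #((S + r) - S)\<close> over \<open>r \<ge> 1\<close>.

  If \<open>t\<close> is a parameter at the singular point, the differentials \<open>t\<^sup>-\<^sup>l\<^sup>-\<^sup>1 dt\<close> with \<open>l\<close> a gap
    of \<open>S\<close> form
  a basis of the sections of the dualizing sheaf. So the exponents of \<open>C'\<close> are the gaps up to an
  affine substitution. A minor of the matrix of a scroll vanishes on a monomial curve iff the
  exponents of its two terms agree, hence \<open>C'\<close> lies on a surface scroll iff the gaps are the union
  of two arithmetic progressions with the same difference \<open>r\<close>. The least number of progressions of
  difference \<open>r\<close> is the number of gaps below \<open>r\<close> plus \<open>#((S + r) - S)\<close>; comparing this with the
  gonality leaves only the case of an element of \<open>S\<close> strictly between \<open>0\<close> and \<open>r\<close>, where the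
  multiplicity \<open>m\<close> of \<open>S\<close> is at most \<open>3\<close>, and \<open>t\<^sup>m\<close> has degree \<open>m\<close>.\<close>


section \<open>Rational functions and their expansions\<close>

text \<open>The definitions speak of arbitrary rational functions, the argument of integers. The
  bridge is the Laurent expansion at the singular point: the local ring consists of the rational
  functions whose expansion has all its exponents in \<open>S\<close>. Since it is defined by
  quotients of forms of equal degree, one inclusion needs numerator and denominator with exponents
  in \<open>S\<close> and a common degree.

  The spaces of the Cech complex are infinite dimensional. They are cut down to Laurent polynomials
  with exponents in \<open>[-N, N]\<close>, and an Euler characteristic becomes a formula valid for
  all large \<open>N\<close>, so that two of them can be compared at a common \<open>N\<close>.

  The singular point may be the image of \<open>0\<close> or of infinity, with different semigroups
  in general; both cases run in parallel as \<open>Q\<close>, with \<open>Q'\<close> the opposite,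
  smooth point.

  The bounds 2 and 3 match because \<open>0\<close> is not a gap: at most \<open>r - 1\<close> gaps
  lie below \<open>r\<close>, one less than the term \<open>r\<close> in the gonality. For
  \<open>g \<le> 3\<close> the scroll is granted by convention, and gonality at most 3 is proved
  separately.\<close>

locale coeff_hom =
  fixes h :: "'a::field \<Rightarrow> 'b::field"
  assumes h_add: "h (a + b) = h a + h b" and h_mult: "h (a * b) = h a * h b" and h_1: "h 1 = 1"
begin

lemma h_0 [simp]: "h 0 = 0"
  by (metis add_0 add_left_cancel add_0_right h_add)

lemma h_eq_0_iff [simp]: "h a = 0 \<longleftrightarrow> a = 0"
proof
  assume "h a = 0"
  show "a = 0"
  proof (rule ccontr)
    assume "a \<noteq> 0"
    then have "h a * h (inverse a) = 1" using h_mult[of a "inverse a"] h_1 by simp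
    with \<open>h a = 0\<close> show False by simp
  qed
qed simp

definition sub :: "'a poly \<Rightarrow> 'b \<Rightarrow> 'b" where
  "sub p x = poly (map_poly h p) x"

lemma sub_0 [simp]: "sub 0 x = 0"
  by (simp add: sub_def)

lemma sub_pCons [simp]: "sub (pCons a p) x = h a + x * sub p x"
  by (simp add: sub_def map_poly_pCons)

lemma sub_1 [simp]: "sub 1 x = 1"
  by (simp add: one_pCons h_1)

lemma sub_add: "sub (p + q) x = sub p x + sub q x"
proof (induction p arbitrary: q)
  case (pCons a p)
  then show ?case by (cases q) (simp add: h_add algebra_simps)
qed simp

lemma sub_smult: "sub (smult a p) x = h a * sub p x"
  by (induction p) (simp_all add: h_mult algebra_simps)

lemma sub_mult: "sub (p * q) x = sub p x * sub q x"
  by (induction p) (simp_all add: sub_add sub_smult algebra_simps)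

lemma sub_power: "sub (p ^ n) x = sub p x ^ n"
  by (induction n) (simp_all add: sub_mult)

lemma sub_monom [simp]: "sub (monom a n) x = h a * x ^ n"
  by (induction n) (simp_all add: monom_0 monom_Suc algebra_simps)

lemma sub_pcompose: "sub (p \<circ>\<^sub>p q) x = sub p (sub q x)"
  by (induction p) (simp_all add: pcompose_pCons sub_add sub_mult)

lemma sub_sum: "sub (sum f A) x = (\<Sum>i\<in>A. sub (f i) x)"
  by (induction A rule: infinite_finite_induct) (simp_all add: sub_add)

end

global_interpretation crf: coeff_hom "const_rf :: 'k::field \<Rightarrow> 'k ratfun"
  defines rf_eval = crf.sub
  by unfold_locales (simp_all add: const_rf_add const_rf_mult const_rf_1)

global_interpretation cls: coeff_hom "fls_const :: 'k::field \<Rightarrow> 'k fls"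
  defines fls_eval = cls.sub
  by unfold_locales (simp_all add: fls_plus_const)

lemma fls_eval_X: "fls_eval p fls_X = fps_to_fls (fps_of_poly p)"
  by (induction p) (simp_all add: fps_of_poly_pCons fls_times_fps_to_fls algebra_simps)

lemma fls_eval_X_nth: "fls_nth (fls_eval p fls_X) i = (if i < 0 then 0 else coeff p (nat i))"
  by (simp add: fls_eval_X)

lemma fls_eval_X_eq_0_iff [simp]: "fls_eval p fls_X = 0 \<longleftrightarrow> p = 0"
  by (simp add: fls_eval_X)

lemma fls_eval_X_inv_nth:
  "fls_nth (fls_eval p fls_X_inv) i = (if i > 0 then 0 else coeff p (nat (- i)))"
proof (induction p arbitrary: i)
  case (pCons a p)
  show ?case
  proof (cases "i < 0")
    case True
    then have "nat (- i) = Suc (nat (- (i + 1)))" by simp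
    with True show ?thesis
      by (simp add: fls_X_inv_times_conv_shift pCons)
  qed (auto simp: fls_X_inv_times_conv_shift pCons)
qed simp

text \<open>The series \<open>t_at Q\<close> is transcendental over the constants. At
  \<open>None\<close> the leading coefficient survives as the lowest term; at \<open>Some c\<close>
  a translation by \<open>c\<close> reduces to powers of \<open>fls_X\<close>.\<close>

lemma fls_eval_t_at_neq_0: "p \<noteq> 0 \<Longrightarrow> fls_eval p (t_at Q) \<noteq> 0"
proof (cases Q)
  case None
  assume "p \<noteq> 0"
  then have "coeff p (degree p) \<noteq> 0" by simp
  then show ?thesis
    using fls_eval_X_inv_nth[of p "- int (degree p)"] None by auto
next
  case (Some c)
  assume "p \<noteq> 0"
  then have "p \<circ>\<^sub>p [:c, 1:] \<noteq> 0"
    by (simp add: pcompose_eq_0_iff)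
  moreover have "fls_eval (p \<circ>\<^sub>p [:c, 1:]) fls_X = fls_eval p (t_at Q)"
    by (simp add: Some cls.sub_pcompose)
  ultimately show ?thesis by (metis fls_eval_X_eq_0_iff)
qed

lemma expand_Fract:
  assumes "q \<noteq> 0"
  shows "expand Q (Fract p q) = fls_eval p (t_at Q) / fls_eval q (t_at Q)"
  unfolding expand_def cls.sub_def[symmetric]
proof (rule the_equality)
  show "\<exists>p' q'. q' \<noteq> 0 \<and> Fract p q = Fract p' q' \<and>
     fls_eval p (t_at Q) / fls_eval q (t_at Q) = fls_eval p' (t_at Q) / fls_eval q' (t_at Q)"
    using assms by blast
next
  fix y assume "\<exists>p' q'. q' \<noteq> 0 \<and> Fract p q = Fract p' q' \<and>
     y = fls_eval p' (t_at Q) / fls_eval q' (t_at Q)"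
  then obtain p' q' where *: "q' \<noteq> 0" "Fract p q = Fract p' q'"
     "y = fls_eval p' (t_at Q) / fls_eval q' (t_at Q)" by blast
  then have "p * q' = p' * q" using assms by (simp add: eq_fract)
  then have "fls_eval p (t_at Q) * fls_eval q' (t_at Q)
    = fls_eval p' (t_at Q) * fls_eval q (t_at Q)"
    by (metis cls.sub_mult)
  then show "y = fls_eval p (t_at Q) / fls_eval q (t_at Q)"
    using fls_eval_t_at_neq_0[OF assms, of Q] fls_eval_t_at_neq_0[OF *(1), of Q] *(3)
    by (simp add: frac_eq_eq)
qed

lemma expand_add: "expand Q (f + g) = expand Q f + expand Q g"
proof (cases f; cases g)
  fix a b c d assume "f = Fract a b" "b \<noteq> 0" "g = Fract c d" "d \<noteq> 0"
  then show ?thesis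
    using fls_eval_t_at_neq_0[of b Q] fls_eval_t_at_neq_0[of d Q]
    by (simp add: expand_Fract cls.sub_add cls.sub_mult add_frac_eq)
qed

lemma expand_mult: "expand Q (f * g) = expand Q f * expand Q g"
proof (cases f; cases g)
  fix a b c d assume "f = Fract a b" "b \<noteq> 0" "g = Fract c d" "d \<noteq> 0"
  then show ?thesis
    by (simp add: expand_Fract cls.sub_mult)
qed

lemma expand_const [simp]: "expand Q (const_rf c) = fls_const c"
  by (simp add: const_rf_def expand_Fract)

lemma expand_t [simp]: "expand Q t_rf = t_at Q"
  by (simp add: t_rf_def expand_Fract)

lemma expand_1 [simp]: "expand Q 1 = 1"
  by (metis expand_const const_rf_1 fls_const_1)

text \<open>Expansion is a field homomorphism, hence injective; this later allows functions to be
  compared through their coefficients.\<close>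

global_interpretation exq: coeff_hom "expand Q :: 'k::field ratfun \<Rightarrow> 'k fls" for Q
  by unfold_locales (simp_all add: expand_add expand_mult)

lemma expand_inverse: "expand Q (inverse f) = inverse (expand Q f)"
proof (cases "f = 0")
  case False
  then have "expand Q f * expand Q (inverse f) = 1"
    by (simp flip: expand_mult)
  then show ?thesis by (metis inverse_unique)
qed simp

lemma expand_power: "expand Q (f ^ n) = expand Q f ^ n"
  by (induction n) (simp_all add: expand_mult)

lemma expand_uminus: "expand Q (- f) = - expand Q f"
  by (metis add.right_inverse expand_add exq.h_0 minus_unique)

lemma expand_diff: "expand Q (f - g) = expand Q f - expand Q g"
  by (metis diff_conv_add_uminus expand_add expand_uminus)

lemma expand_sum: "expand Q (sum f A) = (\<Sum>i\<in>A. expand Q (f i))"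
  by (induction A rule: infinite_finite_induct) (simp_all add: expand_add)

lemma expand_scale: "expand Q (scale_rf c f) = fls_const c * expand Q f"
  by (simp add: scale_rf_def expand_mult)

lemma expand_eq_iff: "expand Q f = expand Q g \<longleftrightarrow> f = g"
  by (metis exq.h_eq_0_iff expand_diff right_minus_eq)

abbreviation coef :: "'k::field option \<Rightarrow> 'k ratfun \<Rightarrow> int \<Rightarrow> 'k" where
  "coef Q f \<equiv> fls_nth (expand Q f)"

definition ord_at :: "'k::field option \<Rightarrow> 'k ratfun \<Rightarrow> int" where
  "ord_at Q f = fls_subdegree (expand Q f)"

lemma ord_at_mult: "f \<noteq> 0 \<Longrightarrow> g \<noteq> 0 \<Longrightarrow> ord_at Q (f * g) = ord_at Q f + ord_at Q g"
  by (simp add: ord_at_def expand_mult)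

lemma ord_at_inverse: "ord_at Q (inverse f) = - ord_at Q f"
  by (cases "f = 0") (simp_all add: ord_at_def expand_inverse)

lemma ord_at_divide: "f \<noteq> 0 \<Longrightarrow> g \<noteq> 0 \<Longrightarrow> ord_at Q (f / g) = ord_at Q f - ord_at Q g"
  by (simp add: divide_inverse ord_at_mult ord_at_inverse)

lemma ord_at_power: "ord_at Q (f ^ n) = int n * ord_at Q f"
  by (simp add: ord_at_def expand_power fls_subdegree_pow)

lemma ord_at_power_int: "ord_at Q (f powi i) = i * ord_at Q f"
  by (simp add: power_int_def ord_at_power ord_at_inverse)

lemma ord_at_const [simp]: "ord_at Q (const_rf c) = 0"
  by (simp add: ord_at_def)

lemma ord_at_1 [simp]: "ord_at Q 1 = 0"
  by (simp add: ord_at_def)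

lemma ord_at_nth: "f \<noteq> 0 \<Longrightarrow> coef Q f (ord_at Q f) \<noteq> 0"
  by (simp add: ord_at_def)

lemma t_rf_neq_0 [simp]: "t_rf \<noteq> 0"
  by (simp add: t_rf_def Zero_fract_def eq_fract)

text \<open>A local parameter at \<open>Q\<close> whose expansion is exactly \<open>fls_X\<close>,
  so a polynomial in it expands to its own coefficients.\<close>

fun unif :: "'k::field option \<Rightarrow> 'k ratfun" where
  "unif (Some c) = t_rf - const_rf c"
| "unif None = inverse t_rf"

lemma expand_unif [simp]: "expand Q (unif Q) = fls_X"
  by (cases Q) (simp_all add: expand_diff expand_inverse fls_inverse_X_inv)

lemma unif_neq_0 [simp]: "unif Q \<noteq> 0"
  by (metis expand_unif exq.h_0 fls_X_nonzero)

lemma ord_at_unif [simp]: "ord_at Q (unif Q) = 1"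
  by (simp add: ord_at_def)

lemma expand_rf_eval_unif: "expand Q (rf_eval p (unif Q)) = fls_eval p fls_X"
  by (induction p) (simp_all add: expand_add expand_mult)

lemma expand_rf_eval_unif_nth:
  "coef Q (rf_eval p (unif Q)) i = (if i < 0 then 0 else coeff p (nat i))"
  by (simp add: expand_rf_eval_unif fls_eval_X_nth)

lemma rf_eval_unif_eq_0_iff [simp]: "rf_eval p (unif Q) = 0 \<longleftrightarrow> p = 0"
  by (metis exq.h_eq_0_iff expand_rf_eval_unif fls_eval_X_eq_0_iff)

lemma Fract_1_eq_rf_eval: "Fract p 1 = rf_eval p t_rf"
proof (induction p)
  case 0
  then show ?case by (simp add: Zero_fract_def)
next
  case (pCons a p)
  have "Fract (pCons a p) 1 = Fract [:a:] 1 + Fract [:0, 1:] 1 * Fract p 1"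
    by simp
  with pCons show ?case by (simp add: const_rf_def t_rf_def)
qed

lemma Fract_eq_rf_eval: "q \<noteq> 0 \<Longrightarrow> Fract p q = rf_eval p t_rf / rf_eval q t_rf"
  by (simp flip: Fract_1_eq_rf_eval)

lemma rf_eval_t_eq_0_iff [simp]: "rf_eval p t_rf = 0 \<longleftrightarrow> p = 0"
  by (simp add: Zero_fract_def eq_fract flip: Fract_1_eq_rf_eval)

text \<open>\<open>unif Q\<close> generates \<open>k(t)\<close> over \<open>k\<close>: the quotients
  of polynomials in it are closed under the field operations and contain the constants and
  \<open>t_rf\<close>.\<close>

lemma ratfun_quotient_unif:
  fixes f :: "'k::field ratfun"
  shows "\<exists>p q. q \<noteq> 0 \<and> f = rf_eval p (unif Q) / rf_eval q (unif Q)"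
proof -
  define K where "K = {f. \<exists>p q. q \<noteq> 0 \<and> f = rf_eval p (unif Q) / rf_eval q (unif Q)}"
  have add: "f + g \<in> K" and mult: "f * g \<in> K" and div: "f / g \<in> K"
    if fg: "f \<in> K" "g \<in> K" for f g
  proof -
    obtain p q p' q' where *: "q \<noteq> 0" "f = rf_eval p (unif Q) / rf_eval q (unif Q)"
      "q' \<noteq> 0" "g = rf_eval p' (unif Q) / rf_eval q' (unif Q)"
      using fg by (auto simp: K_def)
    have "f + g = rf_eval (p * q' + p' * q) (unif Q) / rf_eval (q * q') (unif Q)"
      using * by (simp add: crf.sub_add crf.sub_mult add_frac_eq)
    with * show "f + g \<in> K" unfolding K_def by (metis (mono_tags, lifting) mem_Collect_eq
      mult_eq_0_iff)
    have "f * g = rf_eval (p * p') (unif Q) / rf_eval (q * q') (unif Q)"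
      using * by (simp add: crf.sub_mult)
    with * show "f * g \<in> K" unfolding K_def by (metis (mono_tags, lifting) mem_Collect_eq
      mult_eq_0_iff)
    show "f / g \<in> K"
    proof (cases "p' = 0")
      case True
      then have "f / g = rf_eval 0 (unif Q) / rf_eval 1 (unif Q)" using * by simp
      then show ?thesis unfolding K_def by (metis (mono_tags, lifting) mem_Collect_eq zero_neq_one)
    next
      case False
      have "f / g = rf_eval (p * q') (unif Q) / rf_eval (q * p') (unif Q)"
        using * by (simp add: crf.sub_mult)
      with * False show ?thesis unfolding K_def
        by (metis (mono_tags, lifting) mem_Collect_eq mult_eq_0_iff)
    qed
  qed
  have poly: "rf_eval p (unif Q) \<in> K" for p
    unfolding K_def by (intro CollectI exI[of _ p] exI[of _ 1]) simp
  have const: "const_rf c \<in> K" for c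
    using poly[of "[:c:]"] by simp
  have w: "unif Q \<in> K"
    using poly[of "[:0, 1:]"] by (simp add: const_rf_1)
  have t: "t_rf \<in> K"
  proof (cases Q)
    case None
    then have "t_rf = const_rf 1 / unif Q" by (simp add: const_rf_1 divide_inverse)
    then show ?thesis using div[OF const w] by metis
  next
    case (Some c)
    then have "t_rf = const_rf c + unif Q" by simp
    then show ?thesis using add[OF const w] by metis
  qed
  have evt: "rf_eval p t_rf \<in> K" for p
    by (induction p) (use const[of 0] in \<open>auto intro!: add mult const t\<close>)
  have "f \<in> K"
    by (cases f) (auto simp: Fract_eq_rf_eval intro!: div evt)
  then show ?thesis by (auto simp: K_def)
qed

text \<open>Regularity at \<open>Q\<close> means that the power of \<open>unif Q\<close> dividing
  the denominator also divides the numerator; after cancelling it the denominator has a nonzero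
  constant term.\<close>

lemma ratfun_quotient_unif_unit:
  fixes f :: "'k::field ratfun"
  assumes "f = 0 \<or> 0 \<le> ord_at Q f"
  shows "\<exists>p q. coeff q 0 \<noteq> 0 \<and> f = rf_eval p (unif Q) / rf_eval q (unif Q)"
proof -
  obtain p q where q: "q \<noteq> 0" and f: "f = rf_eval p (unif Q) / rf_eval q (unif Q)"
    using ratfun_quotient_unif by blast
  have split: "\<exists>s. r = [:0, 1:] ^ order 0 r * s \<and> coeff s 0 \<noteq> 0" if "r \<noteq> 0" for r :: "'k poly"
  proof -
    obtain s where s: "r = [:0, 1:] ^ order 0 r * s" "\<not> [:0, 1:] dvd s"
      using order_decomp[of r 0] \<open>r \<noteq> 0\<close> by auto
    then have "coeff s 0 \<noteq> 0"
      using poly_eq_0_iff_dvd[of s 0] by (simp add: poly_0_coeff_0)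
    with s(1) show ?thesis by blast
  qed
  obtain q' where qq: "q = [:0, 1:] ^ order 0 q * q'" and c: "coeff q' 0 \<noteq> 0"
    using split[OF q] by blast
  have q': "rf_eval q (unif Q) = unif Q ^ order 0 q * rf_eval q' (unif Q)"
    using arg_cong[OF qq, of "\<lambda>p. rf_eval p (unif Q)"]
    by (simp add: crf.sub_mult crf.sub_power const_rf_1)
  show ?thesis
  proof (cases "f = 0")
    case True
    then show ?thesis by (intro exI[of _ 0] exI[of _ 1]) auto
  next
    case False
    then have p: "p \<noteq> 0" using f by auto
    have ordq: "ord_at Q (rf_eval r (unif Q)) = int (order 0 r)" if r: "r \<noteq> 0" for r
    proof -
      obtain s where s: "r = [:0, 1:] ^ order 0 r * s" and "coeff s 0 \<noteq> 0"
        using split[OF r] by blast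
      then have "ord_at Q (rf_eval s (unif Q)) = 0"
        unfolding ord_at_def by (intro fls_subdegree_eqI) (auto simp: expand_rf_eval_unif_nth)
      moreover have "rf_eval r (unif Q) = unif Q ^ order 0 r * rf_eval s (unif Q)"
        using arg_cong[OF s(1), of "\<lambda>p. rf_eval p (unif Q)"]
        by (simp add: crf.sub_mult crf.sub_power const_rf_1)
      moreover have "s \<noteq> 0" using \<open>coeff s 0 \<noteq> 0\<close> by auto
      ultimately show ?thesis by (simp add: ord_at_mult ord_at_power)
    qed
    have "order 0 q \<le> order 0 p"
      using assms False p q by (simp add: f ord_at_divide ordq)
    then have "[:0, 1:] ^ order 0 q dvd p"
      using order_1[of 0 p] by (metis le_imp_power_dvd dvd_trans minus_zero)
    then obtain p' where p': "p = [:0, 1:] ^ order 0 q * p'" by (elim dvdE)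
    have "rf_eval p (unif Q) = unif Q ^ order 0 q * rf_eval p' (unif Q)"
      unfolding p' by (simp add: crf.sub_mult crf.sub_power const_rf_1)
    then have "f = rf_eval p' (unif Q) / rf_eval q' (unif Q)"
      by (simp add: f q')
    with c show ?thesis by blast
  qed
qed

section \<open>Dimensions and orders\<close>

text \<open>The exchange argument below counts dimensions modulo a possibly infinite dimensional
  \<open>W\<close>; this first cuts \<open>W\<close> down to a finite part.\<close>

lemma (in vector_space) span_finite_subset:
  assumes "finite D" "D \<subseteq> span (B \<union> W)"
  shows "\<exists>T. finite T \<and> T \<subseteq> W \<and> D \<subseteq> span (B \<union> T)"
  using assms
proof (induction D)
  case (insert d D)
  then obtain T where T: "finite T" "T \<subseteq> W" "D \<subseteq> span (B \<union> T)" by auto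
  from insert.prems obtain t r where t: "finite t" "t \<subseteq> B \<union> W" "d = (\<Sum>a\<in>t. scale (r a) a)"
    unfolding span_explicit by auto
  have "d \<in> span (B \<union> (T \<union> (t \<inter> W)))"
    unfolding t(3) using t(2) by (intro span_sum span_scale span_base) auto
  moreover have "D \<subseteq> span (B \<union> (T \<union> (t \<inter> W)))"
    using T(3) span_mono[of "B \<union> T" "B \<union> (T \<union> (t \<inter> W))"] by auto
  ultimately show ?case using T t(1) by (intro exI[of _ "T \<union> (t \<inter> W)"]) auto
qed auto

text \<open>\<open>U\<close> is a finite dimensional space of representatives for
  \<open>V / W\<close>, so \<open>V / W\<close> is \<open>U / (U \<inter> W)\<close>.
  \<open>V\<close> and \<open>W\<close> themselves may have infinite dimension.\<close>

lemma quot_dim_eq: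
  assumes U: "kt.subspace U" and W: "kt.subspace W" and S: "U \<subseteq> kt.span S" "finite S"
    and UV: "U \<subseteq> V" and V: "\<And>v. v \<in> V \<Longrightarrow> \<exists>u\<in>U. \<exists>w\<in>W. v = u + w"
  shows "quot_dim V W + kt.dim (U \<inter> W) = kt.dim U"
proof -
  obtain C where C: "C \<subseteq> U \<inter> W" "kt.independent C" "U \<inter> W \<subseteq> kt.span C" "card C = kt.dim (U \<inter> W)"
    using kt.basis_exists by blast
  obtain W0 where W0: "C \<subseteq> W0" "W0 \<subseteq> W" "kt.independent W0" "W \<subseteq> kt.span W0"
    using kt.maximal_independent_subset_extend[of C W] C by auto
  obtain B' where B': "W0 \<subseteq> B'" "B' \<subseteq> W0 \<union> U" "kt.independent B'" "W0 \<union> U \<subseteq> kt.span B'"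
    using kt.maximal_independent_subset_extend[of W0 "W0 \<union> U"] W0 by auto
  \<comment> \<open>Independent modulo \<open>W\<close>, because it extends a basis of
    \<open>W\<close> to one of \<open>W + U\<close>.\<close>
  define D where "D = B' - W0"
  have DU: "D \<subseteq> U" using B'(2) by (auto simp: D_def)
  have indD: "kt.independent D"
    using B'(3) kt.independent_mono D_def by blast
  have finD: "finite D"
    using kt.independent_span_bound[OF S(2) indD] DU S(1) by blast
  have finC: "finite C"
    using kt.independent_span_bound[OF S(2) C(2)] C(1) S(1) by blast
  have spanD: "kt.span D \<subseteq> U"
    using DU U by (simp add: kt.span_minimal)
  have dimU: "card (C \<union> D) = kt.dim U"
  proof (rule kt.basis_card_eq_dim)
    show "C \<union> D \<subseteq> U" using C DU by auto
    show "kt.independent (C \<union> D)"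
      by (rule kt.independent_mono[OF B'(3)]) (use W0 B' in \<open>auto simp: D_def\<close>)
    show "U \<subseteq> kt.span (C \<union> D)"
    proof
      fix u assume u: "u \<in> U"
      have "B' = D \<union> W0" using B'(1) by (auto simp: D_def)
      then have "u \<in> kt.span (D \<union> W0)" using u B'(4) by auto
      then obtain x y where xy: "u = x + y" "x \<in> kt.span D" "y \<in> kt.span W0"
        unfolding kt.span_Un by auto
      have "y \<in> W" using xy(3) W0(2) W kt.span_minimal by blast
      moreover have "y \<in> U"
        using xy u spanD U kt.subspace_diff[OF U, of u x] by auto
      ultimately have "y \<in> kt.span C" using C(3) by auto
      then show "u \<in> kt.span (C \<union> D)"
        unfolding xy(1) using xy(2)
        by (intro kt.span_add) (meson kt.span_mono sup_ge1 sup_ge2 subsetD)+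
    qed
  qed
  have "card (C \<union> D) = card C + card D"
    using finC finD W0(1) by (intro card_Un_disjoint) (auto simp: D_def)
  moreover have "quot_dim V W = card D"
    unfolding quot_dim_def
  proof (rule Least_equality)
    have "V \<subseteq> kt.span (D \<union> W)"
    proof
      fix v assume "v \<in> V"
      then obtain u w where uw: "u \<in> U" "w \<in> W" "v = u + w" using V by blast
      have "u \<in> kt.span (D \<union> W)"
        using uw(1) B'(4) kt.span_mono[of B' "D \<union> W"] W0(2) by (auto simp: D_def)
      then show "v \<in> kt.span (D \<union> W)"
        unfolding uw(3) using uw(2) by (intro kt.span_add) (auto intro: kt.span_base)
    qed
    then show "\<exists>B. finite B \<and> card B = card D \<and> B \<subseteq> V \<and> V \<subseteq> kt.span (B \<union> W)"
      using finD DU UV by blast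
  next
    fix d assume "\<exists>B. finite B \<and> card B = d \<and> B \<subseteq> V \<and> V \<subseteq> kt.span (B \<union> W)"
    then obtain B where B: "finite B" "card B = d" "V \<subseteq> kt.span (B \<union> W)" by blast
    have "B \<union> W \<subseteq> kt.span (B \<union> W0)"
      using W0(4) kt.span_mono[of W0 "B \<union> W0"] kt.span_superset[of "B \<union> W0"] by auto
    then have "kt.span (B \<union> W) \<subseteq> kt.span (B \<union> W0)"
      by (simp add: kt.span_minimal)
    then have "D \<subseteq> kt.span (B \<union> W0)"
      by (rule order_trans[OF DU order_trans[OF UV order_trans[OF B(3)]]])
    from kt.span_finite_subset[OF finD this]
    obtain T where T: "finite T" "T \<subseteq> W0" "D \<subseteq> kt.span (B \<union> T)"
      by (elim exE conjE)
    \<comment> \<open>\<open>D\<close> stays independent together with any part of the basis of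
      \<open>W\<close>, and the cost of adding \<open>T\<close> cancels on both sides.\<close>
    have "card (D \<union> T) \<le> card (B \<union> T)"
    proof (rule conjunct2[OF kt.independent_span_bound])
      show "kt.independent (D \<union> T)"
        by (rule kt.independent_mono[OF B'(3)]) (use T B' in \<open>auto simp: D_def\<close>)
      show "D \<union> T \<subseteq> kt.span (B \<union> T)"
        using T(3) kt.span_superset[of "B \<union> T"] by auto
    qed (use B T in auto)
    moreover have "card (D \<union> T) = card D + card T"
      using finD T by (intro card_Un_disjoint) (auto simp: D_def)
    moreover have "card (B \<union> T) \<le> card B + card T" by (rule card_Un_le)
    ultimately show "card D \<le> d" using B(2) by simp
  qed
  ultimately show ?thesis using dimU C(4) by simp
qed

text \<open>The quotient of \<open>A + B\<close> by \<open>B\<close> is computed twice by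
  \<open>quot_dim_eq\<close>, with representatives from \<open>A + B\<close> and from
  \<open>A\<close>.\<close>

lemma dim_sum_Int:
  assumes A: "kt.subspace A" "A \<subseteq> kt.span S" and B: "kt.subspace B" "B \<subseteq> kt.span S" and "finite S"
  shows "kt.dim {x + y | x y. x \<in> A \<and> y \<in> B} + kt.dim (A \<inter> B) = kt.dim A + kt.dim B"
proof -
  let ?P = "{x + y | x y. x \<in> A \<and> y \<in> B}"
  have 0: "0 \<in> A" "0 \<in> B" using A B kt.subspace_0 by auto
  have P: "kt.subspace ?P" using A B by (intro kt.subspace_sums)
  have "?P \<subseteq> kt.span S" using A B by (auto intro: kt.span_add)
  then have "quot_dim ?P B + kt.dim (?P \<inter> B) = kt.dim ?P"
    by (rule quot_dim_eq[OF P B(1) _ \<open>finite S\<close>]) (use 0 in force)+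
  moreover have "quot_dim ?P B + kt.dim (A \<inter> B) = kt.dim A"
    by (rule quot_dim_eq[OF A(1) B(1) A(2) \<open>finite S\<close>]) (use 0 in force)+
  moreover have "?P \<inter> B = B"
  proof (intro equalityI subsetI)
    fix x assume "x \<in> B"
    then show "x \<in> ?P \<inter> B"
      using 0(1) by (intro IntI CollectI exI[of _ 0] exI[of _ x]) simp_all
  qed simp
  ultimately show ?thesis by simp
qed

global_interpretation mul: Vector_Spaces.linear scale_rf scale_rf "(*) (h::'k::field ratfun)" for h
  by unfold_locales (simp_all add: scale_rf_def algebra_simps)

lemma span_mult_image: "kt.span ((*) h ` S) = (*) h ` kt.span S"
  by (rule mul.span_image)

lemma dim_mult_image:
  assumes "h \<noteq> 0" shows "kt.dim ((*) h ` V) = kt.dim V"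
proof -
  obtain B where B: "B \<subseteq> V" "kt.independent B" "V \<subseteq> kt.span B" "card B = kt.dim V"
    using kt.basis_exists by blast
  have inj: "inj_on ((*) h) X" for X using assms by (auto simp: inj_on_def)
  have "card ((*) h ` B) = kt.dim ((*) h ` V)"
  proof (rule kt.basis_card_eq_dim)
    show "(*) h ` V \<subseteq> kt.span ((*) h ` B)"
      unfolding span_mult_image using B(3) by (rule image_mono)
    show "kt.independent ((*) h ` B)"
      by (rule mul.independent_injective_image[OF B(2) inj])
  qed (use B(1) in blast)
  then show ?thesis using B(4) card_image[OF inj, of B] by simp
qed

lemma quot_dim_mult_image:
  assumes "h \<noteq> 0" shows "quot_dim ((*) h ` V) ((*) h ` W) = quot_dim V W"
proof -
  have le: "(\<exists>B. finite B \<and> card B = d \<and> B \<subseteq> (*) h ` V \<and> (*) h ` V \<subseteq> kt.span (B \<union> (*) h ` W))"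
    if "\<exists>B. finite B \<and> card B = d \<and> B \<subseteq> V \<and> V \<subseteq> kt.span (B \<union> W)" "h \<noteq> 0"
    for d V W and h :: "'a ratfun"
  proof -
    obtain B where B: "finite B" "card B = d" "B \<subseteq> V" "V \<subseteq> kt.span (B \<union> W)"
      using \<open>\<exists>B. _ B\<close> by blast
    have "card ((*) h ` B) = d" using B(2) \<open>h \<noteq> 0\<close> by (subst card_image) (auto simp: inj_on_def)
    moreover have "(*) h ` V \<subseteq> kt.span ((*) h ` B \<union> (*) h ` W)"
      using B(4) by (auto simp: span_mult_image simp flip: image_Un)
    ultimately show ?thesis using B by (intro exI[of _ "(*) h ` B"]) auto
  qed
  have inv: "(*) (inverse h) ` (*) h ` X = X" for X :: "'a ratfun set"
    using assms by (auto simp: image_image mult.assoc[symmetric])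
  show ?thesis
    unfolding quot_dim_def
    by (rule arg_cong[where f = Least], rule ext, rule iffI)
      (use le[of _ "(*) h ` V" "(*) h ` W" "inverse h"] le[of _ V W h] assms in \<open>simp_all add: inv\<close>)
qed

text \<open>Phrased by coefficients rather than by \<open>ord_at\<close>, so that \<open>0\<close>
  is included and linearity is immediate.\<close>

definition ord_ge :: "'k::field option \<Rightarrow> int \<Rightarrow> 'k ratfun set" where
  "ord_ge Q m = {f. \<forall>i<m. coef Q f i = 0}"

lemma ord_ge_iff: "f \<in> ord_ge Q m \<longleftrightarrow> f = 0 \<or> m \<le> ord_at Q f"
proof (cases "f = 0")
  case False
  then show ?thesis
    unfolding ord_ge_def ord_at_def
    by (auto intro!: fls_subdegree_geI)
qed (simp add: ord_ge_def)

lemma expand_scale_nth: "coef Q (scale_rf c f) i = c * coef Q f i"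
  by (simp add: expand_scale)

lemma expand_0 [simp]: "expand Q 0 = 0"
  by (rule exq.h_0)

lemma subspace_ord_ge: "kt.subspace (ord_ge Q m)"
  by (auto simp: kt.subspace_def ord_ge_def expand_add expand_scale_nth)

text \<open>Two elements of equal order agree up to a scalar modulo higher order, because
  coefficients lie in \<open>k\<close>. Splitting off one element \<open>b\<close> of lowest order
  therefore removes exactly one order.\<close>

lemma finite_ords_basis:
  assumes "kt.subspace W" "finite (ord_at Q ` (W - {0}))"
  shows "\<exists>B. finite B \<and> kt.independent B \<and> kt.span B = W \<and> card B = card (ord_at Q ` (W - {0}))"
  using assms
proof (induction "card (ord_at Q ` (W - {0}))" arbitrary: W)
  case 0
  then have "W = {0}" using kt.subspace_0[of W] by auto
  then show ?case by (intro exI[of _ "{}"]) (simp add: kt.independent_empty)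
next
  case (Suc n)
  define E where "E = ord_at Q ` (W - {0})"
  define m where "m = Min E"
  have E: "finite E" "E \<noteq> {}"
    unfolding E_def using Suc.prems(2) Suc.hyps(2) by (metis, metis card.empty nat.distinct(1))
  then have "m \<in> E" unfolding m_def by simp
  then obtain b where b: "b \<in> W" "b \<noteq> 0" "ord_at Q b = m" by (auto simp: E_def)
  have mE: "m \<le> i" if "i \<in> E" for i unfolding m_def using E that by simp
  define W' where "W' = W \<inter> ord_ge Q (m + 1)"
  have sub: "kt.subspace W'"
    unfolding W'_def using Suc(3) subspace_ord_ge by (rule kt.subspace_inter)
  have E': "ord_at Q ` (W' - {0}) = E - {m}"
  proof -
    have "ord_at Q ` (W' - {0}) \<subseteq> E - {m}"
      by (auto simp: W'_def E_def ord_ge_iff)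
    moreover have "i \<in> ord_at Q ` (W' - {0})" if i: "i \<in> E" "i \<noteq> m" for i
    proof -
      obtain f where f: "f \<in> W" "f \<noteq> 0" "i = ord_at Q f" using i(1) by (auto simp: E_def)
      then have "f \<in> W' - {0}" using i mE[of i] by (simp add: W'_def ord_ge_iff)
      then show ?thesis using f(3) by blast
    qed
    then have "E - {m} \<subseteq> ord_at Q ` (W' - {0})"
      by (intro subsetI) simp
    ultimately show ?thesis by (rule equalityI)
  qed
  have "n = card (ord_at Q ` (W' - {0}))"
    using Suc(2) E \<open>m \<in> E\<close> unfolding E' E_def[symmetric] by simp
  then have "\<exists>B. finite B \<and> kt.independent B \<and> kt.span B = W' \<and> card B = card (E - {m})"
    using Suc(1)[OF _ sub] E(1) unfolding E' by simp
  then obtain B where B: "finite B" "kt.independent B" "kt.span B = W'" "card B = card (E - {m})"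
    by (elim exE conjE)
  have "b \<notin> W'" using b by (auto simp: W'_def ord_ge_iff)
  moreover have "W \<subseteq> kt.span (insert b B)"
  proof
    fix f assume f: "f \<in> W"
    define c where "c = coef Q f m / coef Q b m"
    have nb: "coef Q b m \<noteq> 0" using ord_at_nth[OF b(2), of Q] b(3) by simp
    have low: "coef Q g i = 0" if "i < m" "g \<in> W" for g i
    proof (cases "g = 0")
      case False
      then have "m \<le> ord_at Q g" using mE that by (auto simp: E_def)
      then show ?thesis using \<open>i < m\<close> by (simp add: ord_at_def)
    qed simp
    have "f - scale_rf c b \<in> W'"
      unfolding W'_def
    proof
      show "f - scale_rf c b \<in> W"
        using Suc(3) f b by (intro kt.subspace_diff kt.subspace_scale) auto
      have "coef Q (f - scale_rf c b) i = 0" if "i < m + 1" for i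
        using that nb low[of i f] low[of i b] f b
        by (cases "i = m") (auto simp: expand_diff expand_scale_nth c_def)
      then show "f - scale_rf c b \<in> ord_ge Q (m + 1)" by (simp add: ord_ge_def)
    qed
    then have "f - scale_rf c b \<in> kt.span B" using B by simp
    then show "f \<in> kt.span (insert b B)" unfolding kt.span_insert by blast
  qed
  moreover have "kt.span (insert b B) \<subseteq> W"
    using kt.span_superset[of B] B(3) b Suc(3) by (intro kt.span_minimal) (auto simp: W'_def)
  moreover have "kt.independent (insert b B)"
    using \<open>b \<notin> W'\<close> B by (intro kt.independent_insertI) auto
  moreover have "b \<notin> B" using \<open>b \<notin> W'\<close> B(3) kt.span_superset by blast
  moreover have "card (insert b B) = card E"
    using B(1,4) \<open>b \<notin> B\<close> card_Suc_Diff1[OF E(1) \<open>m \<in> E\<close>] by simp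
  ultimately show ?case using B(1) unfolding E_def
    by (intro exI[of _ "insert b B"]) auto
qed

lemma dim_eq_card_ords:
  assumes "kt.subspace W" "finite (ord_at Q ` (W - {0}))"
  shows "kt.dim W = card (ord_at Q ` (W - {0}))"
  using finite_ords_basis[OF assms] kt.dim_span_eq_card_independent by metis

section \<open>Laurent polynomials\<close>

lemma rf_eval_t_unif: "rf_eval p t_rf = rf_eval (p \<circ>\<^sub>p [:c, 1:]) (unif (Some c))"
  by (simp add: crf.sub_pcompose const_rf_1)

lemma rf_eval_t_in_ord_ge: "rf_eval p t_rf \<in> ord_ge (Some c) 0"
  by (simp add: ord_ge_def rf_eval_t_unif[of p c] expand_rf_eval_unif_nth del: unif.simps)

lemma expand_rf_eval_t_nth_0: "coef (Some c) (rf_eval p t_rf) 0 = poly p c"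
  by (simp add: rf_eval_t_unif[of p c] expand_rf_eval_unif_nth flip: poly_0_coeff_0 del: unif.simps)
    (simp add: poly_pcompose)

lemma ord_at_rf_eval_t_ge: "p \<noteq> 0 \<Longrightarrow> 0 \<le> ord_at (Some c) (rf_eval p t_rf)"
  using rf_eval_t_in_ord_ge[of p c] by (simp add: ord_ge_iff)

lemma ord_at_rf_eval_t_eq_0:
  assumes "poly p c \<noteq> 0" shows "ord_at (Some c) (rf_eval p t_rf) = 0"
  unfolding ord_at_def
  by (intro fls_subdegree_eqI)
    (use assms rf_eval_t_in_ord_ge[of p c] in \<open>auto simp: ord_ge_def expand_rf_eval_t_nth_0\<close>)

lemma ord_at_rf_eval_t_pos:
  assumes "poly p c = 0" "p \<noteq> 0" shows "0 < ord_at (Some c) (rf_eval p t_rf)"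
proof -
  have "ord_at (Some c) (rf_eval p t_rf) \<noteq> 0"
    using ord_at_nth[of "rf_eval p t_rf" "Some c"] assms expand_rf_eval_t_nth_0[of c p] by auto
  then show ?thesis using ord_at_rf_eval_t_ge[OF assms(2), of c] by simp
qed

text \<open>The functions regular on the projective line without \<open>0\<close> and infinity. Over
  an algebraically closed field these are the Laurent polynomials, by
  \<open>laurent_quotient\<close>.\<close>

definition laurent :: "'k::field ratfun set" where
  "laurent = {f. \<forall>c. c \<noteq> 0 \<longrightarrow> f \<in> ord_ge (Some c) 0}"

lemma subspace_laurent: "kt.subspace laurent"
  using subspace_ord_ge by (auto simp: laurent_def kt.subspace_def)

lemma ord_at_t: "c \<noteq> 0 \<Longrightarrow> ord_at (Some c) t_rf = 0"
  using ord_at_rf_eval_t_eq_0[of "[:0, 1:]" c] by (simp add: const_rf_1)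

lemma ord_at_t_0 [simp]: "ord_at (Some 0) t_rf = 1"
  using ord_at_unif[of "Some 0"] by simp

lemma ord_at_t_None [simp]: "ord_at None (t_rf :: 'k::field ratfun) = - 1"
  using ord_at_inverse[of None "t_rf :: 'k ratfun"] ord_at_unif[of "None :: 'k option"]
  unfolding unif.simps by linarith

text \<open>In a fraction with denominator of least degree, a root \<open>c \<noteq> 0\<close> of
  the denominator is a root of the numerator by regularity, and cancelling contradicts minimality.
  So \<open>0\<close> is the only possible root, and the denominator is a power of \<open>t\<close>
  up to a constant.\<close>

lemma laurent_quotient:
  fixes f :: "'k::alg_closed_field ratfun"
  assumes "f \<in> laurent"
  shows "\<exists>p n. f = rf_eval p t_rf / t_rf ^ n"
proof (cases "f = 0")
  case True
  then show ?thesis by (intro exI[of _ 0]) simp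
next
  case False
  define P where "P d \<longleftrightarrow> (\<exists>p q. q \<noteq> 0 \<and> degree q = d \<and> f = rf_eval p t_rf / rf_eval q t_rf)" for d
  have "\<exists>d. P d"
    by (cases f) (auto simp: P_def Fract_eq_rf_eval)
  then obtain d where d: "P d" "\<And>d'. d' < d \<Longrightarrow> \<not> P d'"
    using exists_least_iff[of P] by blast
  then obtain p q where pq: "q \<noteq> 0" "degree q = d" "f = rf_eval p t_rf / rf_eval q t_rf"
    by (auto simp: P_def)
  have p0: "p \<noteq> 0" using pq(3) False by auto
  have root: "c = 0" if "poly q c = 0" for c
  proof (rule ccontr)
    assume "c \<noteq> 0"
    have "poly p c = 0"
    proof (rule ccontr)
      assume "poly p c \<noteq> 0"
      then have "ord_at (Some c) f < 0"
        using ord_at_rf_eval_t_pos[OF that pq(1)] ord_at_rf_eval_t_eq_0[of p c] pq(1) p0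
        by (simp add: pq(3) ord_at_divide)
      then show False
        using assms \<open>c \<noteq> 0\<close> False by (auto simp: laurent_def ord_ge_iff)
    qed
    then have "[:-c, 1:] dvd p" "[:-c, 1:] dvd q" using that by (simp_all add: poly_eq_0_iff_dvd)
    then obtain p' q' where *: "p = [:-c, 1:] * p'" "q = [:-c, 1:] * q'"
      by (metis dvdE)
    have "q' \<noteq> 0" using pq(1) *(2) by auto
    then have "degree q' < d" using pq(2) unfolding *(2) by (subst (asm) degree_mult_eq) auto
    moreover have "f = rf_eval p' t_rf / rf_eval q' t_rf"
    proof -
      have "rf_eval [:-c, 1:] t_rf \<noteq> 0" by (subst rf_eval_t_eq_0_iff) simp
      then show ?thesis unfolding pq(3) *(1) *(2) crf.sub_mult
        by (rule mult_divide_mult_cancel_left)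
    qed
    ultimately show False using d(2) \<open>q' \<noteq> 0\<close> unfolding P_def by blast
  qed
  obtain s where s: "q = [:0, 1:] ^ order 0 q * s" "\<not> [:0, 1:] dvd s"
    using order_decomp[of q 0] pq(1) by auto
  have "degree s = 0"
  proof (rule ccontr)
    assume "degree s \<noteq> 0"
    then obtain c where c: "poly s c = 0" using alg_closed_imp_poly_has_root[of s] by auto
    then have "poly q c = 0" by (subst s(1)) simp
    then have "c = 0" by (rule root)
    with c s(2) show False by (simp add: poly_eq_0_iff_dvd)
  qed
  then obtain a where a: "s = [:a:]" by (rule degree_eq_zeroE)
  have "a \<noteq> 0" using s(1) a pq(1) by auto
  define k where "k = order 0 q"
  have q: "q = [:0, 1:] ^ k * [:a:]" using s(1) a k_def by simp
  have "f = rf_eval (smult (inverse a) p) t_rf / t_rf ^ k"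
  proof -
    have "const_rf (inverse a) = inverse (const_rf a :: 'k ratfun)"
      using \<open>a \<noteq> 0\<close> by (intro inverse_unique[symmetric]) (simp flip: const_rf_mult add: const_rf_1)
    then show ?thesis
      unfolding pq(3) q by (simp add: crf.sub_mult crf.sub_power crf.sub_smult const_rf_1
        field_simps)
  qed
  then show ?thesis by blast
qed

lemma expand_quotient_t_power_0:
  "coef (Some 0) (rf_eval p t_rf / t_rf ^ n) i
    = (if i + int n < 0 then 0 else coeff p (nat (i + int n)))"
proof -
  have "expand (Some 0) (rf_eval p t_rf) = fls_eval p fls_X"
    using expand_rf_eval_unif[of "Some 0" p] by simp
  then have "expand (Some 0) (rf_eval p t_rf / t_rf ^ n) = fls_eval p fls_X * fls_X_inv ^ n"
    by (simp add: divide_inverse expand_mult expand_inverse expand_power power_inverse[symmetric]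
        fls_inverse_X)
  then show ?thesis by (simp add: fls_X_inv_power_times_conv_shift fls_eval_X_nth)
qed

lemma expand_quotient_t_power_None:
  "coef None (rf_eval p t_rf / t_rf ^ n) i = (if i > int n then 0 else coeff p (nat (int n - i)))"
proof -
  have "expand None (rf_eval p t_rf) = fls_eval p fls_X_inv"
    by (induction p) (simp_all add: expand_add expand_mult)
  then have "expand None (rf_eval p t_rf / t_rf ^ n) = fls_eval p fls_X_inv * fls_X ^ n"
    by (simp add: divide_inverse expand_mult expand_inverse expand_power power_inverse[symmetric]
        fls_inverse_X_inv)
  then show ?thesis by (simp add: fls_X_power_times_conv_shift fls_eval_X_inv_nth)
qed

lemma quotient_t_power_in_laurent: "rf_eval p t_rf / t_rf ^ n \<in> laurent"
proof -
  have "rf_eval p t_rf / t_rf ^ n \<in> ord_ge (Some c) 0" if "c \<noteq> 0" for c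
    using ord_at_rf_eval_t_ge[of p c] that
    by (cases "p = 0") (auto simp: ord_ge_iff ord_at_divide ord_at_power ord_at_t)
  then show ?thesis by (simp add: laurent_def)
qed

text \<open>Both expansions list the coefficients of one Laurent polynomial, in opposite
  directions.\<close>

lemma laurent_expand_None:
  fixes f :: "'k::alg_closed_field ratfun"
  assumes "f \<in> laurent"
  shows "coef None f i = coef (Some 0) f (- i)"
  using laurent_quotient[OF assms]
  by (auto simp: expand_quotient_t_power_0 expand_quotient_t_power_None)

lemma laurent_restrict:
  fixes f :: "'k::alg_closed_field ratfun"
  assumes "f \<in> laurent"
  obtains g where "g \<in> laurent"
    "\<And>i. coef (Some 0) g i = (if i \<in> I then coef (Some 0) f i else 0)"
proof -
  obtain p n where f: "f = rf_eval p t_rf / t_rf ^ n" using laurent_quotient[OF assms] by blast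
  define J where "J = {j. j \<le> degree p \<and> int j - int n \<in> I}"
  define r where "r = (\<Sum>j\<in>J. monom (coeff p j) j)"
  have "finite J" by (simp add: J_def)
  then have "coeff r j = (if j \<in> J then coeff p j else 0)" for j
    by (simp add: r_def coeff_sum sum.delta)
  then have r: "coeff r j = (if int j - int n \<in> I then coeff p j else 0)" for j
    by (auto simp: J_def coeff_eq_0)
  show ?thesis
  proof
    show "rf_eval r t_rf / t_rf ^ n \<in> laurent" by (rule quotient_t_power_in_laurent)
    show "coef (Some 0) (rf_eval r t_rf / t_rf ^ n) i =
      (if i \<in> I then coef (Some 0) f i else 0)" for i
      by (auto simp: f expand_quotient_t_power_0 r)
  qed
qed

text \<open>At least one of \<open>nat i\<close> and \<open>nat (- i)\<close> is zero, so both signs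
  of \<open>i\<close> are covered.\<close>

lemma t_power_int_quotient: "t_rf powi i = rf_eval (monom 1 (nat i)) t_rf / t_rf ^ nat (- i)"
  by (auto simp: power_int_def const_rf_1 field_simps)

lemma t_power_int_in_laurent [simp]: "t_rf powi i \<in> laurent"
  unfolding t_power_int_quotient by (rule quotient_t_power_in_laurent)

lemma expand_t_power_int: "coef (Some 0) (t_rf powi i) j = (if j = i then 1 else 0)"
  unfolding t_power_int_quotient expand_quotient_t_power_0 by auto

lemma laurent_eqI:
  "(\<And>i. coef (Some 0) f i = coef (Some 0) g i) \<Longrightarrow> f = g"
  by (metis expand_eq_iff fls_eqI)

text \<open>The lowest exponent is at most the highest, and the latter is minus the order at
  infinity.\<close>

lemma ord_at_None_laurent:
  fixes f :: "'k::alg_closed_field ratfun"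
  assumes "f \<in> laurent" "f \<noteq> 0"
  shows "ord_at (Some 0) f \<le> - ord_at None f"
proof -
  have "coef (Some 0) f (- ord_at None f) \<noteq> 0"
    using ord_at_nth[OF assms(2), of None] laurent_expand_None[OF assms(1)] by simp
  then show ?thesis unfolding ord_at_def[of "Some 0"] by (rule fls_subdegree_leI)
qed

text \<open>The Laurent polynomials with exponents in \<open>[-N, N]\<close>, a finite dimensional
  window for the index computation.\<close>

definition laurent_box :: "nat \<Rightarrow> 'k::field ratfun set" where
  "laurent_box N = laurent \<inter> ord_ge (Some 0) (- int N) \<inter> ord_ge None (- int N)"

lemma subspace_laurent_box: "kt.subspace (laurent_box N)"
  unfolding laurent_box_def by (intro kt.subspace_inter subspace_laurent subspace_ord_ge)

lemma laurent_box_iff: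
  fixes f :: "'k::alg_closed_field ratfun"
  assumes "f \<in> laurent" and Q: "Q = Some 0 \<or> Q = None"
  shows "f \<in> laurent_box N \<longleftrightarrow> (\<forall>i. int N < \<bar>i\<bar> \<longrightarrow> coef Q f i = 0)"
proof -
  have None: "f \<in> ord_ge None (- int N) \<longleftrightarrow> (\<forall>i. int N < i \<longrightarrow> coef (Some 0) f i = 0)"
    using laurent_expand_None[OF assms(1)]
    by (auto simp: ord_ge_def) (metis minus_less_iff minus_minus)
  moreover have "f \<in> ord_ge (Some 0) (- int N) \<longleftrightarrow> (\<forall>i. i < - int N \<longrightarrow> coef (Some 0) f i = 0)"
    by (simp add: ord_ge_def)
  moreover have "int N < \<bar>i\<bar> \<longleftrightarrow> int N < i \<or> i < - int N" for i by auto
  ultimately have "f \<in> laurent_box N \<longleftrightarrow> (\<forall>i. int N < \<bar>i\<bar> \<longrightarrow> coef (Some 0) f i = 0)"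
    using assms(1) by (auto simp: laurent_box_def)
  also have "\<dots> \<longleftrightarrow> (\<forall>i. int N < \<bar>i\<bar> \<longrightarrow> coef Q f i = 0)"
    using Q laurent_expand_None[OF assms(1)] by (metis abs_minus_cancel minus_minus)
  finally show ?thesis .
qed

lemmas laurent_box_iff_0 = laurent_box_iff[where Q = "Some 0", simplified]

lemma ords_laurent_box: "ord_at (Some 0) ` (laurent_box N - {0 :: 'k::alg_closed_field ratfun})
  = {- int N..int N}"
proof (intro equalityI subsetI)
  fix i assume "i \<in> ord_at (Some 0) ` (laurent_box N - {0 :: 'k ratfun})"
  then obtain f :: "'k ratfun" where f: "f \<in> laurent_box N" "f \<noteq> 0" "i = ord_at (Some 0) f" by auto
  then have "\<not> int N < \<bar>i\<bar>"
    using laurent_box_iff_0[of f N] ord_at_nth[of f "Some 0"] by (auto simp: laurent_box_def)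
  then show "i \<in> {- int N..int N}" by auto
next
  fix i assume i: "i \<in> {- int N..int N}"
  have "t_rf powi i \<in> laurent_box N - {0 :: 'k ratfun}"
    using i by (auto simp: laurent_box_iff_0 expand_t_power_int)
  moreover have "ord_at (Some 0) (t_rf powi i :: 'k ratfun) = i" by (simp add: ord_at_power_int)
  ultimately show "i \<in> ord_at (Some 0) ` (laurent_box N - {0 :: 'k ratfun})" by (metis imageI)
qed

lemma laurent_box_basis:
  "\<exists>S. finite S \<and> kt.independent S \<and> kt.span S = (laurent_box N :: 'k ratfun set) \<and>
    kt.dim (laurent_box N :: 'k::alg_closed_field ratfun set) = 2 * N + 1"
  using finite_ords_basis[OF subspace_laurent_box[where ?'a = 'k, of N], of "Some 0"]
    dim_eq_card_ords[OF subspace_laurent_box[where ?'a = 'k, of N], of "Some 0"]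
  by (auto simp: ords_laurent_box)

lemma laurent_restrict_at:
  fixes f :: "'k::alg_closed_field ratfun"
  assumes f: "f \<in> laurent" and Q: "Q = Some 0 \<or> Q = None"
  obtains g where "g \<in> laurent"
    "\<And>i. coef Q g i = (if i \<in> I then coef Q f i else 0)"
proof (cases "Q = None")
  case True
  obtain g where g: "g \<in> laurent" "\<And>i. coef (Some 0) g i =
      (if i \<in> uminus ` I then coef (Some 0) f i else 0)"
    using laurent_restrict[OF f] by metis
  then show ?thesis using that[OF g(1)] True by (auto simp: laurent_expand_None f image_iff)
next
  case False
  then show ?thesis using Q laurent_restrict[OF f, of I] that by auto
qed

text \<open>Truncating an element of \<open>A\<close> after order \<open>N\<close> at
  \<open>Q\<close> changes it by something of order above \<open>N\<close>, which \<open>A\<close>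
  contains. So the truncation stays in \<open>A\<close>, lies in the window and keeps its
  order.\<close>

lemma ords_Int_box:
  fixes A :: "'k::alg_closed_field ratfun set"
  assumes Q: "Q = Some 0 \<or> Q = None"
    and A: "kt.subspace A" "A \<subseteq> laurent" "A \<subseteq> ord_ge Q (- int N)"
    "laurent \<inter> ord_ge Q (int N + 1) \<subseteq> A"
  shows "ord_at Q ` (A \<inter> laurent_box N - {0}) = ord_at Q ` (A - {0}) \<inter> {..int N}"
proof (intro equalityI subsetI)
  fix i assume "i \<in> ord_at Q ` (A \<inter> laurent_box N - {0})"
  then obtain f where f: "f \<in> A" "f \<in> laurent_box N" "f \<noteq> 0" "i = ord_at Q f" by auto
  then have "\<not> int N < \<bar>i\<bar>"
    using laurent_box_iff[OF _ Q, of f N] ord_at_nth[of f Q] by (auto simp: laurent_box_def)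
  with f show "i \<in> ord_at Q ` (A - {0}) \<inter> {..int N}" by auto
next
  fix i assume "i \<in> ord_at Q ` (A - {0}) \<inter> {..int N}"
  then obtain f where f: "f \<in> A" "f \<noteq> 0" "i = ord_at Q f" "i \<le> int N" by auto
  have fl: "f \<in> laurent" using f(1) A(2) by blast
  obtain g where g: "g \<in> laurent"
    "\<And>j. coef Q g j = (if j \<in> {..int N} then coef Q f j else 0)"
    using laurent_restrict_at[OF fl Q] by metis
  have "f - g \<in> laurent \<inter> ord_ge Q (int N + 1)"
    using fl g by (auto intro!: kt.subspace_diff subspace_laurent simp: ord_ge_def expand_diff)
  then have "f - g \<in> A" using A(4) by blast
  then have "g \<in> A" using kt.subspace_diff[OF A(1) f(1), of "f - g"] by simp
  moreover have "g \<in> laurent_box N"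
    using f(1) A(3) g(2) unfolding laurent_box_iff[OF g(1) Q]
      by (auto simp: ord_ge_def abs_if split: if_splits)
  moreover have nz: "coef Q g i \<noteq> 0"
    using g(2) f ord_at_nth[OF f(2), of Q] by simp
  moreover have "g \<noteq> 0" using nz by auto
  moreover have "ord_at Q g = i"
    unfolding ord_at_def using nz by (intro fls_subdegree_eqI) (auto simp: g(2) f(3) ord_at_def)
  ultimately show "i \<in> ord_at Q ` (A \<inter> laurent_box N - {0})" by blast
qed

text \<open>The Euler characteristic of a sheaf with sections \<open>A\<close> and \<open>B\<close> over the two affine charts.\<close>

lemma laurent_index:
  fixes A B :: "'k::alg_closed_field ratfun set"
  assumes A: "kt.subspace A" "A \<subseteq> laurent" "A \<subseteq> ord_ge (Some 0) (- int N)"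
    "laurent \<inter> ord_ge (Some 0) (int N + 1) \<subseteq> A"
  assumes B: "kt.subspace B" "B \<subseteq> laurent" "B \<subseteq> ord_ge None (- int N)"
    "laurent \<inter> ord_ge None (int N + 1) \<subseteq> B"
  shows "int (kt.dim (A \<inter> B)) - int (quot_dim laurent {f + g | f g. f \<in> A \<and> g \<in> B}) =
     int (card (ord_at (Some 0) ` (A - {0}) \<inter> {..int N})) +
     int (card (ord_at None ` (B - {0}) \<inter> {..int N})) - (2 * int N + 1)"
proof -
  let ?X = "laurent_box N :: 'k ratfun set"
  let ?P = "{f + g | f g. f \<in> A \<and> g \<in> B}"
  obtain S where S: "finite S" "kt.span S = ?X" "kt.dim ?X = 2 * N + 1"
    using laurent_box_basis[where ?'k = 'k, of N] by blast
  have subX: "kt.subspace ?X" by (rule subspace_laurent_box)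
  have subP: "kt.subspace ?P" using A(1) B(1) by (rule kt.subspace_sums)
  \<comment> \<open>The window represents the whole quotient: exponents above \<open>N\<close> are
    absorbed by \<open>A\<close>, those below \<open>-N\<close> by \<open>B\<close>.\<close>
  have "quot_dim laurent ?P + kt.dim (?X \<inter> ?P) = kt.dim ?X"
  proof (rule quot_dim_eq[OF subX subP _ S(1)])
    show "?X \<subseteq> kt.span S" using S by simp
    show "?X \<subseteq> laurent" by (auto simp: laurent_box_def)
  next
    fix v :: "'k ratfun" assume v: "v \<in> laurent"
    let ?c = "\<lambda>f. coef (Some 0) f"
    obtain u where u: "u \<in> laurent" "\<And>i. ?c u i = (if i \<in> {- int N..int N} then ?c v i else 0)"
      using laurent_restrict[OF v] by metis
    obtain a where a: "a \<in> laurent" "\<And>i. ?c a i = (if i \<in> {int N<..} then ?c v i else 0)"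
      using laurent_restrict[OF v] by metis
    obtain b where b: "b \<in> laurent" "\<And>i. ?c b i = (if i \<in> {..<- int N} then ?c v i else 0)"
      using laurent_restrict[OF v] by metis
    have "a \<in> A" using a by (intro subsetD[OF A(4)]) (auto simp: ord_ge_def)
    moreover have "b \<in> B" using b by (intro subsetD[OF B(4)]) (auto simp: ord_ge_def
      laurent_expand_None)
    moreover have "u \<in> ?X" using u by (auto simp: laurent_box_iff_0)
    moreover have "v = u + (a + b)"
      by (rule laurent_eqI) (auto simp: expand_add u a b)
    ultimately show "\<exists>u\<in>?X. \<exists>w\<in>?P. v = u + w" by blast
  qed
  \<comment> \<open>No cancellation happens outside the window: \<open>A\<close> has no exponents
    below \<open>-N\<close> and \<open>B\<close> none above \<open>N\<close>, so both summands of an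
    element of the window lie in it.\<close>
  moreover have "?X \<inter> ?P = {x + y | x y. x \<in> A \<inter> ?X \<and> y \<in> B \<inter> ?X}"
  proof (intro equalityI subsetI)
    fix f assume "f \<in> ?X \<inter> ?P"
    then obtain a b where ab: "f = a + b" "a \<in> A" "b \<in> B" and f: "f \<in> ?X" by blast
    have al: "a \<in> laurent" and bl: "b \<in> laurent" using ab A B by auto
    have fl: "f \<in> laurent" using f by (simp add: laurent_box_def)
    have zf: "coef (Some 0) f i = 0" if "int N < \<bar>i\<bar>" for i
      using f that laurent_box_iff_0[OF fl] by blast
    have za: "coef (Some 0) a i = 0" if "i < - int N" for i
      using ab A(3) that by (auto simp: ord_ge_def)
    have "coef None b (- i) = 0" if "i > int N" for i
      using ab B(3) that by (auto simp: ord_ge_def)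
    then have zb: "coef (Some 0) b i = 0" if "i > int N" for i
      using that laurent_expand_None[OF bl, of "- i"] by simp
    have sum: "coef (Some 0) f i = coef (Some 0) a i + coef (Some 0) b i" for i
      by (simp add: ab expand_add)
    have "a \<in> ?X"
      unfolding laurent_box_iff_0[OF al]
    proof (intro allI impI)
      fix i assume i: "int N < \<bar>i\<bar>"
      show "coef (Some 0) a i = 0"
        using za[of i] zb[of i] zf[OF i] sum[of i] i by (cases "i < 0") auto
    qed
    then have "f - a \<in> ?X" using f subX by (intro kt.subspace_diff)
    then have "b \<in> ?X" by (simp add: ab)
    with \<open>a \<in> ?X\<close> ab show "f \<in> {x + y | x y. x \<in> A \<inter> ?X \<and> y \<in> B \<inter> ?X}" by blast
  next
    fix f assume "f \<in> {x + y | x y. x \<in> A \<inter> ?X \<and> y \<in> B \<inter> ?X}"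
    then obtain x y where xy: "f = x + y" "x \<in> A" "x \<in> ?X" "y \<in> B" "y \<in> ?X" by blast
    then have "f \<in> ?X" using subX by (simp add: kt.subspace_add)
    with xy show "f \<in> ?X \<inter> ?P" by blast
  qed
  moreover have "kt.dim {x + y | x y. x \<in> A \<inter> ?X \<and> y \<in> B \<inter> ?X} + kt.dim ((A \<inter> ?X) \<inter> (B \<inter> ?X))
    = kt.dim (A \<inter> ?X) + kt.dim (B \<inter> ?X)"
    by (rule dim_sum_Int[OF _ _ _ _ S(1)]) (use A B subX S(2) in \<open>auto intro: kt.subspace_inter\<close>)
  \<comment> \<open>\<open>A\<close> bounds the exponents from below and \<open>B\<close> from
    above, so the intersection is already in the window.\<close>
  moreover have "(A \<inter> ?X) \<inter> (B \<inter> ?X) = A \<inter> B"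
    using A B by (auto simp: laurent_box_def)
  moreover have "kt.dim (A \<inter> ?X) = card (ord_at (Some 0) ` (A - {0}) \<inter> {..int N})"
  proof -
    have "ord_at (Some 0) ` (A - {0}) \<inter> {..int N} \<subseteq> {- int N..int N}"
      using A(3) by (auto simp: ord_ge_iff subset_iff)
    then have "finite (ord_at (Some 0) ` (A \<inter> ?X - {0}))"
      unfolding ords_Int_box[OF _ A, simplified] by (rule finite_subset) simp
    then show ?thesis
      using dim_eq_card_ords[of "A \<inter> ?X" "Some 0"] A(1) subX
      unfolding ords_Int_box[OF _ A, simplified] by (simp add: kt.subspace_inter)
  qed
  moreover have "kt.dim (B \<inter> ?X) = card (ord_at None ` (B - {0}) \<inter> {..int N})"
  proof -
    have "ord_at None ` (B - {0}) \<inter> {..int N} \<subseteq> {- int N..int N}"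
      using B(3) by (auto simp: ord_ge_iff subset_iff)
    then have "finite (ord_at None ` (B \<inter> ?X - {0}))"
      unfolding ords_Int_box[OF _ B, simplified] by (rule finite_subset) simp
    then show ?thesis
      using dim_eq_card_ords[of "B \<inter> ?X" None] B(1) subX
      unfolding ords_Int_box[OF _ B, simplified] by (simp add: kt.subspace_inter)
  qed
  ultimately show ?thesis using S(3) by simp
qed

section \<open>Monomial curves and their local rings\<close>

lemma proj_pt_scale:
  assumes "l \<noteq> 0" shows "proj_pt (\<lambda>i. l * v i) = proj_pt v"
proof (intro equalityI subsetI)
  fix x assume "x \<in> proj_pt (\<lambda>i. l * v i)"
  then obtain c where "c \<noteq> 0" "x = (\<lambda>i. c * (l * v i))" by (auto simp: proj_pt_def)
  then show "x \<in> proj_pt v" using assms unfolding proj_pt_def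
    by (intro CollectI exI[of _ "c * l"]) (simp add: mult.assoc)
next
  fix x assume "x \<in> proj_pt v"
  then obtain c where "c \<noteq> 0" "x = (\<lambda>i. c * v i)" by (auto simp: proj_pt_def)
  then show "x \<in> proj_pt (\<lambda>i. l * v i)" using assms unfolding proj_pt_def
    by (intro CollectI exI[of _ "c / l"]) simp
qed

lemma fls_mult_nth_subdegree:
  fixes y g :: "'k::field fls"
  assumes "\<And>i. i < 0 \<Longrightarrow> fls_nth g i = 0"
  shows "fls_nth (y * g) (fls_subdegree y) = fls_nth y (fls_subdegree y) * fls_nth g 0"
proof (cases "fls_nth g 0 = 0")
  case False
  then have "fls_subdegree g = 0" using assms by (intro fls_subdegree_eqI)
  then show ?thesis using fls_times_base[of y g] by simp
next
  case True
  show ?thesis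
  proof (cases "g = 0")
    case False
    moreover have "fls_nth g k = 0" if "k < 1" for k
      using assms[of k] True that by (cases "k = 0") auto
    ultimately have "1 \<le> fls_subdegree g" by (rule fls_subdegree_geI)
    then show ?thesis using True by (simp add: fls_times_nth_eq0)
  qed simp
qed

text \<open>With \<open>0 ^ 0 = 1\<close> and strictly increasing \<open>E\<close>, the value at
  \<open>None\<close> is \<open>1\<close> in the last coordinate and \<open>0\<close> in the
  others.\<close>

definition monomial_coord :: "nat list \<Rightarrow> 'k::field option \<Rightarrow> nat \<Rightarrow> 'k" where
  "monomial_coord E P i = (case P of Some c \<Rightarrow> c ^ (E ! i) | None \<Rightarrow> 0 ^ (E ! (length E - 1) - E !
    i))"

text \<open>The common factor \<open>f0\<close> shifts all orders equally and multiplies the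
  coordinates by its leading coefficient, which a projective point ignores. It is carried along for
  the canonical map, whose basis is \<open>f0\<close> times monomials.\<close>

lemma rat_map_monomials:
  fixes f0 :: "'k::field ratfun"
  assumes E: "sorted_wrt (<) (0 # b)" and f0: "f0 \<noteq> 0"
  shows "rat_map (map (\<lambda>e. f0 * t_rf ^ e) (0 # b)) P =
    proj_pt (\<lambda>i. if i \<le> length b then monomial_coord (0 # b) P i else 0)"
proof -
  let ?E = "0 # b" and ?N = "length b"
  define l where "l = coef P f0 (ord_at P f0)"
  have l: "l \<noteq> 0" using f0 by (simp add: l_def ord_at_nth)
  let ?fs = "map (\<lambda>e. f0 * t_rf ^ e) ?E"
  have ord: "ord_at P (f0 * t_rf ^ e) = ord_at P f0 + int e * ord_at P t_rf" for e
    using f0 by (simp add: ord_at_mult ord_at_power)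
  have le: "?E ! i \<le> ?E ! ?N" "i < ?N \<Longrightarrow> ?E ! i < ?E ! ?N" if "i \<le> ?N" for i
    using sorted_wrt_nth_less[OF E, of i ?N] that by (cases "i = ?N"; auto)+
  have img: "(\<lambda>f. fls_subdegree (expand P f)) ` set ?fs
    = (\<lambda>i. ord_at P f0 + int (?E ! i) * ord_at P t_rf) ` {..?N}"
  proof -
    have "set ?E = (!) ?E ` {..?N}" by (auto simp: set_conv_nth image_iff less_Suc_eq_le simp
      del: set_simps)
    then show ?thesis by (simp add: image_image ord flip: ord_at_def del: set_simps nth_Cons'
      list.map(2) list.set(2))
  qed
  have "\<exists>m. Min ((\<lambda>f. fls_subdegree (expand P f)) ` set ?fs) = m \<and>
    (\<forall>i\<le>?N. coef P (f0 * t_rf ^ (?E ! i)) m = l * monomial_coord ?E P i)"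
  proof (cases P)
    case None
    \<comment> \<open>\<open>t_rf\<close> has order \<open>-1\<close> at infinity, so the last
      exponent gives the least order; at finite points \<open>t_rf\<close> has order at least
      \<open>0\<close>, and the exponent \<open>0\<close> gives it.\<close>
    have "Min ((\<lambda>f. fls_subdegree (expand P f)) ` set ?fs) = ord_at P f0 - int (?E ! ?N)"
      unfolding img by (rule Min_eqI) (use le(1) in \<open>auto simp: None intro!: image_eqI[of _ _
        ?N] simp del: nth_Cons'\<close>)
    moreover have "coef P (f0 * t_rf ^ (?E ! i)) (ord_at P f0 - int (?E ! ?N))
      = l * monomial_coord ?E P i"
      if "i \<le> ?N" for i
    proof -
      have "expand P (f0 * t_rf ^ (?E ! i)) = fls_shift (int (?E ! i)) (expand P f0)"
        by (simp only: expand_mult expand_power expand_t None t_at.simps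
            fls_X_inv_power_times_conv_shift)
      then have "coef P (f0 * t_rf ^ (?E ! i)) (ord_at P f0 - int (?E ! ?N)) =
        coef P f0 (ord_at P f0 - int (?E ! ?N - ?E ! i))"
        using le(1)[OF that] by (simp add: of_nat_diff algebra_simps del: nth_Cons')
      also have "\<dots> = l * 0 ^ (?E ! ?N - ?E ! i)"
        by (cases "?E ! ?N - ?E ! i = 0") (simp_all add: l_def ord_at_def del: nth_Cons')
      finally show ?thesis by (simp add: monomial_coord_def None del: nth_Cons')
    qed
    ultimately show ?thesis by blast
  next
    case (Some c)
    have "0 \<le> ord_at P (t_rf :: 'k ratfun)"
      by (cases "c = 0") (simp_all add: Some ord_at_t)
    then have "Min ((\<lambda>f. fls_subdegree (expand P f)) ` set ?fs) = ord_at P f0"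
      unfolding img by (intro Min_eqI) (auto intro!: image_eqI[of _ _ 0] simp del: nth_Cons'
        simp: nth_Cons_0)
    moreover have "coef P (f0 * t_rf ^ e) (ord_at P f0) = l * c ^ e" for e
    proof -
      have e: "t_rf ^ e = rf_eval (monom 1 e) (t_rf :: 'k ratfun)" by (simp add: const_rf_1)
      have "t_rf ^ e \<in> ord_ge (Some c) 0" unfolding e by (rule rf_eval_t_in_ord_ge)
      then have "coef P (f0 * t_rf ^ e) (ord_at P f0) = l * coef P (t_rf ^ e) 0"
        unfolding expand_mult ord_at_def l_def
          by (intro fls_mult_nth_subdegree) (simp add: Some ord_ge_def)
      also have "coef P (t_rf ^ e) 0 = c ^ e"
        unfolding Some e expand_rf_eval_t_nth_0 by (simp add: poly_monom)
      finally show ?thesis .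
    qed
    ultimately show ?thesis by (simp add: monomial_coord_def Some del: nth_Cons')
  qed
  then have "rat_map ?fs P = proj_pt (\<lambda>i. if i < length ?fs then l * monomial_coord ?E P i else 0)"
    unfolding rat_map_def Let_def
    by (elim exE conjE) (intro arg_cong[where f
        = proj_pt] ext, auto simp: less_Suc_eq_le simp del: nth_Cons' list.map(2))
  also have "\<dots> = proj_pt (\<lambda>i. l * (if i \<le> ?N then monomial_coord ?E P i else 0))"
    by (intro arg_cong[where f = proj_pt] ext) auto
  finally show ?thesis by (simp add: proj_pt_scale[OF l])
qed

section \<open>Numerical semigroups\<close>

lemma submonoid_Gcd_diff:
  fixes S :: "nat set"
  assumes S: "0 \<in> S" "\<And>a b. a \<in> S \<Longrightarrow> b \<in> S \<Longrightarrow> a + b \<in> S" and "finite A" "A \<subseteq> S"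
  shows "\<exists>a\<in>S. \<exists>b\<in>S. a = b + Gcd A"
  using assms(3,4)
proof (induction A rule: finite_induct)
  case empty
  then show ?case using S(1) by auto
next
  case (insert x A)
  have mult: "k * a \<in> S" if "a \<in> S" for k a
    using that by (induction k) (auto intro: S)
  obtain a b where ab: "a \<in> S" "b \<in> S" "a = b + Gcd A" using insert by auto
  \<comment> \<open>Bezout over the naturals comes in two forms according to the sign; each becomes
    an identity without subtraction between elements of \<open>S\<close>.\<close>
  obtain u v where "Gcd A * v \<le> x * u \<and> x * u - Gcd A * v = gcd x (Gcd A) \<or>
      x * v \<le> Gcd A * u \<and> Gcd A * u - x * v = gcd x (Gcd A)"
    using bezout_gcd_nat'[of "Gcd A" x] by blast
  then have "x * u = Gcd A * v + gcd x (Gcd A) \<or> Gcd A * u = x * v + gcd x (Gcd A)"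
    by (metis le_add_diff_inverse)
  then show ?case
  proof
    assume *: "x * u = Gcd A * v + gcd x (Gcd A)"
    have "u * x + v * b = v * a + Gcd (insert x A)"
      using * ab(3) by (simp add: algebra_simps)
    moreover have "u * x + v * b \<in> S" "v * a \<in> S"
      using insert.prems ab by (auto intro!: S(2) mult)
    ultimately show ?case by metis
  next
    assume *: "Gcd A * u = x * v + gcd x (Gcd A)"
    have "u * a = (v * x + u * b) + Gcd (insert x A)"
      using * ab(3) by (simp add: algebra_simps)
    moreover have "v * x + u * b \<in> S" "u * a \<in> S"
      using insert.prems ab by (auto intro!: S(2) mult)
    ultimately show ?case by metis
  qed
qed

text \<open>With \<open>b\<close> and \<open>b + 1\<close> in \<open>S\<close>, write
  \<open>k = q * b + \<rho>\<close> with \<open>\<rho> < b\<close>; then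
  \<open>k = (q - \<rho>) * b + \<rho> * (b + 1)\<close>, and \<open>k \<ge> b * b\<close> gives
  \<open>\<rho> \<le> q\<close>.\<close>

lemma numerical_semigroup_cofinite:
  fixes S :: "nat set"
  assumes S: "0 \<in> S" "\<And>a b. a \<in> S \<Longrightarrow> b \<in> S \<Longrightarrow> a + b \<in> S" and "finite A" "A \<subseteq> S" "Gcd A = 1"
  shows "\<exists>N. \<forall>k\<ge>N. k \<in> S"
proof -
  have mult: "k * a \<in> S" if "a \<in> S" for k a
    using that by (induction k) (auto intro: S)
  obtain b where b: "b \<in> S" "b + 1 \<in> S"
    using submonoid_Gcd_diff[OF assms(1-4)] assms(5) by auto
  have "k \<in> S" if "b * b \<le> k" for k
  proof (cases "b = 0")
    case True
    then show ?thesis using mult[OF b(2), of k] by simp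
  next
    case False
    have "b \<le> k div b"
      using div_le_mono[OF that, of b] False by simp
    then have r: "k mod b \<le> k div b"
      using mod_less_divisor[of b k] False by linarith
    have "k = (k div b - k mod b) * b + (k mod b) * (b + 1)"
      using r div_mult_mod_eq[of k b] by (simp add: diff_mult_distrib algebra_simps)
    moreover have "(k div b - k mod b) * b + (k mod b) * (b + 1) \<in> S"
      by (intro S(2) mult b)
    ultimately show ?thesis by simp
  qed
  then show ?thesis by blast
qed

lemma sum_keys_superset:
  fixes m :: "nat \<Rightarrow>\<^sub>0 nat"
  assumes "Poly_Mapping.keys m \<subseteq> {..n}"
  shows "(\<Sum>i\<in>Poly_Mapping.keys m. Poly_Mapping.lookup m i * f i)
    = (\<Sum>i\<le>n. Poly_Mapping.lookup m i * f i)"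
  by (rule sum.mono_neutral_left) (use assms in \<open>auto simp: in_keys_iff\<close>)

text \<open>The exponents with the leading \<open>0\<close>, already divided by their common
  divisor; \<open>Gcd_e\<close> gives injectivity of \<open>rat_map phi\<close> and finiteness of
  the gaps.\<close>

locale monomial_exponents =
  fixes e :: "nat list" and n :: nat
  assumes len: "length e = Suc n" and n_pos: "0 < n"
    and sorted: "sorted_wrt (<) e" and e_0: "e ! 0 = 0" and Gcd_e: "Gcd (set e) = 1"
begin

definition phi :: "'k::field ratfun list" where
  "phi = map (\<lambda>i. t_rf ^ i) e"

text \<open>The coordinate \<open>tpar Q\<close> takes the value \<open>ctr Q\<close> at \<open>Q\<close>, and up to a common factor the
  coordinates of the curve are \<open>tpar Q ^ expo Q i\<close>.\<close>

fun expo :: "'k::field option \<Rightarrow> nat \<Rightarrow> nat" where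
  "expo None i = e ! n - e ! i"
| "expo (Some c) i = e ! i"

fun ctr :: "'k::field option \<Rightarrow> 'k" where
  "ctr None = 0"
| "ctr (Some c) = c"

fun tpar :: "'k::field option \<Rightarrow> 'k ratfun" where
  "tpar None = inverse t_rf"
| "tpar (Some c) = t_rf"

text \<open>The exponent of \<open>tpar Q\<close> in the pullback of the monomial \<open>m\<close>,
  up to a common factor that depends only on the degree.\<close>

definition wt :: "'k::field option \<Rightarrow> (nat \<Rightarrow>\<^sub>0 nat) \<Rightarrow> nat" where
  "wt Q m = (\<Sum>i\<in>Poly_Mapping.keys m. Poly_Mapping.lookup m i * expo Q i)"

definition mons :: "nat \<Rightarrow> (nat \<Rightarrow>\<^sub>0 nat) set" where
  "mons d = {m. Poly_Mapping.keys m \<subseteq> {..n} \<and> (\<Sum>i\<in>Poly_Mapping.keys m. Poly_Mapping.lookup m i)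
    = d}"

definition wts :: "'k::field option \<Rightarrow> nat \<Rightarrow> nat set" where
  "wts Q d = wt Q ` mons d"

text \<open>The value semigroup of the local ring at the image of \<open>Q\<close>.\<close>

definition semigrp :: "'k::field option \<Rightarrow> nat set" where
  "semigrp Q = (if Q = None \<or> Q = Some 0 then (\<Union>d. wts Q d) else UNIV)"

lemma e_less: "i < j \<Longrightarrow> j \<le> n \<Longrightarrow> e ! i < e ! j"
  using sorted_wrt_nth_less[OF sorted] len by simp

lemma e_le: "i \<le> n \<Longrightarrow> e ! i \<le> e ! n"
  using e_less[of i n] by (cases "i = n") auto

lemma e_pos: "0 < i \<Longrightarrow> i \<le> n \<Longrightarrow> 0 < e ! i"
  using e_less[of 0 i] e_0 by simp

lemma set_e: "set e = (!) e ` {..n}"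
  by (auto simp: set_conv_nth len image_iff less_Suc_eq_le)

lemma wt_eq: "m \<in> mons d \<Longrightarrow> wt Q m = (\<Sum>i\<le>n. Poly_Mapping.lookup m i * expo Q i)"
  unfolding wt_def mons_def by (intro sum_keys_superset) simp

lemma mons_iff: "m \<in> mons d \<longleftrightarrow> Poly_Mapping.keys m \<subseteq> {..n} \<and> (\<Sum>i\<le>n. Poly_Mapping.lookup m i) = d"
  using sum_keys_superset[of m n "\<lambda>_. 1"] by (auto simp: mons_def)

lemma mons_add: "m \<in> mons d \<Longrightarrow> m' \<in> mons d' \<Longrightarrow> m + m' \<in> mons (d + d')"
  using keys_add[of m m'] by (auto simp: mons_iff lookup_add sum.distrib)

lemma single_mons: "i \<le> n \<Longrightarrow> Poly_Mapping.single i d \<in> mons d"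
  by (cases "d = 0") (auto simp: mons_def)

lemma wt_single: "wt Q (Poly_Mapping.single i d) = d * expo Q i"
  by (cases "d = 0") (auto simp: wt_def)

lemma wts_add:
  assumes "s \<in> wts Q d" "s' \<in> wts Q d'" shows "s + s' \<in> wts Q (d + d')"
proof -
  obtain m m' where m: "m \<in> mons d" "m' \<in> mons d'" "s = wt Q m" "s' = wt Q m'"
    using assms by (auto simp: wts_def)
  then have "wt Q (m + m') = s + s'"
    using wt_eq[OF mons_add[OF m(1,2)]] by (simp add: wt_eq lookup_add algebra_simps sum.distrib)
  then show ?thesis using mons_add[OF m(1,2)] by (metis imageI wts_def)
qed

lemma zero_in_wts: "0 \<in> wts Q d"
proof (cases Q)
  case None
  have "wt Q (Poly_Mapping.single n d) = 0" by (simp add: wt_single None)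
  then show ?thesis using single_mons[of n d] by (metis imageI wts_def le_refl)
next
  case (Some c)
  have "wt Q (Poly_Mapping.single 0 d) = 0" by (simp add: wt_single Some e_0)
  then show ?thesis using single_mons[of 0 d] by (metis imageI wts_def le0)
qed

text \<open>At each \<open>Q\<close> some coordinate has exponent \<open>0\<close>: the first at
  finite points, the last at \<open>None\<close>. Multiplying by it raises the degree without
  changing weights.\<close>

lemma wts_mono: "d \<le> d' \<Longrightarrow> wts Q d \<subseteq> wts Q d'"
  using wts_add[OF _ zero_in_wts, of _ Q d "d' - d"] by auto

lemma expo_in_wts: "i \<le> n \<Longrightarrow> expo Q i \<in> wts Q 1"
  using single_mons[of i 1] wt_single[of Q i 1] by (metis imageI mult_1 wts_def)

text \<open>Numerator and denominator of an element of the local ring must be forms of one degree;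
  two polynomials involve finitely many weights, so one degree serves both.\<close>

lemma finite_subset_wts:
  assumes "finite J" "J \<subseteq> (\<Union>d. wts Q d)" shows "\<exists>d. J \<subseteq> wts Q d"
  using assms
proof (induction J)
  case (insert j J)
  then obtain d d' where "J \<subseteq> wts Q d" "j \<in> wts Q d'" by auto
  then have "insert j J \<subseteq> wts Q (max d d')"
    using wts_mono[of d "max d d'" Q] wts_mono[of d' "max d d'" Q] by auto
  then show ?case by blast
qed auto

lemma wts_cofinite: "\<exists>N. \<forall>k\<ge>N. k \<in> (\<Union>d. wts Q d)"
proof (rule numerical_semigroup_cofinite)
  show "0 \<in> (\<Union>d. wts Q d)" using zero_in_wts by blast
  show "a + b \<in> (\<Union>d. wts Q d)" if "a \<in> (\<Union>d. wts Q d)" "b \<in> (\<Union>d. wts Q d)" for a b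
    using that wts_add by blast
  show "finite (expo Q ` {..n})" by simp
  show "expo Q ` {..n} \<subseteq> (\<Union>d. wts Q d)" using expo_in_wts[of _ Q] by blast
  have "Gcd (expo Q ` {..n}) dvd x" if x: "x \<in> set e" for x
  proof -
    obtain i where i: "x = e ! i" "i \<le> n" using x set_e by auto
    show ?thesis
    proof (cases Q)
      case None
      \<comment> \<open>Since \<open>e ! 0 = 0\<close>, the exponent of coordinate \<open>0\<close>
        at infinity is \<open>e ! n\<close>, and a common divisor also divides the difference
        \<open>e ! i\<close>.\<close>
      have "Gcd (expo Q ` {..n}) dvd expo Q i" "Gcd (expo Q ` {..n}) dvd expo Q 0"
        using i by (auto intro!: Gcd_dvd)
      then show ?thesis
        using None i e_0 e_le[OF i(2)] by (metis diff_zero dvd_diffD1 expo.simps(1))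
    next
      case (Some c)
      then have "expo Q i = x" using i by simp
      then show ?thesis using i by (metis Gcd_dvd imageI atMost_iff)
    qed
  qed
  then have "Gcd (expo Q ` {..n}) dvd Gcd (set e)" by (rule Gcd_greatest)
  then show "Gcd (expo Q ` {..n}) = 1" using Gcd_e by simp
qed

lemma zero_in_semigrp [simp]: "0 \<in> semigrp Q"
  using zero_in_wts by (auto simp: semigrp_def)

lemma semigrp_add: "a \<in> semigrp Q \<Longrightarrow> b \<in> semigrp Q \<Longrightarrow> a + b \<in> semigrp Q"
  using wts_add by (fastforce simp: semigrp_def split: if_splits)

lemma semigrp_cofinite: "\<exists>N. \<forall>k\<ge>N. k \<in> semigrp Q"
  using wts_cofinite[of Q] by (auto simp: semigrp_def)

lemma proj_pt_eqD:
  assumes "proj_pt v = proj_pt w" shows "\<exists>c. c \<noteq> 0 \<and> v = (\<lambda>i. c * w i)"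
proof -
  have "v \<in> proj_pt v" unfolding proj_pt_def by (auto intro!: exI[of _ 1])
  then show ?thesis using assms by (auto simp: proj_pt_def)
qed

lemma phi_nth: "i \<le> n \<Longrightarrow> phi ! i = t_rf ^ (e ! i)"
  by (simp add: phi_def len)

lemma length_phi [simp]: "length (phi :: 'k::field ratfun list) = Suc n"
  by (simp add: phi_def len)

lemma rat_map_phi_eq:
  fixes Q :: "'k::field option"
  shows "rat_map phi Q = proj_pt (\<lambda>i. if i \<le> n then ctr Q ^ expo Q i else 0)"
proof -
  have e: "e = 0 # tl e" using len e_0 by (cases e) auto
  have "rat_map (map (\<lambda>i. 1 * t_rf ^ i) e) Q =
      proj_pt (\<lambda>i. if i \<le> length (tl e) then monomial_coord e Q i else 0)"
    using rat_map_monomials[of "tl e" "1 :: 'k ratfun" Q, folded e] sorted by simp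
  moreover have "monomial_coord e Q i = ctr Q ^ expo Q i" for i
    by (cases Q) (simp_all add: monomial_coord_def len)
  ultimately show ?thesis by (simp add: phi_def len cong: if_cong)
qed

text \<open>The exponents \<open>k\<close> with \<open>u ^ k = 1\<close> form a monoid that contains
  two consecutive numbers, because the \<open>e ! i\<close> are coprime.\<close>

lemma power_eq_1_imp_eq_1:
  fixes u :: "'k::field"
  assumes "\<And>i. i \<le> n \<Longrightarrow> u ^ (e ! i) = 1" shows "u = 1"
proof -
  define S where "S = {k. u ^ k = 1}"
  have "\<exists>N. \<forall>k\<ge>N. k \<in> S"
  proof (rule numerical_semigroup_cofinite[OF _ _ _ _ Gcd_e])
    show "set e \<subseteq> S" using assms by (auto simp: S_def set_e)
  qed (auto simp: S_def power_add)
  then obtain N where N: "\<And>k. N \<le> k \<Longrightarrow> k \<in> S" by blast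
  from N[of N] N[of "Suc N"] have "u ^ N = 1" "u ^ Suc N = 1" by (simp_all add: S_def)
  then show ?thesis by simp
qed

text \<open>Only \<open>None\<close> has vanishing coordinate \<open>0\<close>. For two finite
  points the scaling factor is \<open>1\<close> by coordinate \<open>0\<close>, and the ratio of
  nonzero parameters is treated by \<open>power_eq_1_imp_eq_1\<close>.\<close>

lemma inj_rat_map_phi: "inj (rat_map (phi :: 'k::field ratfun list))"
proof (rule injI)
  fix Q Q' :: "'k option" assume "rat_map phi Q = rat_map phi Q'"
  then obtain s where s: "s \<noteq> 0"
    and fn: "(\<lambda>i. if i \<le> n then ctr Q ^ expo Q i else 0)
      = (\<lambda>i. s * (if i \<le> n then ctr Q' ^ expo Q' i else 0))"
    unfolding rat_map_phi_eq by (elim proj_pt_eqD[elim_format] exE conjE)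
  have eq: "ctr Q ^ expo Q i = s * ctr Q' ^ expo Q' i" if "i \<le> n" for i
    using that fun_cong[OF fn, of i] by simp
  show "Q = Q'"
  proof (cases Q; cases Q')
    fix c c' assume Q: "Q = Some c" "Q' = Some c'"
    have "s = 1" using eq[of 0] by (simp add: Q e_0)
    then have eq: "c ^ (e ! i) = c' ^ (e ! i)" if "i \<le> n" for i using eq[OF that] by (simp add: Q)
    have "c = c'"
    proof (cases "c' = 0")
      case True
      then show ?thesis using eq[of n] e_pos[of n] n_pos by (simp add: zero_power)
    next
      case False
      then have "(c / c') ^ (e ! i) = 1" if "i \<le> n" for i using eq[OF that]
        by (simp add: power_divide)
      then show ?thesis using power_eq_1_imp_eq_1[of "c / c'"] False by simp
    qed
    then show ?thesis using Q by simp
  next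
    fix c assume Q: "Q = Some c" "Q' = None"
    show ?thesis using eq[of 0] e_pos[of n] n_pos by (simp add: Q e_0 zero_power s)
  next
    fix c assume Q: "Q' = Some c" "Q = None"
    show ?thesis using eq[of 0] e_pos[of n] n_pos by (simp add: Q e_0 zero_power s)
  qed auto
qed

section \<open>Forms as polynomials in one variable\<close>

definition form_poly :: "'c::field option \<Rightarrow> 'k::field mpol \<Rightarrow> 'k poly" where
  "form_poly Q F = (\<Sum>m\<in>Poly_Mapping.keys F. monom (Poly_Mapping.lookup F m) (wt Q m))"

lemma form_iff: "form n d F \<longleftrightarrow> Poly_Mapping.keys F \<subseteq> mons d"
  by (auto simp: form_def mons_def)

lemma wt_None_Some:
  assumes "m \<in> mons d" shows "wt None m + wt (Some c) m = d * (e ! n)"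
proof -
  have "wt None m + wt (Some c) m = (\<Sum>i\<le>n. Poly_Mapping.lookup m i * (e ! n))"
    using assms by (auto simp: wt_eq e_le simp flip: sum.distrib distrib_left intro!: sum.cong)
  then show ?thesis using assms by (simp add: mons_iff flip: sum_distrib_right)
qed

lemma prod_phi:
  assumes "m \<in> mons d"
  shows "(\<Prod>i\<in>Poly_Mapping.keys m. (phi ! i) ^ Poly_Mapping.lookup m i) =
    tpar Q ^ wt Q m * (if Q = None then t_rf ^ (d * (e ! n)) else 1)"
proof -
  have "(\<Prod>i\<in>Poly_Mapping.keys m. (phi ! i :: 'a ratfun) ^ Poly_Mapping.lookup m i) =
      (\<Prod>i\<in>Poly_Mapping.keys m. t_rf ^ (Poly_Mapping.lookup m i * (e ! i)))"
    using assms by (intro prod.cong) (auto simp: mons_def phi_nth subset_iff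
        power_mult[symmetric] mult.commute)
  also have "\<dots> = t_rf ^ wt (Some 0 :: 'a option) m"
    by (simp add: wt_def power_sum)
  finally have *: "(\<Prod>i\<in>Poly_Mapping.keys m. (phi ! i :: 'a ratfun) ^ Poly_Mapping.lookup m i) = \<dots>" .
  show ?thesis
  proof (cases Q)
    case None
    have "t_rf ^ (d * (e ! n)) = (t_rf :: 'a ratfun) ^ wt (None :: 'a option) m * t_rf ^ wt
      (Some 0 :: 'a option) m"
      using wt_None_Some[OF assms, of "0 :: 'a"] wt_def by (metis expo.simps(1) power_add)
    then show ?thesis unfolding * by (simp add: None field_simps)
  next
    case (Some c)
    have "wt (Some 0) m = wt Q m" by (simp add: wt_def Some)
    then show ?thesis unfolding * by (simp add: Some wt_def)
  qed
qed

text \<open>The extra factor at \<open>None\<close> depends only on the degree, so it cancels in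
  quotients of forms of equal degree.\<close>

lemma mpol_eval_phi:
  assumes "form n d F"
  shows "mpol_eval const_rf ((!) phi) F =
    rf_eval (form_poly Q F) (tpar Q) * (if Q = None then t_rf ^ (d * (e ! n)) else 1)"
proof -
  have "mpol_eval const_rf ((!) phi) F = (\<Sum>m\<in>Poly_Mapping.keys F. const_rf (Poly_Mapping.lookup
    F m) *
      (tpar Q ^ wt Q m * (if Q = None then t_rf ^ (d * (e ! n)) else 1)))"
    unfolding mpol_eval_def by (rule sum.cong[OF refl])
      (use assms in \<open>subst prod_phi[where Q = Q and d = d], auto simp: form_iff\<close>)
  then show ?thesis
    by (simp add: form_poly_def crf.sub_sum sum_distrib_right mult.assoc)
qed

lemma mpol_eval_point:
  assumes "x \<in> rat_map phi Q"
  shows "\<exists>l. l \<noteq> 0 \<and> (\<forall>d F. form n d F \<longrightarrow> mpol_eval id x F = l ^ d * poly (form_poly Q F) (ctr Q))"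
proof -
  obtain l where l: "l \<noteq> 0" "\<And>i. i \<le> n \<Longrightarrow> x i = l * ctr Q ^ expo Q i"
    using assms unfolding rat_map_phi_eq proj_pt_def by auto
  have "mpol_eval id x F = l ^ d * poly (form_poly Q F) (ctr Q)" if F: "form n d F" for d F
  proof -
    have "(\<Prod>i\<in>Poly_Mapping.keys m. x i ^ Poly_Mapping.lookup m i) = l ^ d * ctr Q ^ wt Q m"
      if "m \<in> mons d" for m
    proof -
      have "(\<Prod>i\<in>Poly_Mapping.keys m. x i ^ Poly_Mapping.lookup m i) =
        (\<Prod>i\<in>Poly_Mapping.keys m. l ^ Poly_Mapping.lookup m i * ctr Q ^ (Poly_Mapping.lookup m i
          * expo Q i))"
        using that by (intro prod.cong) (auto simp: mons_def subset_iff l power_mult_distrib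
            power_mult[symmetric] mult.commute)
      then show ?thesis using that by (simp add: prod.distrib wt_def mons_def flip: power_sum)
    qed
    then show ?thesis using F
      by (auto simp: mpol_eval_def form_iff form_poly_def poly_sum poly_monom sum_distrib_left
          subset_iff
          intro!: sum.cong)
  qed
  with l(1) show ?thesis by blast
qed

lemma coeff_form_poly:
  assumes "form n d F" "coeff (form_poly Q F) j \<noteq> 0" shows "j \<in> wts Q d"
proof -
  have "\<exists>m\<in>Poly_Mapping.keys F. wt Q m = j"
    using assms(2) by (rule contrapos_np) (auto simp: form_poly_def coeff_sum intro!: sum.neutral)
  then show ?thesis using assms(1) by (auto simp: form_iff wts_def)
qed

text \<open>One monomial is chosen for each weight; different weights give different monomials, so
  the coefficients do not collide.\<close>

lemma form_poly_surj:
  assumes "\<And>j. coeff p j \<noteq> 0 \<Longrightarrow> j \<in> wts Q d"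
  shows "\<exists>F. form n d F \<and> form_poly Q F = p"
proof -
  define J where "J = {j. coeff p j \<noteq> 0}"
  have J: "finite J" unfolding J_def by (rule finite_subset[of _
    "{..degree p}"]) (auto intro: le_degree)
  have "\<forall>j\<in>J. \<exists>m. m \<in> mons d \<and> wt Q m = j"
    using assms by (force simp: J_def wts_def)
  then obtain mm where mm: "\<And>j. j \<in> J \<Longrightarrow> mm j \<in> mons d" "\<And>j. j \<in> J \<Longrightarrow> wt Q (mm j) = j"
    by metis
  have inj: "inj_on mm J" using mm(2) by (metis inj_onI)
  define F where "F = (\<Sum>j\<in>J. Poly_Mapping.single (mm j) (coeff p j))"
  have lF: "Poly_Mapping.lookup F (mm i) = coeff p i" if "i \<in> J" for i
  proof -
    have "Poly_Mapping.lookup F (mm i) = (\<Sum>j\<in>J. coeff p j when mm j = mm i)"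
      by (simp add: F_def lookup_sum lookup_single)
    also have "\<dots> = (\<Sum>j\<in>J. if i = j then coeff p j else 0)"
      using inj that by (intro sum.cong) (auto simp: when_def inj_on_def)
    finally show ?thesis using that J by simp
  qed
  have "Poly_Mapping.keys F \<subseteq> mm ` J"
    unfolding F_def using keys_sum[of "\<lambda>j. Poly_Mapping.single (mm j) (coeff p j)" J]
      by (auto split: if_splits)
  moreover have "mm ` J \<subseteq> Poly_Mapping.keys F"
    using lF by (auto simp: in_keys_iff J_def)
  ultimately have kF: "Poly_Mapping.keys F = mm ` J" by blast
  have "form_poly Q F = (\<Sum>j\<in>J. monom (coeff p j) j)"
    unfolding form_poly_def kF by (subst sum.reindex[OF inj]) (auto simp: lF mm intro!: sum.cong)
  also have "\<dots> = p"
    by (rule poly_eqI) (use J in \<open>auto simp: coeff_sum J_def\<close>)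
  finally have "form_poly Q F = p" .
  moreover have "form n d F" using mm(1) by (auto simp: form_iff kF)
  ultimately show ?thesis by blast
qed

lemma local_ring_phi_iff:
  "f \<in> local_ring phi (rat_map phi Q) \<longleftrightarrow>
    (\<exists>p q d. (\<forall>j. coeff p j \<noteq> 0 \<longrightarrow> j \<in> wts Q d) \<and> (\<forall>j. coeff q j \<noteq> 0 \<longrightarrow> j \<in> wts Q d) \<and>
      poly q (ctr Q) \<noteq> 0 \<and> f = rf_eval p (tpar Q) / rf_eval q (tpar Q))"
proof
  assume "f \<in> local_ring phi (rat_map phi Q)"
  then obtain F G d where FG: "form n d F" "form n d G" "\<And>x. x \<in> rat_map phi Q
    \<Longrightarrow> mpol_eval id x G \<noteq> 0"
    "f = mpol_eval const_rf ((!) phi) F / mpol_eval const_rf ((!) phi) G"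
    by (auto simp: local_ring_def)
  have "(\<lambda>i. if i \<le> n then ctr Q ^ expo Q i else 0) \<in> rat_map phi Q"
    unfolding rat_map_phi_eq proj_pt_def by (auto intro!: exI[of _ 1])
  then have "poly (form_poly Q G) (ctr Q) \<noteq> 0"
    using mpol_eval_point FG(2,3) by fastforce
  moreover have "f = rf_eval (form_poly Q F) (tpar Q) / rf_eval (form_poly Q G) (tpar Q)"
    unfolding FG(4) mpol_eval_phi[OF FG(1), of Q] mpol_eval_phi[OF FG(2), of Q] by simp
  ultimately show "\<exists>p q d. (\<forall>j. coeff p j \<noteq> 0 \<longrightarrow> j \<in> wts Q d) \<and> (\<forall>j. coeff q j \<noteq> 0 \<longrightarrow> j \<in> wts Q d) \<and>
      poly q (ctr Q) \<noteq> 0 \<and> f = rf_eval p (tpar Q) / rf_eval q (tpar Q)"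
    using coeff_form_poly[OF FG(1)] coeff_form_poly[OF FG(2)] by blast
next
  assume "\<exists>p q d. (\<forall>j. coeff p j \<noteq> 0 \<longrightarrow> j \<in> wts Q d) \<and> (\<forall>j. coeff q j \<noteq> 0 \<longrightarrow> j \<in> wts Q d) \<and>
      poly q (ctr Q) \<noteq> 0 \<and> f = rf_eval p (tpar Q) / rf_eval q (tpar Q)"
  then obtain p q d where pq: "\<And>j. coeff p j \<noteq> 0 \<Longrightarrow> j \<in> wts Q d" "\<And>j. coeff q j \<noteq> 0 \<Longrightarrow> j \<in> wts Q d"
      "poly q (ctr Q) \<noteq> 0" "f = rf_eval p (tpar Q) / rf_eval q (tpar Q)" by blast
  obtain F where F: "form n d F" "form_poly Q F = p" using form_poly_surj[OF pq(1)] by blast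
  obtain G where G: "form n d G" "form_poly Q G = q" using form_poly_surj[OF pq(2)] by blast
  have "mpol_eval id x G \<noteq> 0" if "x \<in> rat_map phi Q" for x
    using mpol_eval_point[OF that] G pq(3) by auto
  moreover have "f = mpol_eval const_rf ((!) phi) F / mpol_eval const_rf ((!) phi) G"
    unfolding pq(4) mpol_eval_phi[OF F(1), of Q] mpol_eval_phi[OF G(1), of Q] F(2) G(2) by simp
  ultimately show "f \<in> local_ring phi (rat_map phi Q)"
    using F(1) G(1) unfolding local_ring_def by auto
qed

text \<open>The local ring at the image of \<open>Q\<close> in terms of supports of expansions;
  \<open>local_ring_phi\<close> identifies the two.\<close>

definition lring :: "'k::field option \<Rightarrow> 'k ratfun set" where
  "lring Q = {f. \<forall>i. coef Q f i \<noteq> 0 \<longrightarrow> i \<in> int ` semigrp Q}"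

lemma lring_mult: "f \<in> lring Q \<Longrightarrow> g \<in> lring Q \<Longrightarrow> f * g \<in> lring Q"
proof -
  assume fg: "f \<in> lring Q" "g \<in> lring Q"
  have "i \<in> int ` semigrp Q" if nz: "coef Q (f * g) i \<noteq> 0" for i
  proof -
    have "(\<Sum>k=fls_subdegree (expand Q f)..i - fls_subdegree (expand Q g).
        coef Q f k * coef Q g (i - k)) \<noteq> 0"
      using nz by (simp add: expand_mult fls_times_nth(2))
    then obtain k where "coef Q f k \<noteq> 0" "coef Q g (i - k) \<noteq> 0"
      by (metis (no_types, lifting) mult_zero_left mult_zero_right sum.neutral)
    then obtain a b where "a \<in> semigrp Q" "b \<in> semigrp Q" "k = int a" "i - k = int b"
      using fg unfolding lring_def by blast
    then have "a + b \<in> semigrp Q" "i = int (a + b)" by (auto intro: semigrp_add)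
    then show ?thesis by blast
  qed
  then show ?thesis by (simp add: lring_def)
qed

lemma subspace_lring: "kt.subspace (lring Q)"
  by (auto simp: lring_def kt.subspace_def expand_add expand_scale_nth) (metis
      add_cancel_right_right)

lemma lring_ord: "f \<in> lring Q \<Longrightarrow> f \<noteq> 0 \<Longrightarrow> ord_at Q f \<in> int ` semigrp Q"
  using ord_at_nth[of f Q] by (simp add: lring_def)

lemma lring_subset_ord_ge: "lring Q \<subseteq> ord_ge Q 0"
  by (auto simp: lring_def ord_ge_def)

lemma lring_unif_power: "s \<in> semigrp Q \<Longrightarrow> unif Q ^ s \<in> lring Q"
  by (auto simp: lring_def expand_power)

lemma expand_eq_fps:
  assumes "f \<in> ord_ge Q 0" shows "\<exists>y. expand Q f = fps_to_fls y"
proof -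
  have "0 \<le> fls_subdegree (expand Q f)"
    using assms by (cases "f = 0") (auto simp: ord_ge_iff ord_at_def)
  then show ?thesis using fls_regpart_to_fls_trivial by metis
qed

text \<open>The series \<open>y = p / q\<close> satisfies \<open>y * q = p\<close>. For
  \<open>k\<close> outside the semigroup, a term \<open>y_i q_(k-i)\<close> with
  \<open>i < k\<close> vanishes by induction or because \<open>k - i\<close> is outside as well;
  what remains is \<open>y_k q_0 = 0\<close>.\<close>

lemma lring_quotient:
  assumes p: "\<And>j. coeff p j \<noteq> 0 \<Longrightarrow> j \<in> semigrp Q" and q: "\<And>j. coeff q j \<noteq> 0 \<Longrightarrow> j \<in> semigrp Q"
    and q0: "coeff q 0 \<noteq> 0"
  shows "rf_eval p (unif Q) / rf_eval q (unif Q) \<in> lring Q"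
proof -
  let ?f = "rf_eval p (unif Q) / rf_eval q (unif Q)"
  have "q \<noteq> 0" using q0 by auto
  have "ord_at Q (rf_eval q (unif Q)) = 0"
    unfolding ord_at_def using q0 by (intro fls_subdegree_eqI) (auto simp: expand_rf_eval_unif_nth)
  moreover have "rf_eval p (unif Q) \<in> ord_ge Q 0"
    by (simp add: ord_ge_def expand_rf_eval_unif_nth)
  ultimately have "?f \<in> ord_ge Q 0"
    using \<open>q \<noteq> 0\<close> by (cases "p = 0") (auto simp: ord_ge_iff ord_at_divide)
  then obtain y where y: "expand Q ?f = fps_to_fls y" using expand_eq_fps by blast
  have "?f * rf_eval q (unif Q) = rf_eval p (unif Q)" using \<open>q \<noteq> 0\<close> by simp
  then have "expand Q ?f * expand Q (rf_eval q (unif Q)) = expand Q (rf_eval p (unif Q))"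
    by (metis expand_mult)
  then have yq: "y * fps_of_poly q = fps_of_poly p"
    unfolding y by (simp add: expand_rf_eval_unif fls_eval_X flip: fls_times_fps_to_fls)
  have zero: "fps_nth y k = 0" if "k \<notin> semigrp Q" for k
    using that
  proof (induction k rule: less_induct)
    case (less k)
    have z: "fps_nth y i * coeff q (k - i) = 0" if "i \<le> k" "i \<noteq> k" for i
    proof (cases "i \<in> semigrp Q")
      case True
      then have "k - i \<notin> semigrp Q" using less.prems semigrp_add[of i Q "k - i"] \<open>i \<le> k\<close> by auto
      then show ?thesis using q by fastforce
    qed (use less.IH[of i] that in simp)
    have "(\<Sum>i\<in>{0..k} - {k}. fps_nth y i * coeff q (k - i)) = 0"
      by (intro sum.neutral ballI z) auto
    then have "fps_nth (y * fps_of_poly q) k = fps_nth y k * coeff q 0"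
      unfolding fps_mult_nth by (subst sum.remove[of _ k]) auto
    then have "fps_nth y k * coeff q 0 = coeff p k" by (simp add: yq)
    moreover have "coeff p k = 0" using p[of k] less.prems by blast
    ultimately show ?case using q0 by simp
  qed
  have "i \<in> int ` semigrp Q" if "coef Q ?f i \<noteq> 0" for i
    using that zero[of "nat i"] unfolding y by (cases "i < 0") (auto intro!: image_eqI[of _ _
        "nat i"])
  then show ?thesis by (simp add: lring_def)
qed

lemma tpar_eq_unif: "Q = None \<or> Q = Some 0 \<Longrightarrow> tpar Q = unif Q"
  by auto

lemma ctr_eq_0: "Q = None \<or> Q = Some 0 \<Longrightarrow> ctr Q = 0"
  by auto

lemma finite_coeffs: "finite {j. coeff p j \<noteq> 0}"
  by (rule finite_subset[of _ "{..degree p}"]) (auto intro: le_degree)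

text \<open>The delicate part is to realize an element of \<open>lring\<close> by forms. Regularity
  gives a fraction in \<open>unif Q\<close>, and a common factor must bring the exponents of
  numerator and denominator into one \<open>wts Q d\<close>. Away from \<open>0\<close> and infinity
  this also justifies the value \<open>UNIV\<close> of \<open>semigrp\<close>.\<close>

lemma local_ring_phi: "local_ring phi (rat_map phi Q) = lring (Q :: 'k::field option)"
proof (intro equalityI subsetI)
  fix f :: "'k ratfun" assume "f \<in> local_ring phi (rat_map phi Q)"
  then obtain p q d where pq: "\<And>j. coeff p j \<noteq> 0 \<Longrightarrow> j \<in> wts Q d" "\<And>j. coeff q j \<noteq> 0 \<Longrightarrow> j \<in> wts Q d"
      "poly q (ctr Q) \<noteq> 0" "f = rf_eval p (tpar Q) / rf_eval q (tpar Q)"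
    unfolding local_ring_phi_iff by blast
  show "f \<in> lring Q"
  proof (cases "Q = None \<or> Q = Some 0")
    case True
    then have "wts Q d \<subseteq> semigrp Q" by (auto simp: semigrp_def)
    then show ?thesis
      unfolding pq(4) tpar_eq_unif[OF True]
      using pq(1-3) by (intro lring_quotient) (auto simp: ctr_eq_0[OF True] poly_0_coeff_0)
  next
    case False
    then obtain c where c: "Q = Some c" "c \<noteq> 0" by (cases Q) auto
    have "q \<noteq> 0" using pq(3) by auto
    then have "f \<in> ord_ge Q 0"
      using pq(3) ord_at_rf_eval_t_ge[of p c] ord_at_rf_eval_t_eq_0[of q c]
      by (cases "p = 0") (auto simp: pq(4) c ord_ge_iff ord_at_divide)
    then show ?thesis using False by (auto simp: lring_def ord_ge_def semigrp_def image_iff)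
      (metis int_nat_eq not_less)
  qed
next
  fix f :: "'k ratfun" assume f: "f \<in> lring Q"
  then have "f \<in> ord_ge Q 0" using lring_subset_ord_ge by (rule rev_subsetD)
  then have "f = 0 \<or> 0 \<le> ord_at Q f" by (simp add: ord_ge_iff)
  then obtain p q where q0: "coeff q 0 \<noteq> 0" and fpq: "f = rf_eval p (unif Q) / rf_eval q (unif Q)"
    using ratfun_quotient_unif_unit by blast
  have "q \<noteq> 0" using q0 by auto
  show "f \<in> local_ring phi (rat_map phi Q)"
  proof (cases "Q = None \<or> Q = Some 0")
    case True
    obtain C where C: "\<And>k. C \<le> k \<Longrightarrow> k \<in> semigrp Q" using semigrp_cofinite[of Q] by blast
    txt \<open>Multiplying by \<open>q'\<close>, a truncation of \<open>1 / q\<close>, makes the denominator \<open>1 + O (X\<^sup>C)\<close>,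
      which has its exponents in the semigroup.\<close>
    define y where "y = inverse (fps_of_poly q)"
    define q' where "q' = (\<Sum>i\<le>C. monom (fps_nth y i) i)"
    have q': "coeff q' i = (if i \<le> C then fps_nth y i else 0)" for i
      by (auto simp: q'_def coeff_sum)
    have yq: "y * fps_of_poly q = 1"
      unfolding y_def using q0 by (intro inverse_mult_eq_1) simp
    have qq: "coeff (q' * q) k = (if k = 0 then 1 else 0)" if "k \<le> C" for k
    proof -
      have "coeff (q' * q) k = fps_nth (y * fps_of_poly q) k"
        using that by (auto simp: coeff_mult fps_mult_nth q' atMost_atLeast0 intro!: sum.cong)
      then show ?thesis by (simp add: yq)
    qed
    have supp_qq: "k \<in> semigrp Q" if "coeff (q' * q) k \<noteq> 0" for k
      using that qq[of k] C[of k] by (cases "k \<le> C") (auto split: if_splits)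
    then have "rf_eval (q' * q) (unif Q) \<in> lring Q"
      by (auto simp: lring_def expand_rf_eval_unif_nth split: if_splits intro!: image_eqI[of _ _
          "nat _"])
    then have "f * rf_eval (q' * q) (unif Q) \<in> lring Q" by (rule lring_mult[OF f])
    moreover have "f * rf_eval (q' * q) (unif Q) = rf_eval (q' * p) (unif Q)"
      using \<open>q \<noteq> 0\<close> by (simp add: fpq crf.sub_mult)
    \<comment> \<open>The numerator needs no separate treatment: as a product of elements of
      \<open>lring\<close> it has its exponents in the semigroup.\<close>
    ultimately have *: "rf_eval (q' * p) (unif Q) \<in> lring Q" by simp
    have supp_qp: "k \<in> semigrp Q" if "coeff (q' * p) k \<noteq> 0" for k
    proof -
      have "coef Q (rf_eval (q' * p) (unif Q)) (int k) \<noteq> 0"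
        using that by (simp add: expand_rf_eval_unif_nth)
      with * show ?thesis by (auto simp: lring_def)
    qed
    have "{k. coeff (q' * p) k \<noteq> 0} \<union> {k. coeff (q' * q) k \<noteq> 0} \<subseteq> (\<Union>d. wts Q d)"
      using supp_qq supp_qp True by (auto simp: semigrp_def)
    then obtain d where "{k. coeff (q' * p) k \<noteq> 0} \<union> {k. coeff (q' * q) k \<noteq> 0} \<subseteq> wts Q d"
      using finite_subset_wts[OF finite_UnI[OF finite_coeffs finite_coeffs]] by blast
    moreover have "poly (q' * q) (ctr Q) \<noteq> 0"
      using qq[of 0] by (simp add: ctr_eq_0[OF True] poly_0_coeff_0)
    moreover have "q' \<noteq> 0" using qq[of 0] by auto
    then have "f = rf_eval (q' * p) (tpar Q) / rf_eval (q' * q) (tpar Q)"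
      by (simp add: fpq crf.sub_mult tpar_eq_unif[OF True])
    ultimately show ?thesis unfolding local_ring_phi_iff by blast
  next
    case False
    then obtain c where c: "Q = Some c" "c \<noteq> 0" by (cases Q) auto
    define sh where "sh p = p \<circ>\<^sub>p [:-c, 1:]" for p :: "'k poly"
    have sh: "rf_eval (sh p) t_rf = rf_eval p (unif Q)" for p
    proof -
      have "const_rf (- c) = - const_rf c"
        by (metis add.right_inverse const_rf_add crf.h_0 minus_unique)
      then show ?thesis by (simp add: sh_def crf.sub_pcompose const_rf_1 c)
    qed
    obtain N where N: "\<And>k. N \<le> k \<Longrightarrow> k \<in> (\<Union>d. wts Q d)" using wts_cofinite[of Q] by blast
    \<comment> \<open>Multiplying by \<open>t ^ N\<close> moves all exponents to \<open>N\<close>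
      and beyond, where every number is a weight; as \<open>c \<noteq> 0\<close>, the denominator
      still does not vanish at \<open>c\<close>.\<close>
    define P R where "P = monom 1 N * sh p" and "R = monom 1 N * sh q"
    have ge: "N \<le> j" if "coeff (monom 1 N * r) j \<noteq> 0" for r :: "'k poly" and j
      using that by (auto simp: coeff_monom_mult split: if_splits)
    have "{k. coeff P k \<noteq> 0} \<union> {k. coeff R k \<noteq> 0} \<subseteq> (\<Union>d. wts Q d)"
      using N ge by (fastforce simp: P_def R_def)
    then obtain d where "{k. coeff P k \<noteq> 0} \<union> {k. coeff R k \<noteq> 0} \<subseteq> wts Q d"
      using finite_subset_wts[OF finite_UnI[OF finite_coeffs finite_coeffs]] by blast
    moreover have "poly R (ctr Q) \<noteq> 0"
      using q0 c by (simp add: R_def sh_def poly_monom poly_pcompose poly_0_coeff_0)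
    moreover have "f = rf_eval P (tpar Q) / rf_eval R (tpar Q)"
      by (simp add: fpq c crf.sub_mult P_def R_def sh const_rf_1)
    ultimately show ?thesis unfolding local_ring_phi_iff by blast
  qed
qed
end

section \<open>Sheaves on a monomial curve\<close>

context monomial_exponents begin

text \<open>The fractional ideals of the local ring, with boundedness in both directions in place of
  finite generation.\<close>

definition lattice_at :: "'k::field option \<Rightarrow> 'k ratfun set \<Rightarrow> bool" where
  "lattice_at Q M \<longleftrightarrow> kt.subspace M \<and> (\<forall>u\<in>lring Q. \<forall>f\<in>M. u * f \<in> M) \<and>
     (\<exists>N. ord_ge Q N \<subseteq> M) \<and> (\<exists>N. M \<subseteq> ord_ge Q N)"

lemma ord_ge_mono: "m \<le> m' \<Longrightarrow> ord_ge Q m' \<subseteq> ord_ge Q m"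
  by (auto simp: ord_ge_def)

lemma ord_ge_mult: "f \<in> ord_ge Q a \<Longrightarrow> g \<in> ord_ge Q b \<Longrightarrow> f * g \<in> ord_ge Q (a + b)"
  by (cases "f = 0 \<or> g = 0") (auto simp: ord_ge_iff ord_at_mult)

lemma zero_in_ord_ge [simp]: "0 \<in> ord_ge Q m"
  by (simp add: ord_ge_iff)

lemma one_in_lring [simp]: "1 \<in> lring Q"
  by (auto simp: lring_def split: if_splits intro: image_eqI[of _ _ 0])

lemma zero_in_lring [simp]: "0 \<in> lring Q"
  by (simp add: lring_def)

lemma lring_conductor: "\<exists>C. ord_ge Q (int C) \<subseteq> lring Q"
proof -
  obtain C where C: "\<And>k. C \<le> k \<Longrightarrow> k \<in> semigrp Q" using semigrp_cofinite[of Q] by blast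
  have "i \<in> int ` semigrp Q" if "f \<in> ord_ge Q (int C)" "coef Q f i \<noteq> 0" for f i
  proof -
    have "\<not> i < int C" using that by (auto simp: ord_ge_def)
    then show ?thesis using C[of "nat i"] by (intro image_eqI[of _ _ "nat i"]) auto
  qed
  then show ?thesis by (auto simp: lring_def)
qed

lemma lattice_at_bounds:
  assumes "lattice_at Q M"
  shows "\<exists>N0. \<forall>N\<ge>N0. ord_ge Q (int N) \<subseteq> M \<and> M \<subseteq> ord_ge Q (- int N)"
proof -
  obtain a b where ab: "ord_ge Q a \<subseteq> M" "M \<subseteq> ord_ge Q b" using assms by (auto simp: lattice_at_def)
  have "ord_ge Q (int N) \<subseteq> M \<and> M \<subseteq> ord_ge Q (- int N)" if "nat \<bar>a\<bar> + nat \<bar>b\<bar> \<le> N" for N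
  proof -
    have "a \<le> int N" "- int N \<le> b" using that by linarith+
    then show ?thesis using ab ord_ge_mono[of a "int N" Q] ord_ge_mono[of "- int N" b Q] by blast
  qed
  then show ?thesis by blast
qed

lemma lattice_at_lring: "lattice_at Q (lring Q)"
proof -
  obtain C where C: "ord_ge Q (int C) \<subseteq> lring Q" using lring_conductor[of Q] by (elim exE)
  show ?thesis
    unfolding lattice_at_def
    by (intro conjI ballI exI[of _ "int C"] exI[of _ 0] C subspace_lring lring_mult
        lring_subset_ord_ge)
qed

text \<open>A nonzero element of \<open>M\<close> times the conductor lies in \<open>M\<close>, and
  the least order among the generators bounds \<open>M\<close> from the other side.\<close>

lemma lattice_at_generated:
  assumes Y: "finite Y" and M: "M = {\<Sum>y\<in>Y. c y * y | c. \<forall>y\<in>Y. c y \<in> lring Q}" and "M \<noteq> {0}"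
  shows "lattice_at Q M"
proof -
  have memI: "(\<Sum>y\<in>Y. c y * y) \<in> M" if "\<And>y. y \<in> Y \<Longrightarrow> c y \<in> lring Q" for c
    unfolding M using that by (intro CollectI exI[of _ c]) simp
  have memE: "\<exists>c. f = (\<Sum>y\<in>Y. c y * y) \<and> (\<forall>y\<in>Y. c y \<in> lring Q)" if "f \<in> M" for f
    using that unfolding M by simp
  have mult: "u * f \<in> M" if u: "u \<in> lring Q" and f: "f \<in> M" for u f
  proof -
    obtain c where c: "f = (\<Sum>y\<in>Y. c y * y)" "\<forall>y\<in>Y. c y \<in> lring Q" using memE[OF f]
      by (elim exE conjE)
    have "u * f = (\<Sum>y\<in>Y. (u * c y) * y)" by (simp add: c(1) sum_distrib_left mult.assoc)
    then show ?thesis using memI[of "\<lambda>y. u * c y"] c(2) lring_mult[OF u] by simp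
  qed
  have const: "const_rf a \<in> lring Q" for a
    using kt.subspace_scale[OF subspace_lring one_in_lring, of a] by (simp add: scale_rf_def)
  have sub: "kt.subspace M"
    unfolding kt.subspace_def
  proof (intro conjI ballI allI)
    show "0 \<in> M" using memI[of "\<lambda>_. 0"] by simp
    show "scale_rf a f \<in> M" if "f \<in> M" for a f
      unfolding scale_rf_def using mult[OF const that] .
    show "f + g \<in> M" if f: "f \<in> M" and g: "g \<in> M" for f g
    proof -
      obtain c where c: "f = (\<Sum>y\<in>Y. c y * y)" "\<forall>y\<in>Y. c y \<in> lring Q" using memE[OF f]
        by (elim exE conjE)
      obtain d where d: "g = (\<Sum>y\<in>Y. d y * y)" "\<forall>y\<in>Y. d y \<in> lring Q" using memE[OF g]
        by (elim exE conjE)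
      have "f + g = (\<Sum>y\<in>Y. (c y + d y) * y)" by (simp add: c d sum.distrib distrib_right)
      moreover have "(\<Sum>y\<in>Y. (c y + d y) * y) \<in> M"
        using c(2) d(2) by (intro memI kt.subspace_add[OF subspace_lring]) auto
      ultimately show ?thesis by simp
    qed
  qed
  obtain f0 where f0: "f0 \<in> M" "f0 \<noteq> 0" using \<open>M \<noteq> {0}\<close> kt.subspace_0[OF sub] by auto
  obtain C where C: "ord_ge Q (int C) \<subseteq> lring Q" using lring_conductor by blast
  have up: "ord_ge Q (ord_at Q f0 + int C) \<subseteq> M"
  proof
    fix g assume "g \<in> ord_ge Q (ord_at Q f0 + int C)"
    then have "g / f0 \<in> ord_ge Q (int C)" using f0
      by (cases "g = 0") (auto simp: ord_ge_iff ord_at_divide)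
    then have "g / f0 * f0 \<in> M" using C f0 by (intro mult) auto
    then show "g \<in> M" using f0 by simp
  qed
  have "\<exists>N. \<forall>y\<in>Y. y \<in> ord_ge Q N"
    using Y
  proof (induction Y)
    case (insert y Y)
    then obtain N where N: "\<forall>y\<in>Y. y \<in> ord_ge Q N" by (elim exE)
    have "y \<in> ord_ge Q (ord_at Q y)" by (simp add: ord_ge_iff)
    then show ?case using N ord_ge_mono[of "min N (ord_at Q y)" N Q] ord_ge_mono[of
      "min N (ord_at Q y)" "ord_at Q y" Q]
      by (intro exI[of _ "min N (ord_at Q y)"]) auto
  qed auto
  then obtain N where N: "\<forall>y\<in>Y. y \<in> ord_ge Q N" by (elim exE)
  have "M \<subseteq> ord_ge Q N"
  proof
    fix f assume "f \<in> M"
    then obtain c where c: "f = (\<Sum>y\<in>Y. c y * y)" "\<forall>y\<in>Y. c y \<in> lring Q" using memE[OF \<open>f \<in> M\<close>]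
      by (elim exE conjE)
    show "f \<in> ord_ge Q N"
      unfolding c(1)
      using ord_ge_mult[OF subsetD[OF lring_subset_ord_ge] N[rule_format]] c(2)
      by (intro kt.subspace_sum[OF subspace_ord_ge]) simp
  qed
  then show ?thesis using sub mult up unfolding lattice_at_def by metis
qed

lemma lring_smooth: "semigrp Q = UNIV \<Longrightarrow> lring Q = ord_ge Q 0"
  by (auto simp: lring_def ord_ge_def image_iff) (metis int_nat_eq not_less)

lemma lattice_at_nonzero:
  assumes "lattice_at Q M" shows "\<exists>f\<in>M. f \<noteq> 0"
proof -
  obtain N where N: "ord_ge Q N \<subseteq> M" using assms by (auto simp: lattice_at_def)
  have "unif Q powi N \<in> ord_ge Q N" by (simp add: ord_ge_iff ord_at_power_int)
  then show ?thesis using N by (intro bexI[of _ "unif Q powi N"]) auto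
qed

text \<open>This is the structure of fractional ideals over a discrete valuation ring: an element
  \<open>f0\<close> of least order generates.\<close>

lemma lattice_at_smooth:
  assumes "lattice_at Q M" "semigrp Q = UNIV"
  shows "\<exists>k. M = ord_ge Q k"
proof -
  define E where "E = ord_at Q ` (M - {0})"
  obtain f1 where f1: "f1 \<in> M" "f1 \<noteq> 0" using lattice_at_nonzero[OF assms(1)] by blast
  obtain b where b: "M \<subseteq> ord_ge Q b" using assms by (auto simp: lattice_at_def)
  have "\<exists>k. k \<in> E \<and> (\<forall>j\<in>E. k \<le> j)"
  proof -
    define P where "P j \<longleftrightarrow> b + int j \<in> E" for j
    have bE: "b \<le> k" if "k \<in> E" for k using that b by (auto simp: E_def ord_ge_iff)
    have "P (nat (ord_at Q f1 - b))" using bE[of "ord_at Q f1"] f1 by (auto simp: P_def E_def)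
    then have "P (LEAST j. P j)" by (rule LeastI)
    moreover have "(LEAST j. P j) \<le> nat (k - b)" if "k \<in> E" for k
      using bE[OF that] that by (intro Least_le) (simp add: P_def)
    ultimately show ?thesis unfolding P_def using bE
      by (intro exI[of _ "b + int (LEAST j. P j)"]) (auto simp: P_def nat_le_iff le_diff_eq
          le_nat_iff algebra_simps)
  qed
  then obtain k where k: "k \<in> E" "\<And>j. j \<in> E \<Longrightarrow> k \<le> j" by blast
  then obtain f0 where f0: "f0 \<in> M" "f0 \<noteq> 0" "ord_at Q f0 = k" by (auto simp: E_def)
  have "M \<subseteq> ord_ge Q k"
  proof
    fix f assume "f \<in> M"
    then show "f \<in> ord_ge Q k" using k(2)[of "ord_at Q f"]
      by (cases "f = 0") (auto simp: E_def ord_ge_iff)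
  qed
  moreover have "ord_ge Q k \<subseteq> M"
  proof
    fix g assume "g \<in> ord_ge Q k"
    then have "g / f0 \<in> lring Q"
      unfolding lring_smooth[OF assms(2)] using f0
        by (cases "g = 0") (auto simp: ord_ge_iff ord_at_divide)
    then have "g / f0 * f0 \<in> M" using assms(1) f0(1) unfolding lattice_at_def by blast
    then show "g \<in> M" using f0 by simp
  qed
  ultimately show ?thesis by (metis equalityI)
qed

lemma lattice_at_mult:
  assumes "lattice_at Q M" "h \<noteq> 0"
  shows "lattice_at Q {g. h * g \<in> M}"
proof -
  obtain a b where ab: "ord_ge Q a \<subseteq> M" "M \<subseteq> ord_ge Q b" using assms by (auto simp: lattice_at_def)
  have sub: "kt.subspace M" using assms by (simp add: lattice_at_def)
  have "kt.subspace {g. h * g \<in> M}"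
    using sub by (auto simp: kt.subspace_def distrib_left mul.scale)
  moreover have "ord_ge Q (a - ord_at Q h) \<subseteq> {g. h * g \<in> M}"
  proof
    fix g assume "g \<in> ord_ge Q (a - ord_at Q h)"
    then have "h * g \<in> ord_ge Q a" using assms(2)
      by (cases "g = 0") (auto simp: ord_ge_iff ord_at_mult)
    then show "g \<in> {g. h * g \<in> M}" using ab(1) by auto
  qed
  moreover have "{g. h * g \<in> M} \<subseteq> ord_ge Q (b - ord_at Q h)"
  proof
    fix g assume "g \<in> {g. h * g \<in> M}"
    then have "h * g \<in> ord_ge Q b" using ab(2) by auto
    then show "g \<in> ord_ge Q (b - ord_at Q h)" using assms(2)
      by (cases "g = 0") (auto simp: ord_ge_iff ord_at_mult)
  qed
  moreover have "\<forall>u\<in>lring Q. \<forall>f\<in>{g. h * g \<in> M}. u * f \<in> {g. h * g \<in> M}"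
    using assms(1) by (auto simp: lattice_at_def mult.left_commute)
  ultimately show ?thesis unfolding lattice_at_def by metis
qed

section \<open>Charts, sections and Euler characteristics\<close>

abbreviation curve :: "'k::field ppoint set" where
  "curve \<equiv> range (rat_map phi)"

lemma rat_map_phi_eq_iff [simp]: "rat_map phi Q = rat_map phi Q' \<longleftrightarrow> Q = Q'"
  using inj_rat_map_phi by (auto dest: injD)

lemma chart_iff: "rat_map phi Q \<in> chart curve i \<longleftrightarrow> i \<le> n \<and> ctr Q ^ expo Q i \<noteq> 0"
proof -
  have v: "(\<lambda>i. if i \<le> n then ctr Q ^ expo Q i else 0) \<in> rat_map phi Q"
    unfolding rat_map_phi_eq proj_pt_def by (auto intro!: exI[of _ 1])
  have x: "x i \<noteq> 0" if "x \<in> rat_map phi Q" "i \<le> n" "ctr Q ^ expo Q i \<noteq> 0" for x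
    using that unfolding rat_map_phi_eq proj_pt_def by auto
  have "rat_map phi Q \<in> chart curve i \<longleftrightarrow> (\<forall>x\<in>rat_map phi Q. x i \<noteq> 0)"
    by (simp add: chart_def)
  also have "\<dots> \<longleftrightarrow> i \<le> n \<and> ctr Q ^ expo Q i \<noteq> 0"
    using bspec[OF _ v, of "\<lambda>x. x i \<noteq> 0"] x by (auto split: if_splits)
  finally show ?thesis .
qed

lemma chart_0: "chart curve 0 = rat_map phi ` (- {None :: 'k::field option})"
proof -
  have "rat_map phi Q \<in> chart curve 0 \<longleftrightarrow> Q \<noteq> None" for Q :: "'k option"
    by (cases Q) (auto simp: chart_iff e_0 e_pos n_pos)
  moreover have "chart curve 0 \<subseteq> (curve :: 'k ppoint set)" by (auto simp: chart_def)
  ultimately show ?thesis by (auto simp: subset_iff)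
qed

lemma chart_n: "chart curve n = rat_map phi ` (- {Some 0 :: 'k::field option})"
proof -
  have "rat_map phi Q \<in> chart curve n \<longleftrightarrow> Q \<noteq> Some 0" for Q :: "'k option"
    by (cases Q) (auto simp: chart_iff e_0 e_pos n_pos)
  moreover have "chart curve n \<subseteq> (curve :: 'k ppoint set)" by (auto simp: chart_def)
  ultimately show ?thesis by (auto simp: subset_iff)
qed

lemma sections_eq: "sections F (rat_map phi ` A) = {f. \<forall>Q\<in>A. f \<in> F (rat_map phi Q)}"
  by (auto simp: sections_def)

text \<open>Away from the two points \<open>0\<close> and \<open>\<infinity>\<close> the sheaf \<open>F\<close> is the principal one generated by \<open>h\<close>.\<close>

definition trivialized :: "'k::field ratfun \<Rightarrow> 'k fsheaf \<Rightarrow> bool" where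
  "trivialized h F \<longleftrightarrow> h \<noteq> 0 \<and>
     (\<forall>c g. c \<noteq> 0 \<longrightarrow> (h * g \<in> F (rat_map phi (Some c)) \<longleftrightarrow> g \<in> ord_ge (Some c) 0)) \<and>
     lattice_at (Some 0) (F (rat_map phi (Some 0))) \<and> lattice_at None (F (rat_map phi None))"

text \<open>The stalk at \<open>Q\<close> of the isomorphic sheaf \<open>F / h\<close>, whose
  sections on the intersection of the two charts are \<open>laurent\<close> when \<open>h\<close>
  trivializes \<open>F\<close>.\<close>

definition twist :: "'k::field ratfun \<Rightarrow> 'k fsheaf \<Rightarrow> 'k option \<Rightarrow> 'k ratfun set" where
  "twist h F Q = {g. h * g \<in> F (rat_map phi Q)}"

lemma mult_image_eq: "h \<noteq> 0 \<Longrightarrow> (*) h ` {g. P (h * g)} = {f. P f}"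
  for h :: "'k::field ratfun"
proof (intro equalityI subsetI)
  fix f assume "h \<noteq> 0" "f \<in> {f. P f}"
  then have "f = h * (f / h)" "f / h \<in> {g. P (h * g)}" by auto
  then show "f \<in> (*) h ` {g. P (h * g)}" by (rule image_eqI)
qed auto

lemma trivialized_sections:
  assumes "trivialized h F"
  shows "sections F (chart curve 0) = (*) h ` (twist h F (Some 0) \<inter> laurent)"
    and "sections F (chart curve n) = (*) h ` (twist h F None \<inter> laurent)"
    and "sections F (chart curve 0 \<inter> chart curve n) = (*) h ` laurent"
    and "sections F curve = (*) h ` (twist h F (Some 0) \<inter> laurent \<inter> (twist h F None \<inter> laurent))"
proof -
  have h: "h \<noteq> 0" and L: "g \<in> laurent \<longleftrightarrow> (\<forall>c. c \<noteq> 0 \<longrightarrow> h * g \<in> F (rat_map phi (Some c)))" for g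
    using assms by (auto simp: trivialized_def laurent_def)
  have ex: "(\<forall>Q. P Q) \<longleftrightarrow> P None \<and> P (Some 0) \<and> (\<forall>c. c \<noteq> 0 \<longrightarrow> P (Some c))" for P :: "'a option \<Rightarrow> bool"
    by (metis option.exhaust)
  have "sections F (chart curve 0) = (*) h ` {g. \<forall>Q. Q \<noteq> None \<longrightarrow> h * g \<in> F (rat_map phi Q)}"
    unfolding chart_0 sections_eq by (subst mult_image_eq[OF h]) auto
  also have "{g. \<forall>Q. Q \<noteq> None \<longrightarrow> h * g \<in> F (rat_map phi Q)} = twist h F (Some 0) \<inter> laurent"
    by (subst ex) (auto simp: twist_def L)
  finally show "sections F (chart curve 0) = (*) h ` (twist h F (Some 0) \<inter> laurent)" .
  have "sections F (chart curve n) = (*) h ` {g. \<forall>Q. Q \<noteq> Some 0 \<longrightarrow> h * g \<in> F (rat_map phi Q)}"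
    unfolding chart_n sections_eq by (subst mult_image_eq[OF h]) auto
  also have "{g. \<forall>Q. Q \<noteq> Some 0 \<longrightarrow> h * g \<in> F (rat_map phi Q)} = twist h F None \<inter> laurent"
    by (subst ex) (auto simp: twist_def L)
  finally show "sections F (chart curve n) = (*) h ` (twist h F None \<inter> laurent)" .
  have int: "chart curve 0 \<inter> chart curve n = rat_map phi ` (- {None, Some 0 :: 'a option})"
    unfolding chart_0 chart_n by (auto simp: image_iff)
  have "sections F (chart curve 0 \<inter> chart curve n) = (*) h ` {g. \<forall>Q. Q \<noteq> None \<and> Q \<noteq> Some 0
    \<longrightarrow> h * g \<in> F (rat_map phi Q)}"
    unfolding int sections_eq by (subst mult_image_eq[OF h]) auto
  also have "{g. \<forall>Q. Q \<noteq> None \<and> Q \<noteq> Some 0 \<longrightarrow> h * g \<in> F (rat_map phi Q)} = laurent"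
    by (subst ex) (auto simp: L)
  finally show "sections F (chart curve 0 \<inter> chart curve n) = (*) h ` laurent" .
  have "sections F curve = (*) h ` {g. \<forall>Q. h * g \<in> F (rat_map phi Q)}"
    unfolding sections_eq by (subst mult_image_eq[OF h]) auto
  also have "{g. \<forall>Q. h * g \<in> F (rat_map phi Q)}
    = twist h F (Some 0) \<inter> laurent \<inter> (twist h F None \<inter> laurent)"
    by (subst ex) (auto simp: twist_def L)
  finally show "sections F curve = (*) h ` (twist h F (Some 0) \<inter> laurent \<inter> (twist h F None \<inter>
    laurent))" .
qed

definition ords :: "'k::field option \<Rightarrow> 'k ratfun set \<Rightarrow> int set" where
  "ords Q M = ord_at Q ` (M \<inter> laurent - {0})"

lemma trivialized_lattice:
  assumes "trivialized h F"
  shows "lattice_at (Some 0) (twist h F (Some 0))" "lattice_at None (twist h F None)"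
  using assms lattice_at_mult[of _ _ h] by (auto simp: trivialized_def twist_def)

lemma h0_eq:
  assumes "trivialized h F"
  shows "h0 curve F = kt.dim (twist h F (Some 0) \<inter> laurent \<inter> (twist h F None \<inter> laurent))"
  using assms unfolding h0_def trivialized_sections(4)[OF assms]
  by (intro dim_mult_image) (simp add: trivialized_def)

text \<open>\<open>N\<close> has to exceed the bounds of both lattices. The formula is kept for all
  large \<open>N\<close>, since different sheaves need different thresholds.\<close>

lemma euler_char_eq:
  fixes h :: "'k::alg_closed_field ratfun"
  assumes F: "trivialized h F"
  shows "\<exists>N0. \<forall>N\<ge>N0. euler_char curve phi F = int (card (ords (Some 0) (twist h F (Some 0)) \<inter>
    {..int N})) +
     int (card (ords None (twist h F None) \<inter> {..int N})) - (2 * int N + 1)"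
proof -
  let ?A = "twist h F (Some 0) \<inter> laurent" and ?B = "twist h F None \<inter> laurent"
  have h: "h \<noteq> 0" using F by (simp add: trivialized_def)
  obtain N1 where N1: "\<forall>N\<ge>N1. ord_ge (Some 0) (int N) \<subseteq> twist h F (Some 0) \<and> twist h F (Some 0)
    \<subseteq> ord_ge (Some 0) (- int N)"
    using lattice_at_bounds[OF trivialized_lattice(1)[OF F]] by (elim exE)
  obtain N2 where N2: "\<forall>N\<ge>N2. ord_ge None (int N) \<subseteq> twist h F None \<and> twist h F None
    \<subseteq> ord_ge None (- int N)"
    using lattice_at_bounds[OF trivialized_lattice(2)[OF F]] by (elim exE)
  have "h1 curve phi F = quot_dim ((*) h ` laurent) {f + g | f g. f \<in> (*) h ` ?A \<and> g \<in> (*) h ` ?B}"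
    unfolding h1_def Let_def using trivialized_sections[OF F] by simp
  also have "{f + g | f g. f \<in> (*) h ` ?A \<and> g \<in> (*) h ` ?B}
    = (*) h ` {f + g | f g. f \<in> ?A \<and> g \<in> ?B}"
  proof (intro equalityI subsetI)
    fix x assume "x \<in> {f + g | f g. f \<in> (*) h ` ?A \<and> g \<in> (*) h ` ?B}"
    then obtain f g where "x = h * f + h * g" "f \<in> ?A" "g \<in> ?B" by auto
    then show "x \<in> (*) h ` {f + g | f g. f \<in> ?A \<and> g \<in> ?B}"
      by (intro image_eqI[of _ _ "f + g"]) (auto simp: distrib_left)
  next
    fix x assume "x \<in> (*) h ` {f + g | f g. f \<in> ?A \<and> g \<in> ?B}"
    then obtain f g where "x = h * f + h * g" "f \<in> ?A" "g \<in> ?B" by (auto simp: distrib_left)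
    then show "x \<in> {f + g | f g. f \<in> (*) h ` ?A \<and> g \<in> (*) h ` ?B}" by auto
  qed
  finally have h1: "h1 curve phi F = quot_dim laurent {f + g | f g. f \<in> ?A \<and> g \<in> ?B}"
    using quot_dim_mult_image[OF h] by simp
  have "euler_char curve phi F = int (card (ords (Some 0) (twist h F (Some 0)) \<inter> {..int N})) +
     int (card (ords None (twist h F None) \<inter> {..int N})) - (2 * int N + 1)"
       if N: "max N1 N2 \<le> N" for N
    unfolding euler_char_def h1 h0_eq[OF F] ords_def
  proof (rule laurent_index)
    show "kt.subspace ?A" "kt.subspace ?B"
      using trivialized_lattice[OF F] by (auto simp: lattice_at_def intro!: kt.subspace_inter
          subspace_laurent)
    show "?A \<subseteq> ord_ge (Some 0) (- int N)" "?B \<subseteq> ord_ge None (- int N)"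
      using N1[rule_format, of N] N2[rule_format, of N] N by auto
    show "laurent \<inter> ord_ge (Some 0) (int N + 1) \<subseteq> ?A"
      using N1[rule_format, of N] N ord_ge_mono[of "int N" "int N + 1" "Some 0"] by auto
    show "laurent \<inter> ord_ge None (int N + 1) \<subseteq> ?B"
      using N2[rule_format, of N] N ord_ge_mono[of "int N" "int N + 1" None] by auto
  qed auto
  then show ?thesis by (intro exI[of _ "max N1 N2"] allI impI)
qed

lemma lring_twist_1: "twist 1 (local_ring phi) Q = lring Q"
  by (simp add: twist_def local_ring_phi)

lemma semigrp_generic: "c \<noteq> 0 \<Longrightarrow> semigrp (Some c) = UNIV"
  by (simp add: semigrp_def)

lemma trivialized_local_ring: "trivialized 1 (local_ring phi)"
  by (auto simp: trivialized_def local_ring_phi lattice_at_lring lring_smooth semigrp_generic)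

text \<open>Divisors on the affine line are principal: at each of the finitely many
  \<open>c \<noteq> 0\<close> where the stalk differs from the local ring it is the power
  \<open>k c\<close> of the maximal ideal, and \<open>h\<close> is the product of the
  \<open>t - c\<close> to these powers. At \<open>0\<close> and infinity the stalk only has to be a
  lattice.\<close>

lemma torsion_free_trivialized:
  fixes F :: "'k::field fsheaf"
  assumes "torsion_free_rank1 curve phi F"
  shows "\<exists>h. trivialized h F"
proof -
  have lat: "lattice_at Q (F (rat_map phi Q))" for Q
  proof -
    have "\<forall>P\<in>curve. F P \<noteq> {0} \<and>
       (\<exists>Y. finite Y \<and> F P = {(\<Sum>y\<in>Y. c y * y) | c. \<forall>y\<in>Y. c y \<in> local_ring phi P})"
      using assms by (simp add: torsion_free_rank1_def)
    from bspec[OF this rangeI[of _ Q]] obtain Y where "finite Y" "F (rat_map phi Q) \<noteq> {0}"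
      "F (rat_map phi Q) = {(\<Sum>y\<in>Y. c y * y) | c. \<forall>y\<in>Y. c y \<in> local_ring phi (rat_map phi Q)}"
      by (elim exE conjE)
    then show ?thesis unfolding local_ring_phi by (intro lattice_at_generated)
  qed
  have fin: "finite {Q. F (rat_map phi Q) \<noteq> lring Q}"
  proof -
    have "rat_map phi ` {Q. F (rat_map phi Q) \<noteq> lring Q} \<subseteq> {P \<in> curve. F P \<noteq> local_ring phi P}"
      by (auto simp: local_ring_phi)
    then have "finite (rat_map phi ` {Q. F (rat_map phi Q) \<noteq> lring Q})"
      by (rule finite_subset) (use assms in \<open>simp add: torsion_free_rank1_def\<close>)
    then show ?thesis by (rule finite_imageD) (simp add: inj_on_def)
  qed
  define Z where "Z = {c. c \<noteq> 0 \<and> F (rat_map phi (Some c)) \<noteq> lring (Some c)}"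
  have "finite Z"
  proof -
    have "Some ` Z \<subseteq> {Q. F (rat_map phi Q) \<noteq> lring Q}" by (auto simp: Z_def)
    then have "finite (Some ` Z)" using fin by (rule finite_subset)
    then show ?thesis by (rule finite_imageD) simp
  qed
  have "\<forall>c. \<exists>k. c \<noteq> 0 \<longrightarrow> F (rat_map phi (Some c)) = ord_ge (Some c) k"
    using lattice_at_smooth[OF lat] semigrp_generic by blast
  then obtain k where k: "\<And>c. c \<noteq> 0 \<Longrightarrow> F (rat_map phi (Some c)) = ord_ge (Some c) (k c)" by metis
  define h where "h = (\<Prod>c\<in>Z. unif (Some c) powi k c)"
  have h0: "h \<noteq> 0" unfolding h_def using \<open>finite Z\<close> by (simp del: unif.simps)
  have ordu: "ord_at (Some c) (unif (Some c')) = (if c = c' then 1 else 0)" for c c' :: 'k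
  proof -
    have "const_rf (- c') = - const_rf c'"
      by (metis add.right_inverse const_rf_add crf.h_0 minus_unique)
    then have u: "unif (Some c') = rf_eval [:- c', 1:] t_rf" by (simp add: const_rf_1)
    show ?thesis
    proof (cases "c = c'")
      case False
      then show ?thesis unfolding u by (subst ord_at_rf_eval_t_eq_0) auto
    qed (simp del: unif.simps)
  qed
  have "ord_at (Some c) (\<Prod>c'\<in>X. unif (Some c') powi k c') = (if c \<in> X then k c else 0)"
    if "finite X" for c and X :: "'k set"
    using that
  proof (induction X)
    case (insert x X)
    have "(\<Prod>c'\<in>X. unif (Some c') powi k c') \<noteq> 0" using insert(1) by (simp del: unif.simps)
    then show ?case using insert by (simp add: ord_at_mult ord_at_power_int ordu del: unif.simps)
  qed simp
  then have ordh: "ord_at (Some c) h = (if c \<in> Z then k c else 0)" for c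
    unfolding h_def using \<open>finite Z\<close> by simp
  have H: "h * g \<in> F (rat_map phi (Some c)) \<longleftrightarrow> g \<in> ord_ge (Some c) 0" if "c \<noteq> 0" for c g
  proof (cases "c \<in> Z")
    case True
    then show ?thesis using k[OF that] ordh[of c] h0
      by (cases "g = 0") (auto simp: ord_ge_iff ord_at_mult)
  next
    case False
    then have "F (rat_map phi (Some c)) = ord_ge (Some c) 0"
      using that lring_smooth[OF semigrp_generic[OF that]] by (auto simp: Z_def)
    then show ?thesis using False ordh[of c] h0
      by (cases "g = 0") (auto simp: ord_ge_iff ord_at_mult)
  qed
  show ?thesis
    unfolding trivialized_def by (intro exI[of _ h] conjI allI impI H h0 lat)
qed

end

section \<open>Gonality\<close>

definition gaps :: "nat set \<Rightarrow> nat set" where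
  "gaps S = - S"

text \<open>The number \<open>#(S - (S + r))\<close>; the guard \<open>r \<le> s\<close> is there
  because subtraction is truncated.\<close>

definition shift_defect :: "nat set \<Rightarrow> nat \<Rightarrow> nat" where
  "shift_defect S r = card {s \<in> S. \<not> (r \<le> s \<and> s - r \<in> S)}"

lemma finite_gaps: "\<forall>k\<ge>C. k \<in> S \<Longrightarrow> finite (gaps S)"
  by (rule finite_subset[of _ "{..<C}"]) (auto simp: gaps_def not_le[symmetric])

lemma card_shifted_semigroup:
  assumes C: "\<forall>k\<ge>C. k \<in> S" and N: "int C + j \<le> int N + 1"
  shows "int (card ((\<lambda>s. int s + j) ` S \<inter> {..int N})) = int N - j + 1 - int (card (gaps S))"
proof (cases "j \<le> int N")
  case True
  define M where "M = nat (int N - j)"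
  have le_M: "int s + j \<le> int N \<longleftrightarrow> s \<le> M" for s using True by (auto simp: M_def)
  have gM: "gaps S \<subseteq> {..M}"
  proof
    fix k assume "k \<in> gaps S"
    then have "\<not> C \<le> k" using C by (auto simp: gaps_def)
    then show "k \<in> {..M}" using N le_M[of k] by simp
  qed
  have "(\<lambda>s. int s + j) ` S \<inter> {..int N} = (\<lambda>s. int s + j) ` ({..M} - gaps S)"
    by (auto simp: gaps_def le_M)
  then have "card ((\<lambda>s. int s + j) ` S \<inter> {..int N}) = card ({..M} - gaps S)"
    by (simp add: card_image inj_on_def)
  also have "\<dots> = card {..M} - card (gaps S)"
    using gM finite_subset by (intro card_Diff_subset) auto
  finally show ?thesis using card_mono[OF _ gM] True by (simp add: M_def of_nat_diff)
next
  case False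
  then have "C = 0" "j = int N + 1" using N by auto
  then have "gaps S = {}" using C by (auto simp: gaps_def)
  moreover have "(\<lambda>s. int s + j) ` S \<inter> {..int N} = {}" using \<open>j = int N + 1\<close> by auto
  ultimately show ?thesis using \<open>j = int N + 1\<close> by simp
qed

text \<open>Relative to \<open>S + j\<close>, the union gains the elements of \<open>S + i\<close>
  outside it; with \<open>r = j - i\<close> there are \<open>#(S - (S + r))\<close> of them, and all
  lie below a fixed bound.\<close>

lemma card_two_shifts:
  fixes S :: "nat set"
  assumes C: "\<forall>k\<ge>C. k \<in> S" and "i < j"
  shows "\<exists>N0. \<forall>N\<ge>N0. int (card (((\<lambda>s. int s + i) ` S \<union> (\<lambda>s. int s + j) ` S) \<inter> {..int N}))
     = int N - j + 1 - int (card (gaps S)) + int (shift_defect S (nat (j - i)))"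
proof -
  define r where "r = nat (j - i)"
  have r: "j = i + int r" using assms(2) by (simp add: r_def)
  define T where "T = {s \<in> S. \<not> (r \<le> s \<and> s - r \<in> S)}"
  have Tb: "s < C + r" if "s \<in> T" for s
  proof (rule ccontr)
    assume "\<not> s < C + r"
    then have "s - r \<in> S" using C by auto
    then show False using that \<open>\<not> s < C + r\<close> by (auto simp: T_def)
  qed
  then have finT: "finite T" by (intro finite_subset[of T "{..<C + r}"]) auto
  let ?A = "(\<lambda>s. int s + i) ` S" and ?B = "(\<lambda>s. int s + j) ` S"
  \<comment> \<open>In the threshold for \<open>N\<close>, the first summand serves
    \<open>card_shifted_semigroup\<close> and the second puts all of \<open>T + i\<close> below
    \<open>N\<close>.\<close>
  have "int (card ((?A \<union> ?B) \<inter> {..int N})) = int N - j + 1 - int (card (gaps S)) + int (card T)"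
    if N: "nat \<bar>int C + j\<bar> + nat \<bar>int C + int r + i\<bar> \<le> N" for N
  proof -
    have "(?A \<union> ?B) \<inter> {..int N} = (?B \<inter> {..int N}) \<union> (\<lambda>s. int s + i) ` T"
    proof (intro equalityI subsetI)
      fix x assume x: "x \<in> (?A \<union> ?B) \<inter> {..int N}"
      show "x \<in> (?B \<inter> {..int N}) \<union> (\<lambda>s. int s + i) ` T"
      proof (cases "x \<in> ?B")
        case False
        then obtain s where s: "s \<in> S" "x = int s + i" using x by auto
        have "s \<in> T"
          unfolding T_def
        proof (intro CollectI conjI s notI)
          assume "r \<le> s \<and> s - r \<in> S"
          then have "x \<in> ?B" using s r by (intro image_eqI[of _ _ "s - r"]) auto
          with False show False by simp
        qed
        then show ?thesis using s by auto
      qed (use x in auto)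
    next
      fix x assume "x \<in> (?B \<inter> {..int N}) \<union> (\<lambda>s. int s + i) ` T"
      then show "x \<in> (?A \<union> ?B) \<inter> {..int N}"
      proof
        assume "x \<in> (\<lambda>s. int s + i) ` T"
        then obtain s where s: "s \<in> T" "x = int s + i" by auto
        then have "x \<le> int N" using Tb[of s] N by linarith
        then show ?thesis using s by (auto simp: T_def)
      qed auto
    qed
    moreover have "card ((?B \<inter> {..int N}) \<union> (\<lambda>s. int s + i) ` T) = card (?B \<inter> {..int N}) + card T"
    proof -
      have "(?B \<inter> {..int N}) \<inter> (\<lambda>s. int s + i) ` T = {}"
      proof (intro equalityI subsetI)
        fix x assume "x \<in> (?B \<inter> {..int N}) \<inter> (\<lambda>s. int s + i) ` T"
        then obtain s t where st: "x = int s + j" "s \<in> S" "x = int t + i" "t \<in> T" by blast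
        then have "t = s + r" using r by simp
        then show "x \<in> {}" using st by (simp add: T_def)
      qed simp
      moreover have "finite (?B \<inter> {..int N})"
        by (rule finite_subset[of _ "{j..int N}"]) auto
      ultimately show ?thesis using finT by (subst card_Un_disjoint) (auto simp: card_image
        inj_on_def)
    qed
    moreover have "int C + j \<le> int N + 1" using N by linarith
    ultimately show ?thesis using card_shifted_semigroup[OF C, of j N] by simp
  qed
  then show ?thesis unfolding shift_defect_def r_def[symmetric] T_def[symmetric]
    by (intro exI[of _ "nat \<bar>int C + j\<bar> + nat \<bar>int C + int r + i\<bar>"] allI impI)
qed

context monomial_exponents begin

section \<open>Units and singular points\<close>

lemma lring_inverse:
  assumes "x \<in> lring Q" "x \<noteq> 0" "ord_at Q x = 0"
  shows "inverse x \<in> lring Q"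
proof (cases "Q = None \<or> Q = Some 0")
  case True
  obtain p q d where pq: "\<forall>j. coeff p j \<noteq> 0 \<longrightarrow> j \<in> wts Q d" "\<forall>j. coeff q j \<noteq> 0 \<longrightarrow> j \<in> wts Q d"
      "poly q (ctr Q) \<noteq> 0" "x = rf_eval p (tpar Q) / rf_eval q (tpar Q)"
    using assms(1) unfolding local_ring_phi[symmetric] local_ring_phi_iff by (elim exE conjE)
  have pq': "coeff p j \<noteq> 0 \<Longrightarrow> j \<in> semigrp Q" "coeff q j \<noteq> 0 \<Longrightarrow> j \<in> semigrp Q" for j
    using pq True by (auto simp: semigrp_def)
  have p0: "p \<noteq> 0" "q \<noteq> 0" using assms(2) pq by auto
  have q0: "coeff q 0 \<noteq> 0" using pq(3) by (simp add: ctr_eq_0[OF True] poly_0_coeff_0)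
  have "ord_at Q (rf_eval q (unif Q)) = 0"
    unfolding ord_at_def using q0 by (intro fls_subdegree_eqI) (auto simp: expand_rf_eval_unif_nth)
  then have "ord_at Q (rf_eval p (unif Q)) = 0"
    using assms(3) p0 by (simp add: pq(4) tpar_eq_unif[OF True] ord_at_divide)
  \<comment> \<open>Order zero forces a nonzero constant term of the numerator, so the inverted
    fraction meets the hypotheses of \<open>lring_quotient\<close>.\<close>
  then have "coeff p 0 \<noteq> 0"
    using ord_at_nth[of "rf_eval p (unif Q)" Q] p0 by (simp add: expand_rf_eval_unif_nth)
  then have "rf_eval q (unif Q) / rf_eval p (unif Q) \<in> lring Q"
    by (intro lring_quotient pq')
  then show ?thesis by (simp add: pq(4) tpar_eq_unif[OF True])
next
  case False
  then have "semigrp Q = UNIV" by (cases Q) (auto simp: semigrp_def)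
  then show ?thesis using assms by (simp add: lring_smooth ord_ge_iff ord_at_inverse)
qed

lemma lring_maximal_ideal:
  "{x \<in> lring Q. x = 0 \<or> inverse x \<notin> lring Q} = lring Q \<inter> ord_ge Q 1"
proof (intro equalityI subsetI)
  fix x assume x: "x \<in> {x \<in> lring Q. x = 0 \<or> inverse x \<notin> lring Q}"
  then have "x = 0 \<or> 0 \<le> ord_at Q x" using lring_subset_ord_ge[of Q]
    by (auto simp: subset_iff ord_ge_iff)
  moreover have "x = 0 \<or> ord_at Q x \<noteq> 0" using x lring_inverse[of x Q] by auto
  ultimately show "x \<in> lring Q \<inter> ord_ge Q 1" using x by (auto simp: ord_ge_iff)
next
  fix x assume x: "x \<in> lring Q \<inter> ord_ge Q 1"
  have "x = 0 \<or> inverse x \<notin> lring Q"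
  proof (rule ccontr)
    assume *: "\<not> (x = 0 \<or> inverse x \<notin> lring Q)"
    then have "0 \<le> ord_at Q (inverse x)" using lring_subset_ord_ge[of Q]
      by (auto simp: subset_iff ord_ge_iff)
    moreover have "1 \<le> ord_at Q x" using x * by (auto simp: ord_ge_iff)
    ultimately show False by (simp add: ord_at_inverse)
  qed
  then show "x \<in> {x \<in> lring Q. x = 0 \<or> inverse x \<notin> lring Q}" using x by auto
qed

text \<open>If \<open>u\<close> of order \<open>m\<close> generates the maximal ideal, every
  positive element of the semigroup is \<open>m\<close> plus an element. Hence \<open>m\<close>
  divides the whole semigroup, which contains consecutive numbers, so \<open>m = 1\<close> and the
  semigroup is closed under predecessors.\<close>

lemma singular_at_iff: "singular_at phi (rat_map phi Q) \<longleftrightarrow> semigrp Q \<noteq> UNIV"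
proof -
  have "(\<exists>u\<in>lring Q. lring Q \<inter> ord_ge Q 1 = {x * u | x. x \<in> lring Q}) \<longleftrightarrow> semigrp Q = UNIV"
  proof
    assume "\<exists>u\<in>lring Q. lring Q \<inter> ord_ge Q 1 = {x * u | x. x \<in> lring Q}"
    then obtain u where u: "u \<in> lring Q" "lring Q \<inter> ord_ge Q 1 = {x * u | x. x \<in> lring Q}"
      by (elim bexE)
    obtain C where C: "\<And>k. C \<le> k \<Longrightarrow> k \<in> semigrp Q" using semigrp_cofinite[of Q] by blast
    have pow: "\<exists>x\<in>lring Q. unif Q ^ s = x * u" if "s \<in> semigrp Q" "0 < s" for s
    proof -
      have "unif Q ^ s \<in> lring Q \<inter> ord_ge Q 1"
        using that by (auto simp: lring_unif_power ord_ge_iff ord_at_power)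
      then show ?thesis unfolding u(2) by blast
    qed
    have u0: "u \<noteq> 0" using pow[of "Suc C"] C[of "Suc C"] by auto
    have "1 * u \<in> lring Q \<inter> ord_ge Q 1" unfolding u(2) by (intro CollectI exI[of _ 1]) simp
    then have "1 \<le> ord_at Q u" using u0 by (simp add: ord_ge_iff)
    obtain m where m: "ord_at Q u = int m" using lring_ord[OF u(1) u0] by auto
    have m0: "0 < m" using \<open>1 \<le> ord_at Q u\<close> m by simp
    have step: "m \<le> s \<and> s - m \<in> semigrp Q" if s: "s \<in> semigrp Q" "0 < s" for s
    proof -
      obtain x where x: "x \<in> lring Q" "unif Q ^ s = x * u" using pow[OF s] by blast
      then have x0: "x \<noteq> 0" by auto
      have "int s = ord_at Q x + int m"
        using arg_cong[OF x(2), of "ord_at Q"] x0 u0 m by (simp add: ord_at_power ord_at_mult)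
      moreover obtain k where "ord_at Q x = int k" "k \<in> semigrp Q" using lring_ord[OF x(1) x0]
        by auto
      ultimately have "s = k + m" by simp
      then show ?thesis using \<open>k \<in> semigrp Q\<close> by simp
    qed
    have dvd: "m dvd s" if "s \<in> semigrp Q" for s
      using that
    proof (induction s rule: less_induct)
      case (less s)
      show ?case
      proof (cases "s = 0")
        case False
        then have "m \<le> s" "m dvd s - m" using step[of s] less m0 by auto
        then show ?thesis using dvd_add[of m "s - m" m] by simp
      qed simp
    qed
    have "m dvd C" "m dvd Suc C" using dvd C by auto
    then have "m dvd 1" by (metis dvd_add_right_iff Suc_eq_plus1)
    then have "m = 1" by simp
    then have sd: "k \<in> semigrp Q" if "Suc k \<in> semigrp Q" for k using step[OF that] by simp
    have "k \<in> semigrp Q" for k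
    proof (cases "k \<le> C")
      case True
      have "C \<in> semigrp Q" by (simp add: C)
      with True show ?thesis by (induction rule: inc_induct) (auto intro: sd)
    qed (simp add: C)
    then show "semigrp Q = UNIV" by auto
  next
    assume U: "semigrp Q = UNIV"
    have "unif Q \<in> lring Q" using lring_unif_power[of 1 Q] U by simp
    moreover have "lring Q \<inter> ord_ge Q 1 = {x * unif Q | x. x \<in> lring Q}"
    proof (intro equalityI subsetI)
      fix x assume "x \<in> lring Q \<inter> ord_ge Q 1"
      then have "x / unif Q \<in> lring Q" "x = x / unif Q * unif Q"
        unfolding lring_smooth[OF U] by (cases "x = 0"; auto simp: ord_ge_iff ord_at_divide)+
      then show "x \<in> {x * unif Q | x. x \<in> lring Q}" by blast
    next
      fix x assume "x \<in> {x * unif Q | x. x \<in> lring Q}"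
      then obtain y where "y \<in> lring Q" "x = y * unif Q" by blast
      then show "x \<in> lring Q \<inter> ord_ge Q 1"
        unfolding lring_smooth[OF U] by (cases "y = 0") (auto simp: ord_ge_iff ord_at_mult)
    qed
    ultimately show "\<exists>u\<in>lring Q. lring Q \<inter> ord_ge Q 1 = {x * u | x. x \<in> lring Q}" by blast
  qed
  then show ?thesis
    unfolding singular_at_def Let_def local_ring_phi lring_maximal_ideal by simp
qed

end

text \<open>\<open>Q\<close> is the only point that may be singular, and \<open>Q'\<close> is the
  opposite end of the projective line. Keeping both positions in one locale avoids proving
  everything twice.\<close>

locale monomial_one_singular = monomial_exponents +
  fixes Q Q' :: "'k::alg_closed_field option"
  assumes Q_cases: "Q = None \<and> Q' = Some 0 \<or> Q = Some 0 \<and> Q' = None"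
    and smooth: "semigrp Q' = UNIV"
begin

abbreviation "S \<equiv> semigrp Q"

lemma unif_inverse: "unif Q' = inverse (unif Q)"
  using Q_cases by auto

lemma lring_Q': "lring Q' = ord_ge Q' 0"
  by (rule lring_smooth[OF smooth])

lemma ord_le_laurent: "f \<in> laurent \<Longrightarrow> f \<noteq> 0 \<Longrightarrow> ord_at Q f \<le> - ord_at Q' f"
  using Q_cases ord_at_None_laurent[of f] by auto

lemma unif_power_int_laurent: "unif Q powi i \<in> laurent" "unif Q' powi i \<in> laurent"
proof -
  have "(inverse t_rf) powi i = (t_rf :: 'k ratfun) powi (- i)"
    by (simp add: power_int_minus power_int_inverse)
  then have "(inverse t_rf) powi i \<in> (laurent :: 'k ratfun set)"
    by (simp only: t_power_int_in_laurent)
  then show "unif Q powi i \<in> laurent" "unif Q' powi i \<in> laurent" using Q_cases by auto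
qed

lemma laurent_mult: "f \<in> laurent \<Longrightarrow> g \<in> laurent \<Longrightarrow> f * g \<in> laurent"
  using ord_ge_mult[of f _ 0 g 0] by (auto simp: laurent_def)

lemma semigrp_conductor: "\<exists>C. \<forall>k\<ge>C. k \<in> S"
  by (rule semigrp_cofinite)

lemma ords_ord_ge: "ords Q' (ord_ge Q' k) = {k..}"
proof (intro equalityI subsetI)
  fix i assume i: "i \<in> {k..}"
  have "unif Q' powi i \<in> ord_ge Q' k \<inter> laurent - {0}"
    using i unif_power_int_laurent(2) by (auto simp: ord_ge_iff ord_at_power_int)
  moreover have "ord_at Q' (unif Q' powi i) = i" by (simp add: ord_at_power_int)
  ultimately show "i \<in> ords Q' (ord_ge Q' k)" unfolding ords_def by (metis imageI)
qed (auto simp: ords_def ord_ge_iff)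

lemma ords_lring: "ords Q (lring Q) = int ` S"
proof (intro equalityI subsetI)
  fix i assume "i \<in> int ` S"
  then obtain s where s: "s \<in> S" "i = int s" by blast
  have "unif Q ^ s \<in> lring Q \<inter> laurent - {0}"
    using lring_unif_power[OF s(1)] unif_power_int_laurent(1)[of "int s"] by simp
  moreover have "ord_at Q (unif Q ^ s) = i" using s by (simp add: ord_at_power)
  ultimately show "i \<in> ords Q (lring Q)" unfolding ords_def by (metis imageI)
qed (auto simp: ords_def dest: lring_ord)

lemma euler_char_ords:
  assumes F: "trivialized h F"
  shows "\<exists>N0. \<forall>N\<ge>N0. euler_char curve phi F = int (card (ords Q (twist h F Q) \<inter> {..int N})) +
     int (card (ords Q' (twist h F Q') \<inter> {..int N})) - (2 * int N + 1)"
  using Q_cases euler_char_eq[OF F] by (elim disjE conjE) (simp_all add: add.commute)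

lemma lattice_at_twist:
  assumes "trivialized h F" shows "lattice_at Q (twist h F Q)" "lattice_at Q' (twist h F Q')"
  using trivialized_lattice[OF assms] Q_cases by auto

text \<open>The orders at \<open>Q'\<close> are the \<open>N - k + 1\<close> integers from
  \<open>k\<close> to \<open>N\<close>.\<close>

lemma euler_char_smooth:
  assumes F: "trivialized h F" and k: "twist h F Q' = ord_ge Q' k"
  shows "\<exists>N0. \<forall>N\<ge>N0. euler_char curve phi F = int (card (ords Q (twist h F Q) \<inter> {..int N})) -
    int N - k"
proof -
  obtain N0 where N0: "\<forall>N\<ge>N0. euler_char curve phi F
    = int (card (ords Q (twist h F Q) \<inter> {..int N})) +
     int (card (ords Q' (twist h F Q') \<inter> {..int N})) - (2 * int N + 1)"
    using euler_char_ords[OF F] by (elim exE)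
  have "euler_char curve phi F = int (card (ords Q (twist h F Q) \<inter> {..int N})) - int N - k"
    if "max N0 (nat \<bar>k\<bar>) \<le> N" for N
  proof -
    have "{k..} \<inter> {..int N} = {k..int N}" by auto
    moreover have "k \<le> int N" using that by linarith
    ultimately show ?thesis using that N0[rule_format, of N] by (simp add: k ords_ord_ge)
  qed
  then show ?thesis by (intro exI[of _ "max N0 (nat \<bar>k\<bar>)"] allI impI)
qed

lemma euler_char_local_ring: "euler_char (curve :: 'k ppoint set) phi (local_ring phi)
  = 1 - int (card (gaps S))"
proof -
  have k: "twist 1 (local_ring phi) Q' = ord_ge Q' 0" by (simp add: lring_twist_1 lring_Q')
  obtain N0 where N0: "\<forall>N\<ge>N0. euler_char (curve :: 'k ppoint set) phi (local_ring phi) =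
      int (card (ords Q (twist 1 (local_ring phi) Q) \<inter> {..int N})) - int N - 0"
    using euler_char_smooth[OF trivialized_local_ring k] by (elim exE)
  obtain C where C: "\<forall>k\<ge>C. k \<in> S" using semigrp_conductor by (elim exE)
  show ?thesis
    using N0[rule_format, of "N0 + C"] card_shifted_semigroup[OF C, of 0 "N0 + C"]
    by (simp add: lring_twist_1 ords_lring)
qed

text \<open>The order of a Laurent polynomial at \<open>Q\<close> is at most minus its order at
  \<open>Q'\<close>, here at most \<open>-k\<close>; the lattice at \<open>Q\<close> bounds the
  orders from below.\<close>

lemma global_sections_finite:
  assumes F: "trivialized h F" and k: "twist h F Q' = ord_ge Q' k"
  shows "h0 curve F = card (ord_at Q ` (twist h F Q \<inter> laurent \<inter> ord_ge Q' k - {0}))"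
    and "finite (ord_at Q ` (twist h F Q \<inter> laurent \<inter> ord_ge Q' k - {0}))"
    and "ord_at Q ` (twist h F Q \<inter> laurent \<inter> ord_ge Q' k - {0}) \<subseteq> ords Q (twist h F Q) \<inter> {..- k}"
proof -
  let ?W = "twist h F Q \<inter> laurent \<inter> ord_ge Q' k"
  have W: "twist h F (Some 0) \<inter> laurent \<inter> (twist h F None \<inter> laurent) = ?W"
    using Q_cases k by auto
  show sub: "ord_at Q ` (?W - {0}) \<subseteq> ords Q (twist h F Q) \<inter> {..- k}"
  proof
    fix i assume "i \<in> ord_at Q ` (?W - {0})"
    then obtain f where f: "f \<in> ?W" "f \<noteq> 0" "i = ord_at Q f" by auto
    then have "i \<le> - k" using ord_le_laurent[of f] by (auto simp: ord_ge_iff)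
    then show "i \<in> ords Q (twist h F Q) \<inter> {..- k}" using f by (auto simp: ords_def)
  qed
  obtain b where "twist h F Q \<subseteq> ord_ge Q b"
    using lattice_at_twist(1)[OF F] unfolding lattice_at_def by (elim conjE exE)
  then have "ords Q (twist h F Q) \<subseteq> {b..}" by (auto simp: ords_def ord_ge_iff subset_iff)
  then have "ords Q (twist h F Q) \<inter> {..- k} \<subseteq> {b..- k}" by auto
  then have "ord_at Q ` (?W - {0}) \<subseteq> {b..- k}" by (rule order_trans[OF sub])
  then show fin: "finite (ord_at Q ` (?W - {0}))" by (rule finite_subset) simp
  have "kt.subspace ?W"
    using lattice_at_twist(1)[OF F]
    by (intro kt.subspace_inter subspace_laurent subspace_ord_ge) (simp add: lattice_at_def)
  then show "h0 curve F = card (ord_at Q ` (?W - {0}))"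
    unfolding h0_eq[OF F] W by (rule dim_eq_card_ords[OF _ fin])
qed

text \<open>Orders of global functions are elements of \<open>S\<close> and at most
  \<open>0\<close>, so only the order \<open>0\<close> of the constants occurs.\<close>

lemma h0_local_ring: "h0 (curve :: 'k ppoint set) (local_ring phi) = 1"
proof -
  have k: "twist 1 (local_ring phi) Q' = ord_ge Q' 0" by (simp add: lring_twist_1 lring_Q')
  let ?E = "ord_at Q ` (twist 1 (local_ring phi) Q \<inter> laurent \<inter> ord_ge Q' 0 - {0})"
  note g = global_sections_finite[OF trivialized_local_ring k]
  have "?E \<subseteq> {0}" by (rule order_trans[OF g(3)]) (auto simp: lring_twist_1 ords_lring)
  moreover have "1 \<in> lring Q \<inter> laurent \<inter> ord_ge Q' 0 - {0}"
    using unif_power_int_laurent(1)[of 0] by (simp add: ord_ge_iff)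
  then have "0 \<in> ?E" unfolding lring_twist_1 by (intro image_eqI[of _ _ 1]) simp_all
  ultimately have "?E = {0}" by blast
  then show ?thesis using g(1) by simp
qed

lemma arith_genus_eq: "arith_genus (curve :: 'k ppoint set) phi = card (gaps S)"
  using euler_char_local_ring unfolding euler_char_def arith_genus_def h0_local_ring by simp

lemma degree_lower_bound:
  fixes F :: "'k fsheaf"
  assumes "torsion_free_rank1 curve phi F" and "2 \<le> h0 curve F"
  shows "\<exists>r\<ge>1. int (shift_defect S r) \<le> sheaf_degree curve phi F"
proof -
  obtain h where h: "trivialized h F" using torsion_free_trivialized[OF assms(1)] by (elim exE)
  let ?M = "twist h F Q"
  obtain k where k: "twist h F Q' = ord_ge Q' k"
    using lattice_at_smooth[OF lattice_at_twist(2)[OF h] smooth] by (elim exE)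
  let ?E = "ord_at Q ` (?M \<inter> laurent \<inter> ord_ge Q' k - {0})"
  note g = global_sections_finite[OF h k]
  have "\<exists>i j. i \<in> ?E \<and> j \<in> ?E \<and> i < j"
  proof (rule ccontr)
    assume "\<nexists>i j. i \<in> ?E \<and> j \<in> ?E \<and> i < j"
    then have "i = j" if "i \<in> ?E" "j \<in> ?E" for i j using that by (metis linorder_neqE)
    then have "card ?E \<le> 1" using card_le_Suc0_iff_eq[OF g(2)] by (metis One_nat_def)
    then show False using assms(2) g(1) by simp
  qed
  then obtain i j where ij: "i \<in> ?E" "j \<in> ?E" "i < j" by (elim exE conjE)
  have "j \<le> - k" using g(3) ij(2) by blast
  have up: "(\<lambda>s. int s + a) ` S \<subseteq> ords Q ?M" if a: "a \<in> ?E" for a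
  proof
    fix x assume "x \<in> (\<lambda>s. int s + a) ` S"
    then obtain s where s: "s \<in> S" "x = int s + a" by auto
    obtain f where f: "f \<in> ?M" "f \<in> laurent" "f \<noteq> 0" "ord_at Q f = a" using a by auto
    have "unif Q ^ s * f \<in> ?M"
      using lattice_at_twist(1)[OF h] lring_unif_power[OF s(1)] f(1) unfolding lattice_at_def
        by blast
    moreover have "unif Q ^ s * f \<in> laurent"
      using laurent_mult[OF unif_power_int_laurent(1)[of "int s"] f(2)] by simp
    ultimately have "unif Q ^ s * f \<in> ?M \<inter> laurent - {0}" using f(3) by simp
    moreover have "ord_at Q (unif Q ^ s * f) = x" using f s by (simp add: ord_at_mult ord_at_power)
    ultimately show "x \<in> ords Q ?M" unfolding ords_def by (metis imageI)
  qed
  obtain C where C: "\<forall>k\<ge>C. k \<in> S" using semigrp_conductor by (elim exE)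
  define r where "r = nat (j - i)"
  obtain N1 where N1: "\<forall>N\<ge>N1. int (card (((\<lambda>s. int s + i) ` S \<union> (\<lambda>s. int s + j) ` S) \<inter> {..int N}))
     = int N - j + 1 - int (card (gaps S)) + int (shift_defect S r)"
    using card_two_shifts[OF C ij(3)] unfolding r_def by (elim exE)
  obtain N2 where N2: "\<forall>N\<ge>N2. euler_char curve phi F
    = int (card (ords Q ?M \<inter> {..int N})) - int N - k"
    using euler_char_smooth[OF h k] by (elim exE)
  obtain b where "?M \<subseteq> ord_ge Q b"
    using lattice_at_twist(1)[OF h] unfolding lattice_at_def by (elim conjE exE)
  then have "ords Q ?M \<subseteq> {b..}" by (auto simp: ords_def ord_ge_iff subset_iff)
  then have "ords Q ?M \<inter> {..int (N1 + N2)} \<subseteq> {b..int (N1 + N2)}" by auto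
  then have "finite (ords Q ?M \<inter> {..int (N1 + N2)})" by (rule finite_subset) simp
  moreover have "((\<lambda>s. int s + i) ` S \<union> (\<lambda>s. int s + j) ` S) \<inter> {..int (N1 + N2)}
    \<subseteq> ords Q ?M \<inter> {..int (N1 + N2)}"
    using up[OF ij(1)] up[OF ij(2)] by auto
  ultimately have "card (((\<lambda>s. int s + i) ` S \<union> (\<lambda>s. int s + j) ` S) \<inter> {..int (N1 + N2)}) \<le> card
    (ords Q ?M \<inter> {..int (N1 + N2)})"
    by (rule card_mono)
  \<comment> \<open>Counting gives the lower bound \<open>shift_defect S r - j - k\<close>, and
    \<open>j \<le> - k\<close> because \<open>j\<close> is the order of a global section.\<close>
  then have "int (shift_defect S r) \<le> sheaf_degree curve phi F"
    using N1[rule_format, of "N1 + N2"] N2[rule_format, of "N1 + N2"] \<open>j \<le> - k\<close>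
    unfolding sheaf_degree_def euler_char_local_ring by simp
  moreover have "1 \<le> r" using ij(3) by (simp add: r_def)
  ultimately show ?thesis by blast
qed

lemma degree_attained:
  assumes r: "1 \<le> r"
  shows "\<exists>F :: 'k fsheaf. torsion_free_rank1 curve phi F \<and> 2 \<le> h0 curve F \<and> sheaf_degree curve
    phi F = int (shift_defect S r)"
proof -
  \<comment> \<open>The monomial with a pole of order \<open>r\<close> at \<open>Q\<close>; it
    equals \<open>unif Q' ^ r\<close>, so it is regular elsewhere and becomes a second global
    section beside \<open>1\<close>.\<close>
  define v where "v = unif Q powi (- int r)"
  define M where "M = {\<Sum>y\<in>{1, v}. c y * y | c. \<forall>y\<in>{1, v}. c y \<in> lring Q}"
  define F :: "'k fsheaf" where "F P = (if P = rat_map phi Q then M else local_ring phi P)" for P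
  have v0: "v \<noteq> 0" and ordv: "ord_at Q v = - int r" by (simp_all add: v_def ord_at_power_int)
  have v1: "v \<noteq> 1" using ordv r by auto
  have vL: "v \<in> laurent" unfolding v_def by (rule unif_power_int_laurent)
  have M_eq: "M = {a + b * v | a b. a \<in> lring Q \<and> b \<in> lring Q}"
  proof (intro equalityI subsetI)
    fix x assume "x \<in> M"
    then obtain c where "x = (\<Sum>y\<in>{1, v}. c y * y)" "\<forall>y\<in>{1, v}. c y \<in> lring Q"
      unfolding M_def by blast
    then show "x \<in> {a + b * v | a b. a \<in> lring Q \<and> b \<in> lring Q}" using v1 by auto
  next
    fix x assume "x \<in> {a + b * v | a b. a \<in> lring Q \<and> b \<in> lring Q}"
    then obtain a b where "x = a + b * v" "a \<in> lring Q" "b \<in> lring Q" by blast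
    then show "x \<in> M" unfolding M_def using v1
      by (intro CollectI exI[of _ "\<lambda>y. if y = 1 then a else b"]) auto
  qed
  have in_M: "1 \<in> M" "v \<in> M"
    unfolding M_eq by (rule CollectI, rule exI[of _ 1], rule exI[of _ 0], simp)
      (rule CollectI, rule exI[of _ 0], rule exI[of _ 1], simp)
  have M0: "M \<noteq> {0}" using in_M by auto
  have lat: "lattice_at Q M"
    by (rule lattice_at_generated[OF _ M_def M0]) simp
  have FP: "F (rat_map phi Q) = M" "P \<noteq> Q \<Longrightarrow> F (rat_map phi P) = lring P" for P :: "'k option"
    by (simp_all add: F_def local_ring_phi)
  have tf: "torsion_free_rank1 curve phi F"
    unfolding torsion_free_rank1_def
  proof (intro conjI ballI)
    fix P :: "'k ppoint" assume "P \<in> curve"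
    then obtain P' where P': "P = rat_map phi P'" by auto
    show "F P \<noteq> {0}"
    proof (cases "P' = Q")
      case False
      have "1 \<in> lring P'" "(1 :: 'k ratfun) \<notin> {0}" by simp_all
      then have "lring P' \<noteq> {0}" by metis
      then show ?thesis using False by (simp add: P' FP)
    qed (simp add: P' FP M0)
    show "\<exists>Y. finite Y \<and> F P = {(\<Sum>y\<in>Y. c y * y) | c. \<forall>y\<in>Y. c y \<in> local_ring phi P}"
    proof (cases "P' = Q")
      case True
      then show ?thesis using M_def by (intro exI[of _ "{1, v}"]) (simp add: P' FP local_ring_phi)
    next
      case False
      have "lring P' = {(\<Sum>y\<in>{1}. c y * y) | c. \<forall>y\<in>{1}. c y \<in> lring P'}"
      proof (intro equalityI subsetI)
        fix x assume "x \<in> lring P'"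
        then show "x \<in> {(\<Sum>y\<in>{1}. c y * y) | c. \<forall>y\<in>{1}. c y \<in> lring P'}"
          by (intro CollectI exI[of _ "\<lambda>_. x"]) simp
      qed auto
      then show ?thesis using False by (intro exI[of _ "{1}"]) (simp add: P' FP local_ring_phi)
    qed
  next
    show "finite {P \<in> curve. F P \<noteq> local_ring phi P}"
      by (rule finite_subset[of _ "{rat_map phi Q}"]) (auto simp: F_def)
  qed
  have latP: "lattice_at P (F (rat_map phi P))" for P
    by (cases "P = Q") (simp_all add: FP lat lattice_at_lring)
  have triv: "trivialized 1 F"
    unfolding trivialized_def
  proof (intro conjI allI impI)
    fix c g assume "c \<noteq> (0::'k)"
    then have "Some c \<noteq> Q" using Q_cases by auto
    then show "1 * g \<in> F (rat_map phi (Some c)) \<longleftrightarrow> g \<in> ord_ge (Some c) 0"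
      using lring_smooth[OF semigrp_generic[OF \<open>c \<noteq> 0\<close>]] by (simp add: FP)
  next
    show "lattice_at (Some 0) (F (rat_map phi (Some 0)))" "lattice_at None (F (rat_map phi None))"
      by (rule latP)+
  qed simp
  have tw: "twist 1 F Q = M" "twist 1 F Q' = ord_ge Q' 0"
  proof -
    have "Q' \<noteq> Q" using Q_cases by auto
    then show "twist 1 F Q = M" "twist 1 F Q' = ord_ge Q' 0"
      by (simp_all add: twist_def FP lring_Q')
  qed
  have ordsM: "ords Q M = (\<lambda>s. int s + (- int r)) ` S \<union> (\<lambda>s. int s + 0) ` S"
  proof (intro equalityI subsetI)
    fix i assume "i \<in> ords Q M"
    then obtain f where f: "f \<in> M" "f \<noteq> 0" "i = ord_at Q f" by (auto simp: ords_def)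
    then obtain a b where ab: "f = a + b * v" "a \<in> lring Q" "b \<in> lring Q" unfolding M_eq by blast
    have "v = inverse (unif Q) ^ r" by (simp add: v_def power_int_minus power_inverse)
    then have "expand Q v = fls_X_inv ^ r" by (simp only: expand_power expand_inverse
      expand_unif fls_inverse_X)
    then have "expand Q (b * v) = fls_shift (int r) (expand Q b)"
      by (simp add: expand_mult fls_X_inv_power_times_conv_shift)
    \<comment> \<open>Multiplication by \<open>v\<close> only shifts exponents by \<open>-r\<close>,
      so the order of \<open>a + b * v\<close> lies in the support of one summand even when leading
      terms cancel.\<close>
    then have "coef Q a i + coef Q b (i + int r) \<noteq> 0"
      using ord_at_nth[OF f(2), of Q] f(3) by (simp add: ab(1) expand_add)
    then have "coef Q a i \<noteq> 0 \<or> coef Q b (i + int r) \<noteq> 0" by auto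
    then have "i \<in> int ` S \<or> i + int r \<in> int ` S" using ab(2,3) by (auto simp: lring_def)
    then show "i \<in> (\<lambda>s. int s + (- int r)) ` S \<union> (\<lambda>s. int s + 0) ` S"
      by (auto simp: image_iff algebra_simps)
  next
    fix i assume "i \<in> (\<lambda>s. int s + (- int r)) ` S \<union> (\<lambda>s. int s + 0) ` S"
    then obtain s where s: "s \<in> S" "i = int s - int r \<or> i = int s" by auto
    have "unif Q ^ s \<in> laurent" using unif_power_int_laurent(1)[of "int s"] by simp
    then have L: "unif Q ^ s * v \<in> laurent" "unif Q ^ s * 1 \<in> laurent"
      using laurent_mult[OF _ vL] by simp_all
    have m: "unif Q ^ s * x \<in> M" if "x \<in> M" for x
      using lat lring_unif_power[OF s(1)] that unfolding lattice_at_def by blast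
    have "unif Q ^ s * v \<in> M \<inter> laurent - {0}" "unif Q ^ s * 1 \<in> M \<inter> laurent - {0}"
      using m[OF in_M(1)] m[OF in_M(2)] L v0 by simp_all
    moreover have "ord_at Q (unif Q ^ s * v) = int s - int r" "ord_at Q (unif Q ^ s * 1) = int s"
      using v0 ordv by (simp_all add: ord_at_mult ord_at_power)
    ultimately show "i \<in> ords Q M" using s(2) unfolding ords_def by (metis imageI)
  qed
  obtain C where C: "\<forall>k\<ge>C. k \<in> S" using semigrp_conductor by (elim exE)
  have "- int r < 0" using r by simp
  from card_two_shifts[OF C this] obtain N1 where N1: "\<forall>N\<ge>N1. int (card (ords Q M \<inter> {..int N}))
     = int N - 0 + 1 - int (card (gaps S)) + int (shift_defect S (nat (0 - - int r)))"
    unfolding ordsM by (elim exE)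
  obtain N2 where N2: "\<forall>N\<ge>N2. euler_char curve phi F
    = int (card (ords Q M \<inter> {..int N})) - int N - 0"
    using euler_char_smooth[OF triv tw(2)] unfolding tw(1) by (elim exE)
  have "sheaf_degree curve phi F = int (shift_defect S r)"
    using N1[rule_format, of "N1 + N2"] N2[rule_format, of "N1 + N2"]
    unfolding sheaf_degree_def euler_char_local_ring by simp
  moreover have "2 \<le> h0 curve F"
  proof -
    let ?E = "ord_at Q ` (twist 1 F Q \<inter> laurent \<inter> ord_ge Q' 0 - {0})"
    note g = global_sections_finite[OF triv tw(2)]
    have "v = unif Q' ^ r"
      by (simp add: v_def unif_inverse power_int_minus power_inverse)
    then have "v \<in> ord_ge Q' 0" by (simp add: ord_ge_iff ord_at_power)
    then have "v \<in> twist 1 F Q \<inter> laurent \<inter> ord_ge Q' 0 - {0}" using vL in_M v0 tw by simp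
    moreover have "1 \<in> twist 1 F Q \<inter> laurent \<inter> ord_ge Q' 0 - {0}"
      using unif_power_int_laurent(1)[of 0] in_M tw by (simp add: ord_ge_iff)
    ultimately have "{- int r, 0} \<subseteq> ?E" using ordv ord_at_1[of Q]
      by (metis empty_subsetI image_eqI insert_subset)
    then have "card {- int r, 0} \<le> card ?E" using g(2) by (rule card_mono[rotated])
    then show ?thesis using g(1) r by simp
  qed
  ultimately show ?thesis using tf by blast
qed

text \<open>The integer \<open>LEAST\<close> in \<open>gonality\<close> is a true minimum because
  the lower bound for the degree is attained; on the right the minimum exists since it is over
  naturals.\<close>

lemma gonality_eq: "gonality (curve :: 'k ppoint set) phi = int (LEAST m. \<exists>r\<ge>1. m
  = shift_defect S r)"
proof -
  define m where "m = (LEAST m. \<exists>r\<ge>1. m = shift_defect S r)"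
  have "\<exists>m. \<exists>r\<ge>1. m = shift_defect S r" by (intro exI[of _ "shift_defect S 1"] exI[of _ 1]) simp
  from LeastI_ex[OF this] obtain r where r: "1 \<le> r" "m = shift_defect S r" unfolding m_def by blast
  have min: "m \<le> shift_defect S r" if "1 \<le> r" for r
    unfolding m_def using that by (intro Least_le) blast
  show ?thesis
    unfolding gonality_def m_def[symmetric]
  proof (rule Least_equality)
    show "\<exists>F :: 'k fsheaf. torsion_free_rank1 curve phi F \<and> sheaf_degree curve phi F
      = int m \<and> 2 \<le> h0 curve F"
    proof -
      obtain F :: "'k fsheaf" where "torsion_free_rank1 curve phi F" "2 \<le> h0 curve F"
        "sheaf_degree curve phi F = int (shift_defect S r)"
        using degree_attained[OF r(1)] by (elim exE conjE)
      then show ?thesis using r(2) by (intro exI[of _ F] conjI) simp_all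
    qed
  next
    fix d assume "\<exists>F :: 'k fsheaf. torsion_free_rank1 curve phi F \<and> sheaf_degree curve phi F
      = d \<and> 2 \<le> h0 curve F"
    then obtain F :: "'k fsheaf" where F: "torsion_free_rank1 curve phi F"
      "sheaf_degree curve phi F = d" "2 \<le> h0 curve F"
      by (elim exE conjE)
    obtain r where "1 \<le> r" "int (shift_defect S r) \<le> d"
      using degree_lower_bound[OF F(1,3)] F(2) by blast
    then show "int m \<le> d" using min[of r] by simp
  qed
qed

lemma gonality_le_iff: "gonality (curve :: 'k ppoint set) phi \<le> int d
  \<longleftrightarrow> (\<exists>r\<ge>1. shift_defect S r \<le> d)"
proof -
  have ex: "\<exists>m. \<exists>r\<ge>1. m = shift_defect S r" by (intro exI[of _ "shift_defect S 1"] exI[of _ 1]) simp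
  have "(LEAST m. \<exists>r\<ge>1. m = shift_defect S r) \<le> d \<longleftrightarrow> (\<exists>r\<ge>1. shift_defect S r \<le> d)"
  proof
    show "\<exists>r\<ge>1. shift_defect S r \<le> d" if "(LEAST m. \<exists>r\<ge>1. m = shift_defect S r) \<le> d"
      using LeastI_ex[OF ex] that by auto
    show "(LEAST m. \<exists>r\<ge>1. m = shift_defect S r) \<le> d" if *: "\<exists>r\<ge>1. shift_defect S r \<le> d"
    proof -
      obtain r where r: "1 \<le> r" "shift_defect S r \<le> d" using * by (elim exE conjE)
      then have "(LEAST m. \<exists>r\<ge>1. m = shift_defect S r) \<le> shift_defect S r" by (intro Least_le) blast
      then show ?thesis using r(2) by (rule order_trans)
    qed
  qed
  then show ?thesis unfolding gonality_eq by simp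
qed

end

section \<open>The dualizing sheaf\<close>

text \<open>The element of lowest order \<open>m\<close> is not in the span of the others, which
  lies in \<open>ord_ge Q (m + 1)\<close>.\<close>

lemma finite_independent_ords:
  assumes "finite B" "0 \<notin> B" "inj_on (ord_at Q) B"
  shows "kt.independent B"
  using assms
proof (induction "card B" arbitrary: B)
  case 0
  then show ?case by (simp add: kt.independent_empty)
next
  case (Suc k)
  then have "B \<noteq> {}" by auto
  define m where "m = Min (ord_at Q ` B)"
  have "m \<in> ord_at Q ` B" unfolding m_def using Suc.prems \<open>B \<noteq> {}\<close> by (intro Min_in) auto
  then obtain b where b: "b \<in> B" "ord_at Q b = m" by auto
  have gt: "m < ord_at Q x" if "x \<in> B - {b}" for x
  proof -
    have "m \<le> ord_at Q x" unfolding m_def using Suc.prems that by (intro Min_le) auto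
    moreover have "ord_at Q x \<noteq> ord_at Q b" using that b Suc.prems(3) by (auto dest: inj_onD)
    ultimately show ?thesis using b by simp
  qed
  have "B - {b} \<subseteq> ord_ge Q (m + 1)"
  proof
    fix x assume "x \<in> B - {b}"
    then show "x \<in> ord_ge Q (m + 1)" using gt[of x] by (simp add: ord_ge_iff)
  qed
  then have "kt.span (B - {b}) \<subseteq> ord_ge Q (m + 1)" using subspace_ord_ge by (rule kt.span_minimal)
  moreover have "b \<notin> ord_ge Q (m + 1)" using b Suc.prems(2) by (auto simp: ord_ge_iff)
  ultimately have "b \<notin> kt.span (B - {b})" by auto
  moreover have "kt.independent (B - {b})"
    using Suc.hyps(2) Suc.prems b(1) by (intro Suc.hyps(1)) (auto intro: inj_on_diff)
  ultimately have "kt.independent (insert b (B - {b}))" by (intro kt.independent_insertI)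
  then show ?case using b(1) by (simp add: insert_absorb)
qed

lemma laurent_expansion:
  fixes f :: "'k::alg_closed_field ratfun"
  assumes "finite T" "\<And>i. coef (Some 0) f i \<noteq> 0 \<Longrightarrow> i \<in> T"
  shows "f = (\<Sum>j\<in>T. scale_rf (coef (Some 0) f j) (t_rf powi j))"
proof (rule laurent_eqI)
  fix i
  have "coef (Some 0) (\<Sum>j\<in>T. scale_rf (coef (Some 0) f j) (t_rf powi j)) i =
      (\<Sum>j\<in>T. if i = j then coef (Some 0) f j else 0)"
    unfolding expand_sum fls_nth_sum by (intro sum.cong) (auto simp: expand_scale_nth
      expand_t_power_int)
  then show "coef (Some 0) f i =
      coef (Some 0) (\<Sum>j\<in>T. scale_rf (coef (Some 0) f j) (t_rf powi j)) i"
    using assms by auto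
qed

text \<open>At infinity \<open>t = 1 / X\<close> and \<open>dt = - X ^ (-2) dX\<close>, so the
  residue of \<open>f dt\<close> reads the coefficient of \<open>f\<close> at \<open>1\<close>, up
  to sign; at finite points it reads the one at \<open>-1\<close>.\<close>

definition res_index :: "'k::field option \<Rightarrow> int" where
  "res_index P = (if P = None then 1 else -1)"

lemma residue_dt_eq_0_iff: "residue_dt P g = 0 \<longleftrightarrow> coef P g (res_index P) = 0"
proof (cases P)
  case None
  have "residue_dt P g = - fls_nth (expand P g * fls_X_inv ^ 2) (-1)"
    by (simp add: residue_dt_def None)
  also have "\<dots> = - coef P g 1"
    unfolding fls_X_inv_power_times_conv_shift by simp
  finally show ?thesis by (simp add: res_index_def None)
next
  case (Some c)
  then show ?thesis by (simp add: residue_dt_def res_index_def)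
qed

context monomial_exponents begin

text \<open>Only one point lies over each image point, so there is one residue. Elements of
  \<open>lring P\<close> are supported on the semigroup, hence testing against the powers
  \<open>unif P ^ s\<close> suffices.\<close>

lemma dualizing_stalk:
  "f \<in> dualizing_sheaf phi (rat_map phi P) \<longleftrightarrow>
    (\<forall>s\<in>semigrp P. coef P f (res_index P - int s) = 0)"
proof -
  have "f \<in> dualizing_sheaf phi (rat_map phi P) \<longleftrightarrow> (\<forall>u\<in>lring P. coef P (u * f) (res_index P) = 0)"
    by (simp add: dualizing_sheaf_def local_ring_phi residue_dt_eq_0_iff)
  also have "\<dots> \<longleftrightarrow> (\<forall>s\<in>semigrp P. coef P f (res_index P - int s) = 0)"
  proof (intro iffI ballI)
    fix s assume *: "\<forall>u\<in>lring P. coef P (u * f) (res_index P) = 0" and "s \<in> semigrp P"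
    then have "coef P (unif P ^ s * f) (res_index P) = 0" using lring_unif_power by blast
    then show "coef P f (res_index P - int s) = 0"
      by (simp add: expand_mult expand_power fls_X_power_times_conv_shift)
  next
    fix u assume *: "\<forall>s\<in>semigrp P. coef P f (res_index P - int s) = 0" and u: "u \<in> lring P"
    have "coef P u k * coef P f (res_index P - k) = 0" for k
    proof (cases "coef P u k = 0")
      case False
      then obtain s where "s \<in> semigrp P" "k = int s" using u by (auto simp: lring_def)
      then show ?thesis using * by simp
    qed simp
    then show "coef P (u * f) (res_index P) = 0"
      unfolding expand_mult fls_times_nth(2) by (intro sum.neutral ballI)
  qed
  finally show ?thesis .
qed

lemma dualizing_stalk_generic:
  "c \<noteq> 0 \<Longrightarrow> f \<in> dualizing_sheaf phi (rat_map phi (Some c)) \<longleftrightarrow> f \<in> ord_ge (Some c) 0"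
proof -
  assume c: "c \<noteq> 0"
  have "(\<forall>s. coef (Some c) f (- 1 - int s) = 0) \<longleftrightarrow> (\<forall>i<0. coef (Some c) f i = 0)"
  proof (intro iffI allI impI)
    fix i :: int assume *: "\<forall>s. coef (Some c) f (- 1 - int s) = 0" and "i < 0"
    then show "coef (Some c) f i = 0" using *[rule_format, of "nat (- 1 - i)"] by simp
  qed simp
  then show ?thesis by (simp add: dualizing_stalk semigrp_generic[OF c] res_index_def ord_ge_def)
qed

end

context monomial_one_singular begin

text \<open>The exponent of \<open>t\<close> in the differential \<open>t\<^sup>j dt\<close> attached to a gap of the singular point.\<close>

definition gap_exponent :: "int \<Rightarrow> int" where
  "gap_exponent l = (if Q = None then l - 1 else - 1 - l)"

definition canonical_exponents :: "int set" where
  "canonical_exponents = (\<lambda>l. gap_exponent (int l)) ` gaps S"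

lemma finite_gaps_S: "finite (gaps S)"
  using semigrp_conductor by (elim exE) (rule finite_gaps)

lemma expand_Q_laurent: "f \<in> laurent \<Longrightarrow> coef Q f i = coef (Some 0) f (if Q = None then - i else i)"
  and expand_Q'_laurent: "f \<in> laurent \<Longrightarrow> coef Q' f i = coef (Some 0) f (if Q = None then i else - i)"
  using Q_cases laurent_expand_None[of f] by auto

text \<open>In terms of the index \<open>l\<close> of \<open>gap_exponent\<close>, the condition at
  \<open>Q\<close> removes the elements of \<open>S\<close>, that at the smooth point
  \<open>Q'\<close> removes all \<open>l \<le> 0\<close>; the gaps remain.\<close>

lemma sections_dualizing_iff:
  "f \<in> sections (dualizing_sheaf phi) (curve :: 'k ppoint set) \<longleftrightarrow>
    f \<in> laurent \<and> (\<forall>i. coef (Some 0) f i \<noteq> 0 \<longrightarrow> i \<in> canonical_exponents)"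
proof -
  have ex: "(\<forall>P. R P) \<longleftrightarrow> R Q \<and> R Q' \<and> (\<forall>c. c \<noteq> 0 \<longrightarrow> R (Some c))" for R :: "'k option \<Rightarrow> bool"
    using Q_cases by (metis option.exhaust)
  have "f \<in> sections (dualizing_sheaf phi) (curve :: 'k ppoint set) \<longleftrightarrow>
      (\<forall>P. f \<in> dualizing_sheaf phi (rat_map phi P))"
    by (simp add: sections_def)
  also have "\<dots> \<longleftrightarrow> f \<in> laurent \<and> (\<forall>s\<in>S. coef Q f (res_index Q - int s) = 0) \<and>
      (\<forall>s. coef Q' f (res_index Q' - int s) = 0)"
  proof -
    have "(\<forall>c. c \<noteq> 0 \<longrightarrow> f \<in> dualizing_sheaf phi (rat_map phi (Some c))) \<longleftrightarrow> f \<in> laurent"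
      by (simp add: laurent_def dualizing_stalk_generic)
    then show ?thesis unfolding ex by (auto simp: dualizing_stalk smooth)
  qed
  also have "\<dots> \<longleftrightarrow> f \<in> laurent \<and> (\<forall>i. coef (Some 0) f i \<noteq> 0 \<longrightarrow> i \<in> canonical_exponents)"
  proof (cases "f \<in> laurent")
    case True
    have A: "(\<forall>s\<in>S. coef Q f (res_index Q - int s) = 0) \<longleftrightarrow>
        (\<forall>s\<in>S. coef (Some 0) f (gap_exponent (int s)) = 0)"
    proof -
      have "(if Q = None then - (res_index Q - int s) else res_index Q - int s)
        = gap_exponent (int s)" for s
        by (simp add: res_index_def gap_exponent_def)
      then show ?thesis unfolding expand_Q_laurent[OF True] by (simp only:)
    qed
    have B: "(\<forall>s. coef Q' f (res_index Q' - int s) = 0) \<longleftrightarrow>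
        (\<forall>s. coef (Some 0) f (gap_exponent (- int s)) = 0)"
    proof -
      \<comment> \<open>\<open>res_index\<close> is \<open>1\<close> at infinity and
        \<open>-1\<close> at \<open>0\<close>, which makes one formula in
        \<open>gap_exponent\<close> fit both ends.\<close>
      have "res_index Q' = - res_index Q" using Q_cases by (auto simp: res_index_def)
      then have "(if Q = None then res_index Q' - int s else - (res_index Q' - int s))
        = gap_exponent (- int s)" for s
        by (simp add: res_index_def gap_exponent_def)
      then show ?thesis unfolding expand_Q'_laurent[OF True] by (simp only:)
    qed
    have "(\<forall>i. coef (Some 0) f i \<noteq> 0 \<longrightarrow> i \<in> canonical_exponents) \<longleftrightarrow>
       (\<forall>l. coef (Some 0) f (gap_exponent l) \<noteq> 0 \<longrightarrow> l \<in> int ` gaps S)"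
    proof -
      have inv: "gap_exponent (if Q = None then i + 1 else - 1 - i) = i" for i
        by (simp add: gap_exponent_def)
      have inj: "gap_exponent l = gap_exponent l' \<longleftrightarrow> l = l'" for l l'
        by (simp add: gap_exponent_def)
      have mem: "gap_exponent l \<in> canonical_exponents \<longleftrightarrow> l \<in> int ` gaps S" for l
        by (auto simp: canonical_exponents_def image_iff inj)
      have "(\<forall>i. R i) \<longleftrightarrow> (\<forall>l. R (gap_exponent l))" for R
      proof (intro iffI allI)
        fix i assume "\<forall>l. R (gap_exponent l)"
        from this[rule_format, of "if Q = None then i + 1 else - 1 - i"] show "R i"
          by (simp only: inv)
      qed simp
      then show ?thesis unfolding mem[symmetric] .
    qed
    also have "\<dots> \<longleftrightarrow> (\<forall>l. l \<notin> int ` gaps S \<longrightarrow> coef (Some 0) f (gap_exponent l) = 0)" by blast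
    also have "\<dots> \<longleftrightarrow> (\<forall>s\<in>S. coef (Some 0) f (gap_exponent (int s)) = 0) \<and>
        (\<forall>s. coef (Some 0) f (gap_exponent (- int s)) = 0)"
    proof (intro iffI conjI ballI allI impI)
      fix s assume *: "\<forall>l. l \<notin> int ` gaps S \<longrightarrow> coef (Some 0) f (gap_exponent l) = 0"
      show "coef (Some 0) f (gap_exponent (int s)) = 0" if "s \<in> S"
        using that by (intro *[rule_format]) (auto simp: gaps_def)
      have "- int s \<notin> int ` gaps S"
      proof
        assume "- int s \<in> int ` gaps S"
        then obtain l where l: "- int s = int l" "l \<in> gaps S" by auto
        then have "l = 0" by linarith
        then show False using l(2) by (simp add: gaps_def)
      qed
      then show "coef (Some 0) f (gap_exponent (- int s)) = 0" by (rule *[rule_format])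
    next
      fix l assume *: "(\<forall>s\<in>S. coef (Some 0) f (gap_exponent (int s)) = 0) \<and>
        (\<forall>s. coef (Some 0) f (gap_exponent (- int s)) = 0)" and l: "l \<notin> int ` gaps S"
      show "coef (Some 0) f (gap_exponent l) = 0"
      proof (cases "l < 0")
        case True
        then show ?thesis using conjunct2[OF *, rule_format, of "nat (- l)"] by simp
      next
        case False
        have "nat l \<in> S"
        proof (rule ccontr)
          assume "nat l \<notin> S"
          then have "int (nat l) \<in> int ` gaps S" by (intro imageI) (simp add: gaps_def)
          then show False using l False by simp
        qed
        then show ?thesis using conjunct1[OF *, rule_format, of "nat l"] False by simp
      qed
    qed
    finally show ?thesis using A B by blast
  qed simp
  finally show ?thesis .
qed

lemma finite_canonical_exponents: "finite canonical_exponents"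
  using finite_gaps_S by (simp add: canonical_exponents_def)

lemma card_canonical_exponents: "card canonical_exponents = card (gaps S)"
  unfolding canonical_exponents_def by (rule card_image) (auto simp: inj_on_def gap_exponent_def)

abbreviation canonical_sections :: "'k ratfun set" where
  "canonical_sections \<equiv> sections (dualizing_sheaf phi) curve"

lemma t_power_int_canonical: "j \<in> canonical_exponents \<Longrightarrow> t_rf powi j \<in> canonical_sections"
  by (auto simp: sections_dualizing_iff expand_t_power_int split: if_splits)

lemma canonical_ords: "f \<in> canonical_sections \<Longrightarrow> f \<noteq> 0 \<Longrightarrow> ord_at (Some 0) f \<in> canonical_exponents"
  using ord_at_nth[of f "Some 0"] by (auto simp: sections_dualizing_iff)

lemma subspace_canonical: "kt.subspace canonical_sections"
proof -
  have "canonical_sections = laurent \<inter> (\<Inter>i\<in>- canonical_exponents. {f. coef (Some 0) f i = 0})"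
    by (rule set_eqI) (auto simp: sections_dualizing_iff)
  moreover have "kt.subspace {f. coef (Some 0) f i = 0}" for i
    by (simp add: kt.subspace_def expand_add expand_scale_nth)
  ultimately show ?thesis
    using subspace_laurent by (auto intro!: kt.subspace_inter kt.subspace_Inter)
qed

lemma dim_canonical: "kt.dim canonical_sections = card (gaps S)"
proof -
  have "ord_at (Some 0) ` (canonical_sections - {0}) = canonical_exponents"
  proof (intro equalityI subsetI)
    fix j assume "j \<in> canonical_exponents"
    then have "t_rf powi j \<in> canonical_sections - {0}" using t_power_int_canonical by simp
    moreover have "ord_at (Some 0) (t_rf powi j :: 'k ratfun) = j" by (simp add: ord_at_power_int)
    ultimately show "j \<in> ord_at (Some 0) ` (canonical_sections - {0})" by (metis imageI)
  qed (use canonical_ords in auto)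
  then show ?thesis
    using dim_eq_card_ords[OF subspace_canonical, of
        "Some 0"] finite_canonical_exponents card_canonical_exponents
    by simp
qed

text \<open>Nothing is known about \<open>f0\<close> in an arbitrary such basis. But the orders at
  \<open>0\<close> of the members are distinct canonical exponents, and there are as many members as
  exponents; with \<open>o0\<close> the order of \<open>f0\<close>, all exponents are
  reached.\<close>

lemma monomial_canonical_basis_exponents:
  assumes "monomial_canonical_basis (curve :: 'k ppoint set) phi ws"
  shows "\<exists>b f0 o0. f0 \<noteq> 0 \<and> sorted_wrt (<) (0 # b) \<and> ws = map (\<lambda>e. f0 * t_rf ^ e) (0 # b) \<and>
    (\<lambda>e. o0 + int e) ` set (0 # b) = canonical_exponents"
proof -
  from assms obtain b where ws: "distinct ws" "kt.independent (set ws)" "kt.span (set ws)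
    = canonical_sections"
    and b: "sorted_wrt (<) (0 # b)" "ws = map (\<lambda>e. ws ! 0 * t_rf ^ e) (0 # b)"
    unfolding monomial_canonical_basis_def by (elim conjE exE)
  define f0 where "f0 = ws ! 0"
  have ws_eq: "ws = map (\<lambda>e. f0 * t_rf ^ e) (0 # b)" using b(2) unfolding f0_def .
  have "f0 \<in> set ws" by (subst ws_eq) simp
  then have f0: "f0 \<noteq> 0" using ws(2) kt.dependent_zero by blast
  have set_ws: "set ws = (\<lambda>e. f0 * t_rf ^ e) ` set (0 # b)" by (subst ws_eq) simp
  have sub: "(\<lambda>e. ord_at (Some 0) f0 + int e) ` set (0 # b) \<subseteq> canonical_exponents"
  proof
    fix j assume "j \<in> (\<lambda>e. ord_at (Some 0) f0 + int e) ` set (0 # b)"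
    then obtain e where e: "e \<in> set (0 # b)" "j = ord_at (Some 0) f0 + int e" by blast
    have "f0 * t_rf ^ e \<in> set ws" unfolding set_ws using e(1) by (rule imageI)
    then have "f0 * t_rf ^ e \<in> canonical_sections" using ws(3) kt.span_superset by blast
    then have "ord_at (Some 0) (f0 * t_rf ^ e) \<in> canonical_exponents"
      by (rule canonical_ords) (simp add: f0)
    then show "j \<in> canonical_exponents" using f0 by (simp add: e(2) ord_at_mult ord_at_power)
  qed
  have "distinct (0 # b)" using b(1) strict_sorted_iff by blast
  then have "card ((\<lambda>e. ord_at (Some 0) f0 + int e) ` set (0 # b)) = length (0 # b)"
    by (subst card_image) (auto simp: inj_on_def distinct_card)
  also have "\<dots> = card (set ws)" using distinct_card[OF ws(1)] arg_cong[OF ws_eq, of length] by simp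
  also have "\<dots> = kt.dim canonical_sections"
    using kt.dim_span_eq_card_independent[OF ws(2)] ws(3) by simp
  also have "\<dots> = card canonical_exponents" by (simp add: dim_canonical card_canonical_exponents)
  finally have "(\<lambda>e. ord_at (Some 0) f0 + int e) ` set (0 # b) = canonical_exponents"
    using card_subset_eq[OF finite_canonical_exponents sub] by simp
  then show ?thesis using f0 b(1) ws_eq by (intro exI[of _ b] exI[of _ f0] exI[of _
    "ord_at (Some 0) f0"] conjI)
qed

lemma monomial_canonical_basis_exists:
  assumes "gaps S \<noteq> {}"
  shows "\<exists>ws. monomial_canonical_basis (curve :: 'k ppoint set) phi ws"
proof -
  define js where "js = sorted_list_of_set canonical_exponents"
  have set_js: "set js = canonical_exponents" and sorted_js: "sorted_wrt (<) js"
    using finite_canonical_exponents by (simp_all add: js_def)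
  have "js \<noteq> []" using assms set_js by (auto simp: canonical_exponents_def)
  then obtain j0 js' where js: "js = j0 # js'" by (cases js) auto
  define b where "b = map (\<lambda>j. nat (j - j0)) js'"
  define f0 :: "'k ratfun" where "f0 = t_rf powi j0"
  define ws where "ws = map (\<lambda>e. f0 * t_rf ^ e) (0 # b)"
  have gt: "j0 < j" if "j \<in> set js'" for j using sorted_js that by (simp add: js)
  have sorted_b: "sorted_wrt (<) (0 # b)"
  proof -
    have "nat (x - j0) < nat (y - j0)" if "x \<in> set js'" "y \<in> set js'" "x < y" for x y
      using gt[of x] that by simp
    moreover have "sorted_wrt (<) js'" using sorted_js by (simp add: js)
    ultimately have "sorted_wrt (<) b"
      unfolding b_def sorted_wrt_map by (rule sorted_wrt_mono_rel)
    moreover have "\<forall>x\<in>set b. 0 < x" using gt by (simp add: b_def)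
    ultimately show ?thesis by simp
  qed
  have pw: "f0 * t_rf ^ nat (j - j0) = t_rf powi j" if "j \<in> set js" for j
  proof -
    have "j0 \<le> j" using that gt[of j] by (auto simp: js)
    then have "t_rf ^ nat (j - j0) = (t_rf :: 'k ratfun) powi (j - j0)" by (simp add: power_int_def)
    then have "f0 * t_rf ^ nat (j - j0) = t_rf powi (j0 + (j - j0))"
      unfolding f0_def by (subst power_int_add) simp_all
    then show ?thesis by simp
  qed
  have set_b: "set (0 # b) = (\<lambda>j. nat (j - j0)) ` set js" by (simp add: b_def js)
  have "set ws = (\<lambda>e. f0 * t_rf ^ e) ` set (0 # b)" by (simp add: ws_def)
  also have "\<dots> = (\<lambda>j. t_rf powi j) ` canonical_exponents"
    unfolding set_b image_image set_js[symmetric] by (rule image_cong[OF refl pw])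
  finally have set_ws: "set ws = (\<lambda>j. t_rf powi j) ` canonical_exponents" .
  have "distinct (0 # b)" using sorted_b strict_sorted_iff by blast
  moreover have "inj_on (\<lambda>e. f0 * t_rf ^ e) X" for X
  proof (rule inj_onI)
    fix x y assume "f0 * t_rf ^ x = f0 * t_rf ^ y"
    then have "ord_at (Some 0) (t_rf ^ x :: 'k ratfun)
      = ord_at (Some 0) (t_rf ^ y :: 'k ratfun)" by (simp add: f0_def)
    then show "x = y" by (simp add: ord_at_power)
  qed
  ultimately have "distinct ws" unfolding ws_def by (simp add: distinct_map del: list.map)
  moreover have "kt.independent (set ws)"
    by (rule finite_independent_ords[of _ "Some 0"])
      (auto simp: set_ws finite_canonical_exponents inj_on_def ord_at_power_int)
  moreover have "kt.span (set ws) = canonical_sections"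
  proof (rule equalityI)
    show "kt.span (set ws) \<subseteq> canonical_sections"
      unfolding set_ws by (rule kt.span_minimal[OF _ subspace_canonical]) (use
        t_power_int_canonical in auto)
    show "canonical_sections \<subseteq> kt.span (set ws)"
    proof
      fix f assume "f \<in> canonical_sections"
      then have "f = (\<Sum>j\<in>canonical_exponents. scale_rf (coef (Some 0) f j) (t_rf powi j))"
        by (intro laurent_expansion finite_canonical_exponents) (auto simp: sections_dualizing_iff)
      moreover have "\<dots> \<in> kt.span (set ws)"
        unfolding set_ws by (intro kt.span_sum kt.span_scale kt.span_base imageI)
      ultimately show "f \<in> kt.span (set ws)" by simp
    qed
  qed
  moreover have "ws = map (\<lambda>e. ws ! 0 * t_rf ^ e) (0 # b)" by (simp add: ws_def)
  ultimately show ?thesis unfolding monomial_canonical_basis_def using sorted_b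
    by (intro exI[of _ ws] conjI exI[of _ b])
qed

end

section \<open>Gaps and arithmetic progressions\<close>

text \<open>The first terms of the maximal arithmetic progressions of difference \<open>r\<close> in \<open>G\<close>.\<close>

definition chain_starts :: "nat \<Rightarrow> nat set \<Rightarrow> nat set" where
  "chain_starts r G = {l \<in> G. \<not> (r \<le> l \<and> l - r \<in> G)}"

text \<open>Count \<open>S\<close> below \<open>C\<close> and below \<open>C + r\<close>. Both
  counts contain the pairs \<open>x\<close>, \<open>x + r\<close> in \<open>S\<close>, collected in
  \<open>V\<close>; what remains is \<open>U\<close> in the first and \<open>T\<close> in the
  second, while the counts themselves differ by \<open>r\<close>.\<close>

lemma shift_defect_eq:
  assumes C: "\<forall>k\<ge>C. k \<in> S"
  shows "shift_defect S r = r + card {l \<in> gaps S. r \<le> l \<and> l - r \<in> S}"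
proof -
  define T where "T = {s \<in> S. \<not> (r \<le> s \<and> s - r \<in> S)}"
  define U where "U = {l \<in> gaps S. r \<le> l \<and> l - r \<in> S}"
  define V where "V = {x \<in> S. x + r \<in> S \<and> x < C}"
  have GC: "gaps S \<subseteq> {..<C}" using C by (auto simp: gaps_def not_le[symmetric])
  have finG: "finite (gaps S)" using C by (rule finite_gaps)
  have SM: "card (S \<inter> {..<M}) + card (gaps S) = M" if "C \<le> M" for M
  proof -
    have "card (S \<inter> {..<M}) + card (gaps S) = card ((S \<inter> {..<M}) \<union> gaps S)"
      using finG by (subst card_Un_disjoint) (auto simp: gaps_def)
    also have "(S \<inter> {..<M}) \<union> gaps S = {..<M}" using GC that by (auto simp: gaps_def)
    finally show ?thesis by simp
  qed
  have TC: "T \<subseteq> {..<C + r}"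
  proof
    fix s assume "s \<in> T"
    then have "\<not> C + r \<le> s" using C by (auto simp: T_def)
    then show "s \<in> {..<C + r}" by simp
  qed
  have "S \<inter> {..<C + r} = T \<union> (\<lambda>x. x + r) ` V"
  proof (intro equalityI subsetI)
    fix s assume s: "s \<in> S \<inter> {..<C + r}"
    show "s \<in> T \<union> (\<lambda>x. x + r) ` V"
    proof (cases "r \<le> s \<and> s - r \<in> S")
      case True
      then show ?thesis using s by (intro UnI2 image_eqI[of _ _ "s - r"]) (auto simp: V_def)
    qed (use s in \<open>auto simp: T_def\<close>)
  next
    fix s assume "s \<in> T \<union> (\<lambda>x. x + r) ` V"
    then show "s \<in> S \<inter> {..<C + r}"
    proof
      assume "s \<in> T"
      moreover from this have "s \<in> {..<C + r}" using TC by (rule rev_subsetD)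
      ultimately show ?thesis by (simp add: T_def)
    qed (auto simp: V_def)
  qed
  moreover have "T \<inter> (\<lambda>x. x + r) ` V = {}" by (auto simp: T_def V_def)
  moreover have finV: "finite V" by (simp add: V_def)
  moreover have "card ((\<lambda>x. x + r) ` V) = card V" by (simp add: card_image)
  ultimately have 1: "card (S \<inter> {..<C + r}) = card T + card V"
    using card_Un_disjoint[OF finite_subset[OF TC], of "(\<lambda>x. x + r) ` V"] by simp
  have "S \<inter> {..<C} = V \<union> (\<lambda>l. l - r) ` U"
  proof (intro equalityI subsetI)
    fix x assume x: "x \<in> S \<inter> {..<C}"
    show "x \<in> V \<union> (\<lambda>l. l - r) ` U"
    proof (cases "x + r \<in> S")
      case False
      then show ?thesis using x by (intro UnI2 image_eqI[of _ _
        "x + r"]) (auto simp: U_def gaps_def)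
    qed (use x in \<open>auto simp: V_def\<close>)
  next
    fix x assume "x \<in> V \<union> (\<lambda>l. l - r) ` U"
    then show "x \<in> S \<inter> {..<C}"
    proof
      assume "x \<in> (\<lambda>l. l - r) ` U"
      then obtain l where l: "l \<in> gaps S" "x = l - r" "l - r \<in> S" by (auto simp: U_def)
      then have "l < C" using GC by auto
      then show ?thesis using l by simp
    qed (simp add: V_def)
  qed
  moreover have "V \<inter> (\<lambda>l. l - r) ` U = {}" by (auto simp: V_def U_def gaps_def)
  moreover have "finite U" using finG by (auto simp: U_def)
  moreover have "card ((\<lambda>l. l - r) ` U) = card U" by (rule card_image) (auto simp: inj_on_def U_def)
  ultimately have 2: "card (S \<inter> {..<C}) = card V + card U"
    using card_Un_disjoint[OF finV, of "(\<lambda>l. l - r) ` U"] by simp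
  have "card T = r + card U" using 1 2 SM[of C] SM[of "C + r"] by simp
  then show ?thesis by (simp add: shift_defect_def T_def U_def)
qed

text \<open>A gap starts a progression iff it is below \<open>r\<close> or the number
  \<open>r\<close> below it lies in \<open>S\<close>.\<close>

lemma card_chain_starts_gaps:
  assumes "finite (gaps S)"
  shows "card (chain_starts r (gaps S)) = card {l \<in> gaps S. l < r} + card {l \<in> gaps S. r \<le> l \<and> l
    - r \<in> S}"
proof -
  have "chain_starts r (gaps S) = {l \<in> gaps S. l < r} \<union> {l \<in> gaps S. r \<le> l \<and> l - r \<in> S}"
    by (auto simp: chain_starts_def gaps_def)
  then show ?thesis using assms by (simp add: card_Un_disjoint disjoint_iff)
qed

text \<open>\<open>S + m\<close> is contained in \<open>S\<close>, so the second term of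
  \<open>shift_defect_eq\<close> vanishes.\<close>

lemma shift_defect_multiplicity:
  assumes S: "\<And>a b. a \<in> S \<Longrightarrow> b \<in> S \<Longrightarrow> a + b \<in> S" and C: "\<forall>k\<ge>C. k \<in> S" and m: "m \<in> S"
  shows "shift_defect S m = m"
proof -
  have "{l \<in> gaps S. m \<le> l \<and> l - m \<in> S} = {}"
  proof (intro equals0I)
    fix l assume "l \<in> {l \<in> gaps S. m \<le> l \<and> l - m \<in> S}"
    then have "l - m \<in> S" "l \<notin> S" "m \<le> l" by (auto simp: gaps_def)
    then show False using S[of "l - m" m] m by simp
  qed
  then show ?thesis unfolding shift_defect_eq[OF C] by (simp only: card.empty)
qed

lemma multiplicity_exists:
  assumes C: "\<forall>k\<ge>C. k \<in> (S :: nat set)"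
  shows "\<exists>m\<in>S. 0 < m \<and> {1..<m} \<subseteq> gaps S"
proof -
  define m where "m = (LEAST m. m \<in> S \<and> 0 < m)"
  have "\<exists>m. m \<in> S \<and> 0 < m" using C by (intro exI[of _ "Suc C"]) simp
  then have "m \<in> S \<and> 0 < m" unfolding m_def by (rule LeastI_ex)
  moreover have "{1..<m} \<subseteq> gaps S"
  proof
    fix k assume k: "k \<in> {1..<m}"
    then show "k \<in> gaps S" using not_less_Least[of k "\<lambda>m. m \<in> S \<and> 0 < m"]
      by (simp add: m_def gaps_def)
  qed
  ultimately show ?thesis by blast
qed

text \<open>The two counts differ only in \<open>r\<close> against the number of gaps below
  \<open>r\<close>, which is at most \<open>r - 1\<close>. Conversely it is at least
  \<open>r - 1\<close> if \<open>r \<le> m\<close>, with \<open>m\<close> the multiplicity; if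
  \<open>m < r\<close>, the gaps \<open>1, ..., m - 1\<close> already give \<open>m \<le> 3\<close>,
  and \<open>m\<close> replaces \<open>r\<close> as the shift.\<close>

lemma chain_starts_iff_shift_defect:
  assumes S: "0 \<in> S" "\<And>a b. a \<in> S \<Longrightarrow> b \<in> S \<Longrightarrow> a + b \<in> S" and C: "\<forall>k\<ge>C. k \<in> S"
  shows "(\<exists>r\<ge>1. card (chain_starts r (gaps S)) \<le> 2) \<longleftrightarrow> (\<exists>r\<ge>1. shift_defect S r \<le> 3)"
proof
  assume "\<exists>r\<ge>1. shift_defect S r \<le> 3"
  then obtain r where r: "1 \<le> r" "shift_defect S r \<le> 3" by blast
  have "{l \<in> gaps S. l < r} \<subseteq> {1..<r}" using S(1) by (auto simp: gaps_def Suc_le_eq intro: gr0I)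
  then have "card {l \<in> gaps S. l < r} \<le> r - 1"
    using card_mono[of "{1..<r}" "{l \<in> gaps S. l < r}"] by simp
  then have "card (chain_starts r (gaps S)) \<le> 2"
    using r unfolding card_chain_starts_gaps[OF finite_gaps[OF C]] shift_defect_eq[OF C] by simp
  then show "\<exists>r\<ge>1. card (chain_starts r (gaps S)) \<le> 2" using r(1) by blast
next
  assume "\<exists>r\<ge>1. card (chain_starts r (gaps S)) \<le> 2"
  then obtain r where r: "1 \<le> r" "card (chain_starts r (gaps S)) \<le> 2" by blast
  obtain m where m: "m \<in> S" "0 < m" "{1..<m} \<subseteq> gaps S" using multiplicity_exists[OF C] by blast
  have fin: "finite {l \<in> gaps S. l < r}" by simp
  show "\<exists>r\<ge>1. shift_defect S r \<le> 3"
  proof (cases "m < r")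
    case True
    then have "{1..<m} \<subseteq> {l \<in> gaps S. l < r}" using m(3) by auto
    then have "m - 1 \<le> card {l \<in> gaps S. l < r}" using card_mono[OF fin, of "{1..<m}"] by simp
    then have "m \<le> 3" using r(2) unfolding card_chain_starts_gaps[OF finite_gaps[OF C]] by simp
    then show ?thesis using shift_defect_multiplicity[OF S(2) C m(1)] m(2)
      by (intro exI[of _ m]) auto
  next
    case False
    then have "{1..<r} \<subseteq> {l \<in> gaps S. l < r}" using m(3) by auto
    then have "r - 1 \<le> card {l \<in> gaps S. l < r}" using card_mono[OF fin, of "{1..<r}"] by simp
    then have "shift_defect S r \<le> 3"
      using r unfolding card_chain_starts_gaps[OF finite_gaps[OF C]] shift_defect_eq[OF C] by simp
    then show ?thesis using r(1) by blast
  qed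
qed

text \<open>Covers the plane case. With multiplicity above \<open>3\<close> and at most three gaps,
  the gaps are \<open>1, 2, 3\<close>, and the shift by \<open>1\<close> has defect at most
  \<open>2\<close>.\<close>

lemma shift_defect_small_genus:
  assumes S: "0 \<in> S" "\<And>a b. a \<in> S \<Longrightarrow> b \<in> S \<Longrightarrow> a + b \<in> S" and C: "\<forall>k\<ge>C. k \<in> S"
    and g: "card (gaps S) \<le> 3"
  shows "\<exists>r\<ge>1. shift_defect S r \<le> 3"
proof -
  obtain m where m: "m \<in> S" "0 < m" "{1..<m} \<subseteq> gaps S" using multiplicity_exists[OF C] by blast
  show ?thesis
  proof (cases "m \<le> 3")
    case True
    then show ?thesis using shift_defect_multiplicity[OF S(2) C m(1)] m(2)
      by (intro exI[of _ m]) auto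
  next
    case False
    have "{1, 2, 3} \<subseteq> gaps S" using m(3) False by auto
    moreover have "card {1, 2, 3 :: nat} = 3" by simp
    ultimately have G: "gaps S = {1, 2, 3}"
      using g card_seteq[OF finite_gaps[OF C], of "{1, 2, 3}"] by simp
    have "{l \<in> gaps S. 1 \<le> l \<and> l - 1 \<in> S} \<subseteq> {1}"
    proof
      fix l assume l: "l \<in> {l \<in> gaps S. 1 \<le> l \<and> l - 1 \<in> S}"
      then have "l - 1 \<notin> gaps S" "l \<in> gaps S" by (auto simp: gaps_def)
      then show "l \<in> {1}" unfolding G by auto
    qed
    then have "card {l \<in> gaps S. 1 \<le> l \<and> l - 1 \<in> S} \<le> 1"
      using card_mono[of "{1}" "{l \<in> gaps S. 1 \<le> l \<and> l - 1 \<in> S}"] by simp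
    then show ?thesis unfolding shift_defect_eq[OF C] by (intro exI[of _ 1]) simp
  qed
qed

text \<open>Columns are named by the index of their upper entry. The index \<open>m1\<close> is left
  out: \<open>x m1\<close> ends the first block and \<open>x (m1 + 1)\<close> begins the
  second.\<close>

definition block_columns :: "nat \<Rightarrow> nat \<Rightarrow> nat set" where
  "block_columns m1 m2 = {j. j < m1 \<or> m1 < j \<and> j \<le> m1 + m2}"

text \<open>The vanishing of the minors of the scroll matrix, read on exponents; equivalently, all
  steps inside the blocks are equal.\<close>

definition ap_blocks :: "nat \<Rightarrow> nat \<Rightarrow> (nat \<Rightarrow> int) \<Rightarrow> bool" where
  "ap_blocks m1 m2 x \<longleftrightarrow>
     (\<forall>j\<in>block_columns m1 m2. \<forall>j'\<in>block_columns m1 m2. x j + x (Suc j') = x (Suc j) + x j')"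

text \<open>Within the blocks \<open>x\<close> moves by a constant nonzero \<open>d\<close>, so an
  element without a predecessor at distance \<open>\<bar>d\<bar>\<close> must sit at an end of a
  block, and each block has one such end.\<close>

lemma ap_blocks_chain_starts:
  assumes b: "bij_betw x {..m1 + m2 + 1} (int ` G)" and ap: "ap_blocks m1 m2 x" and m: "1 \<le> m1 + m2"
  shows "\<exists>r\<ge>1. card (chain_starts r G) \<le> 2"
proof -
  \<comment> \<open>Some column exists as \<open>m1 + m2 \<ge> 1\<close>; the index taken is
    \<open>1\<close> instead of \<open>0\<close> when the first block is empty.\<close>
  obtain j0 where j0: "j0 \<in> block_columns m1 m2"
  proof (cases "m1 = 0")
    case True
    then show ?thesis using m that[of 1] by (simp add: block_columns_def)
  next
    case False
    then show ?thesis using that[of 0] by (simp add: block_columns_def)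
  qed
  define d where "d = x (Suc j0) - x j0"
  have step: "x (Suc j) = x j + d" if "j \<in> block_columns m1 m2" for j
    using ap j0 that unfolding ap_blocks_def d_def by (smt (verit))
  have "x (Suc j0) \<noteq> x j0"
    using inj_onD[OF bij_betw_imp_inj_on[OF b], of "Suc j0" j0] j0 by (auto simp: block_columns_def)
  then have d0: "d \<noteq> 0" by (simp add: d_def)
  define r where "r = nat \<bar>d\<bar>"
  have r1: "1 \<le> r" using d0 by (simp add: r_def)
  \<comment> \<open>A reordering may run the progressions backwards; for \<open>d < 0\<close> they
    start at the right ends of the blocks.\<close>
  define Z where "Z = (if d > 0 then {0, m1 + 1} else {m1, m1 + m2 + 1})"
  have "int ` chain_starts r G \<subseteq> x ` Z"
  proof
    fix y assume "y \<in> int ` chain_starts r G"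
    then obtain l where l: "y = int l" "l \<in> G" "\<not> (r \<le> l \<and> l - r \<in> G)"
      by (auto simp: chain_starts_def)
    then have "y \<in> x ` {..m1 + m2 + 1}" using b by (auto simp: bij_betw_def)
    then obtain j where j: "j \<le> m1 + m2 + 1" "x j = y" by auto
    have no: "y - int r \<notin> int ` G"
    proof
      assume "y - int r \<in> int ` G"
      then obtain l' where "int l - int r = int l'" "l' \<in> G" using l(1) by auto
      then have "l = l' + r" by linarith
      then show False using l(3) \<open>l' \<in> G\<close> by simp
    qed
    have inG: "x i \<in> int ` G" if "i \<le> m1 + m2 + 1" for i using b that by (auto simp: bij_betw_def)
    have "j \<in> Z"
    proof (rule ccontr)
      assume nZ: "j \<notin> Z"
      show False
      proof (cases "d > 0")
        case True
        then have "j - 1 \<in> block_columns m1 m2" "Suc (j - 1) = j"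
          using nZ j by (auto simp: Z_def block_columns_def)
        then have "x (j - 1) = y - int r" using step[of "j - 1"] j True by (simp add: r_def)
        moreover have "j - 1 \<le> m1 + m2 + 1" using j(1) by linarith
        ultimately show False using inG[of "j - 1"] no by simp
      next
        case False
        then have "j \<in> block_columns m1 m2"
          using nZ j by (auto simp: Z_def block_columns_def)
        then have "x (Suc j) = y - int r" "Suc j \<le> m1 + m2 + 1"
          using step[of j] j False by (auto simp: r_def block_columns_def)
        then show False using inG[of "Suc j"] no by simp
      qed
    qed
    then show "y \<in> x ` Z" using j by blast
  qed
  then have "card (int ` chain_starts r G) \<le> card (x ` Z)"
    by (rule card_mono[rotated]) (simp add: Z_def)
  also have "\<dots> \<le> card Z" by (rule card_image_le) (simp add: Z_def)
  also have "\<dots> \<le> 2" by (simp add: Z_def card_insert_if)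
  finally have "card (chain_starts r G) \<le> 2" by (simp add: card_image)
  then show ?thesis using r1 by blast
qed

lemma chain_starts_decomposition:
  assumes "finite G" "1 \<le> r" "l \<in> G"
  shows "\<exists>s\<in>chain_starts r G. \<exists>k. l = s + k * r \<and> (\<forall>i\<le>k. s + i * r \<in> G)"
  using assms(3)
proof (induction l rule: less_induct)
  case (less l)
  show ?case
  proof (cases "r \<le> l \<and> l - r \<in> G")
    case True
    then have "l - r < l" using assms(2) by auto
    then obtain s k where sk: "s \<in> chain_starts r G" "l - r = s + k * r" "\<forall>i\<le>k. s + i * r \<in> G"
      using less.IH[of "l - r"] True by blast
    then have "l = s + Suc k * r" using True by simp
    moreover have "\<forall>i\<le>Suc k. s + i * r \<in> G" using sk(3) calculation less.prems
      by (auto simp: le_Suc_eq)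
    ultimately show ?thesis using sk(1) by blast
  next
    case False
    then show ?thesis using less.prems by (intro bexI[of _ l] exI[of _ 0]) (auto simp:
      chain_starts_def)
  qed
qed

text \<open>The progression from \<open>s\<close> must leave the finite set \<open>G\<close>;
  \<open>m\<close> is its last index before that.\<close>

lemma chain_exists:
  fixes G :: "nat set"
  assumes "finite G" "1 \<le> r" "s \<in> G"
  shows "\<exists>m. \<forall>k. (\<forall>i\<le>k. s + i * r \<in> G) \<longleftrightarrow> k \<le> m"
proof -
  define K where "K = {k. \<forall>i\<le>k. s + i * r \<in> G}"
  have "k \<le> Max G" if "k \<in> K" for k
  proof -
    have "k \<le> s + k * r" using assms(2) by (simp add: trans_le_add2)
    also have "\<dots> \<le> Max G" using that assms(1) by (intro Max_ge) (auto simp: K_def)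
    finally show ?thesis .
  qed
  then have fin: "finite K" by (intro finite_subset[of K "{..Max G}"]) auto
  have "0 \<in> K" using assms(3) by (simp add: K_def)
  then obtain m where m: "m \<in> K" "\<And>k. k \<in> K \<Longrightarrow> k \<le> m"
    using Max_in[OF fin] Max_ge[OF fin] by blast
  have "k \<in> K \<longleftrightarrow> k \<le> m" for k
  proof
    assume "k \<le> m"
    then show "k \<in> K" using m(1) by (simp add: K_def)
  qed (rule m(2))
  then show ?thesis unfolding K_def by blast
qed

text \<open>The maximal progressions, listed one after the other, are the blocks. Exactly two blocks
  are needed, so a single progression is cut before its last term.\<close>

lemma chain_starts_ap_blocks:
  assumes G: "finite G" "card G = Suc N" "1 \<le> N" and r: "1 \<le> r" "card (chain_starts r G) \<le> 2"
  shows "\<exists>m1 m2 x. m1 + m2 + 1 = N \<and> bij_betw x {..N} (int ` G) \<and> ap_blocks m1 m2 x"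
proof -
  have "chain_starts r G \<noteq> {}"
  proof -
    have "Min G \<in> chain_starts r G"
    proof -
      have "G \<noteq> {}" using G(2) by auto
      then have "Min G \<in> G" using G(1) by simp
      moreover have "\<not> (r \<le> Min G \<and> Min G - r \<in> G)"
        using Min_le[OF G(1), of "Min G - r"] r(1) by auto
      ultimately show ?thesis by (simp add: chain_starts_def)
    qed
    then show ?thesis by blast
  qed
  then obtain s where s: "s \<in> chain_starts r G" by blast
  have sG: "s \<in> G" using s by (simp add: chain_starts_def)
  obtain m where m: "\<And>k. (\<forall>i\<le>k. s + i * r \<in> G) \<longleftrightarrow> k \<le> m" using chain_exists[OF G(1) r(1) sG] by metis
  have main: ?thesis if decomp: "G = (\<lambda>i. s + i * r) ` {..m1} \<union> (\<lambda>i. s' + i * r) ` {..m2}"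
    and disj: "(\<lambda>i. s + i * r) ` {..m1} \<inter> (\<lambda>i. s' + i * r) ` {..m2} = {}" for s' m1 m2
  proof -
    have inj: "inj_on (\<lambda>i. a + i * r) X" for a X using r(1) by (auto simp: inj_on_def)
    have "card G = Suc m1 + Suc m2"
      unfolding decomp by (subst card_Un_disjoint) (use disj in \<open>auto simp: card_image[OF inj]\<close>)
    then have N: "N = m1 + m2 + 1" using G(2) by simp
    define x where "x j = (if j \<le> m1 then int (s + j * r) else int (s' + (j - (m1 + 1)) * r))" for j
    have "bij_betw x {..N} (int ` G)"
      unfolding bij_betw_def
    proof
      have "{..N} = {..m1} \<union> (\<lambda>i. i + (m1 + 1)) ` {..m2}"
      proof (intro equalityI subsetI)
        fix j assume "j \<in> {..N}"
        then show "j \<in> {..m1} \<union> (\<lambda>i. i + (m1 + 1)) ` {..m2}"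
          by (cases "j \<le> m1") (auto simp: N intro!: image_eqI[of _ _ "j - (m1 + 1)"])
      qed (auto simp: N)
      then have "x ` {..N} = x ` {..m1} \<union> x ` (\<lambda>i. i + (m1 + 1)) ` {..m2}" by (simp add: image_Un)
      also have "x ` {..m1} = int ` (\<lambda>i. s + i * r) ` {..m1}"
        unfolding image_image by (intro image_cong) (auto simp: x_def)
      also have "x ` (\<lambda>i. i + (m1 + 1)) ` {..m2} = int ` (\<lambda>i. s' + i * r) ` {..m2}"
        unfolding image_image by (intro image_cong) (auto simp: x_def)
      finally show im: "x ` {..N} = int ` G" unfolding decomp by (simp add: image_Un)
      then have "card (x ` {..N}) = card {..N}" using G(2) by (simp add: card_image)
      then show "inj_on x {..N}" by (intro eq_card_imp_inj_on) auto
    qed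
    moreover have "x (Suc j) = x j + int r" if "j \<in> block_columns m1 m2" for j
    proof (cases "j < m1")
      case False
      then have "\<not> j \<le> m1" "Suc j - (m1 + 1) = Suc (j - (m1 + 1))" using that
        by (auto simp: block_columns_def)
      then show ?thesis by (simp only: x_def if_False) simp
    qed (simp add: x_def)
    then have "ap_blocks m1 m2 x" by (simp add: ap_blocks_def)
    ultimately show ?thesis using N by blast
  qed
  show ?thesis
  proof (cases "chain_starts r G = {s}")
    case True
    have Gm: "G = (\<lambda>i. s + i * r) ` {..m}"
    proof (intro equalityI subsetI)
      fix l assume "l \<in> G"
      then obtain k where "l = s + k * r" "\<forall>i\<le>k. s + i * r \<in> G"
        using chain_starts_decomposition[OF G(1) r(1)] True by fastforce
      then show "l \<in> (\<lambda>i. s + i * r) ` {..m}" using m[of k] by blast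
    qed (use m[of m] in auto)
    have inj: "inj (\<lambda>i. s + i * r)" using r(1) by (auto simp: inj_on_def)
    have "card G = Suc m" unfolding Gm using inj by (simp add: card_image inj_on_subset)
    then have "1 \<le> m" using G by simp
    \<comment> \<open>The last term becomes a block without columns; \<open>1 \<le> m\<close> keeps
      the other block nonempty.\<close>
    have split: "{..m} = {..m - 1} \<union> {m}" using \<open>1 \<le> m\<close> by auto
    have "G = (\<lambda>i. s + i * r) ` {..m - 1} \<union> (\<lambda>i. (s + m * r) + i * r) ` {..0}"
      by (subst Gm, subst split) auto
    moreover have "(\<lambda>i. s + i * r) ` {..m - 1} \<inter> (\<lambda>i. (s + m * r) + i * r) ` {..0} = {}"
      using \<open>1 \<le> m\<close> r(1) by auto
    ultimately show ?thesis by (rule main)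
  next
    case False
    then obtain s' where s': "s' \<in> chain_starts r G" "s' \<noteq> s" using s by blast
    have "finite (chain_starts r G)" using G(1) by (simp add: chain_starts_def)
    then have starts: "chain_starts r G = {s, s'}"
      using card_seteq[of "chain_starts r G" "{s, s'}"] s s' r(2) by auto
    have s'G: "s' \<in> G" using s' by (simp add: chain_starts_def)
    obtain m' where m': "\<And>k. (\<forall>i\<le>k. s' + i * r \<in> G) \<longleftrightarrow> k \<le> m'"
      using chain_exists[OF G(1) r(1) s'G] by metis
    have decomp: "G = (\<lambda>i. s + i * r) ` {..m} \<union> (\<lambda>i. s' + i * r) ` {..m'}"
    proof (intro equalityI subsetI)
      fix l assume "l \<in> G"
      then obtain a k where "a \<in> {s, s'}" "l = a + k * r" "\<forall>i\<le>k. a + i * r \<in> G"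
        using chain_starts_decomposition[OF G(1) r(1)] starts by metis
      then show "l \<in> (\<lambda>i. s + i * r) ` {..m} \<union> (\<lambda>i. s' + i * r) ` {..m'}"
        using m[of k] m'[of k] by auto
    qed (use m[of m] m'[of m'] in auto)
    \<comment> \<open>A start cannot be a later term of another progression, since its predecessor
      would lie in \<open>G\<close>.\<close>
    have no: "False" if "a \<in> chain_starts r G" "b \<in> G" "\<forall>i\<le>k. b + i * r \<in> G" "a = b + k * r"
      "a \<noteq> b" for a b k
    proof -
      have "0 < k" using that by (cases k) auto
      then have "a - r = b + (k - 1) * r" "r \<le> a" using that(4) by (cases k; simp)+
      then show False using that(1,3) by (auto simp: chain_starts_def)
    qed
    have "(\<lambda>i. s + i * r) ` {..m} \<inter> (\<lambda>i. s' + i * r) ` {..m'} = {}"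
    proof (rule equals0I)
      fix y assume "y \<in> (\<lambda>i. s + i * r) ` {..m} \<inter> (\<lambda>i. s' + i * r) ` {..m'}"
      then obtain i i' where ii: "i \<le> m" "i' \<le> m'" "s + i * r = s' + i' * r" by auto
      show False
      proof (cases "i' \<le> i")
        case True
        then have 1: "s' = s + (i - i') * r" using ii(3) by (simp add: diff_mult_distrib)
        have 2: "\<forall>j\<le>i - i'. s + j * r \<in> G" using m[of m] ii(1) by auto
        show False by (rule no[OF s'(1) sG 2 1 s'(2)])
      next
        case False
        then have 1: "s = s' + (i' - i) * r" using ii(3) by (simp add: diff_mult_distrib)
        have 2: "\<forall>j\<le>i' - i. s' + j * r \<in> G" using m'[of m'] ii(2) by auto
        show False by (rule no[OF s s'G 2 1 s'(2)[symmetric]])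
      qed
    qed
    with decomp show ?thesis by (rule main)
  qed
qed

section \<open>Scrolls\<close>

text \<open>If the field were finite, the product of all \<open>X - a\<close> plus \<open>1\<close>
  would be a nonconstant polynomial without a root.\<close>

lemma infinite_alg_closed: "infinite (UNIV :: 'k::alg_closed_field set)"
proof
  assume fin: "finite (UNIV :: 'k set)"
  define p where "p = (\<Prod>a\<in>(UNIV :: 'k set). [:- a, 1:])"
  have pa: "poly p a = 0" for a
    unfolding p_def poly_prod by (rule prod_zero[OF fin]) (auto intro!: bexI[of _ a])
  have "p \<noteq> 0" unfolding p_def using fin by simp
  have "degree p \<noteq> 0"
  proof
    assume "degree p = 0"
    then obtain a where "p = [:a:]" by (rule degree_eq_zeroE)
    then show False using pa[of 0] \<open>p \<noteq> 0\<close> by simp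
  qed
  then have "degree (p + 1) > 0" by (simp add: degree_add_eq_left)
  then obtain x where "poly (p + 1) x = 0" using alg_closed_imp_poly_has_root by blast
  then show False using pa[of x] by simp
qed

lemma power_eq_imp_exponent_eq:
  assumes "\<And>c :: 'k::alg_closed_field. c ^ x = c ^ y" shows "x = y"
proof -
  have "monom (1 :: 'k) x - monom 1 y = 0"
  proof (rule ccontr)
    assume "monom (1 :: 'k) x - monom 1 y \<noteq> 0"
    then have "finite {c. poly (monom (1 :: 'k) x - monom 1 y) c = 0}" by (rule poly_roots_finite)
    moreover have "{c. poly (monom (1 :: 'k) x - monom 1 y) c = 0} = UNIV"
      using assms by (simp add: poly_monom)
    ultimately show False using infinite_alg_closed by metis
  qed
  then have "degree (monom (1 :: 'k) x) = degree (monom (1 :: 'k) y)" by simp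
  then show ?thesis by (simp add: degree_monom_eq)
qed

lemma vec_dim_less_2_iff:
  fixes T :: "('k::field ^ 2) set"
  shows "vec.dim T < 2 \<longleftrightarrow> (\<forall>u\<in>T. \<forall>v\<in>T. u $ 1 * v $ 2 = u $ 2 * v $ 1)"
proof
  assume dim: "vec.dim T < 2"
  show "\<forall>u\<in>T. \<forall>v\<in>T. u $ 1 * v $ 2 = u $ 2 * v $ 1"
  proof (intro ballI, rule ccontr)
    fix u v :: "'k ^ 2" assume uv: "u \<in> T" "v \<in> T" and nz: "u $ 1 * v $ 2 \<noteq> u $ 2 * v $ 1"
    have "v \<noteq> 0" using nz by auto
    moreover have "u \<notin> vec.span {v}"
      using nz by (auto simp: vec.span_singleton)
    ultimately have "vec.independent {u, v}"
      by (simp add: vec.independent_insert vec.span_base)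
    moreover have "u \<noteq> v" using nz by (auto simp: mult.commute)
    ultimately have "2 \<le> vec.dim T"
      using vec.independent_card_le_dim[of "{u, v}" T] uv by simp
    with dim show False by simp
  qed
next
  assume *: "\<forall>u\<in>T. \<forall>v\<in>T. u $ 1 * v $ 2 = u $ 2 * v $ 1"
  show "vec.dim T < 2"
  proof (cases "T \<subseteq> {0}")
    case True
    then have d: "vec.dim T = 0" by simp
    show ?thesis by (subst d) simp
  next
    case False
    then obtain u :: "'k ^ 2" where u: "u \<in> T" "u \<noteq> 0" by auto
    have "T \<subseteq> vec.span {u}"
    proof
      fix v :: "'k ^ 2" assume "v \<in> T"
      then have e: "u $ 1 * v $ 2 = u $ 2 * v $ 1" using * u by blast
      have "u $ 1 \<noteq> 0 \<or> u $ 2 \<noteq> 0" using u(2) by (simp add: vec_eq_iff forall_2)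
      then have "\<exists>k. v = k *s u"
      proof
        assume "u $ 1 \<noteq> 0"
        then show ?thesis using e
          by (intro exI[of _ "v $ 1 / u $ 1"]) (simp add: vec_eq_iff forall_2 field_simps)
      next
        assume "u $ 2 \<noteq> 0"
        then show ?thesis using e
          by (intro exI[of _ "v $ 2 / u $ 2"]) (simp add: vec_eq_iff forall_2 field_simps)
      qed
      then show "v \<in> vec.span {u}" by (auto simp: vec.span_singleton)
    qed
    then have "vec.dim T \<le> card {u}" by (rule vec.dim_le_card) simp
    then show ?thesis by simp
  qed
qed

lemma scroll_columns_eq:
  fixes x :: "nat \<Rightarrow> 'k::field"
  shows "scroll_columns [m1, m2] x = (\<lambda>j. vector [x j, x (Suc j)]) ` block_columns m1 m2"
proof (intro equalityI subsetI)
  fix v :: "'k ^ 2" assume "v \<in> scroll_columns [m1, m2] x"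
  then obtain i l j where v: "v = vector [x j, x (Suc j)]" and il: "i < 2" "l < [m1, m2] ! i"
    "j = sum_list (take i [m1, m2]) + i + l"
    by (auto simp: scroll_columns_def)
  then have "i = 0 \<or> i = 1" by auto
  then have "j \<in> block_columns m1 m2" using il by (auto simp: block_columns_def)
  with v show "v \<in> (\<lambda>j. vector [x j, x (Suc j)]) ` block_columns m1 m2" by blast
next
  fix v :: "'k ^ 2" assume "v \<in> (\<lambda>j. vector [x j, x (Suc j)]) ` block_columns m1 m2"
  then obtain j where j: "v = vector [x j, x (Suc j)]" "j < m1 \<or> m1 < j \<and> j \<le> m1 + m2"
    by (auto simp: block_columns_def)
  from j(2) show "v \<in> scroll_columns [m1, m2] x"
  proof
    assume "j < m1"
    then show ?thesis unfolding scroll_columns_def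
      by (intro CollectI exI[of _ 0] exI[of _ j] exI[of _ j]) (simp add: j)
  next
    assume "m1 < j \<and> j \<le> m1 + m2"
    then show ?thesis unfolding scroll_columns_def
      by (intro CollectI exI[of _ 1] exI[of _ "j - Suc m1"] exI[of _ j]) (auto simp: j(1))
  qed
qed

text \<open>The minors are homogeneous of degree two, so one representative decides for the whole
  point.\<close>

lemma scroll_rank_condition:
  "(\<forall>x\<in>proj_pt v. vec.dim (scroll_columns [m1, m2] (x \<circ> \<sigma>)) < 2) \<longleftrightarrow>
    (\<forall>j\<in>block_columns m1 m2. \<forall>j'\<in>block_columns m1 m2.
      v (\<sigma> j) * v (\<sigma> (Suc j')) = v (\<sigma> (Suc j)) * v (\<sigma> j'))"
proof -
  have "(\<forall>x\<in>proj_pt v. P x) \<longleftrightarrow> (\<forall>c. c \<noteq> 0 \<longrightarrow> P (\<lambda>i. c * v i))" for P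
    by (auto simp: proj_pt_def)
  then have "(\<forall>x\<in>proj_pt v. vec.dim (scroll_columns [m1, m2] (x \<circ> \<sigma>)) < 2) \<longleftrightarrow>
    (\<forall>c. c \<noteq> 0 \<longrightarrow> (\<forall>j\<in>block_columns m1 m2. \<forall>j'\<in>block_columns m1 m2.
      (c * v (\<sigma> j)) * (c * v (\<sigma> (Suc j'))) = (c * v (\<sigma> (Suc j))) * (c * v (\<sigma> j'))))"
    by (simp add: scroll_columns_eq vec_dim_less_2_iff)
  also have "\<dots> \<longleftrightarrow> (\<forall>j\<in>block_columns m1 m2. \<forall>j'\<in>block_columns m1 m2.
      v (\<sigma> j) * v (\<sigma> (Suc j')) = v (\<sigma> (Suc j)) * v (\<sigma> j'))"
    by (auto simp: mult_ac) (metis mult_1 one_neq_zero)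
  finally show ?thesis .
qed

text \<open>At finite points a minor is a difference of two powers of the parameter, and over an
  infinite field these agree everywhere only for equal exponents. At infinity the exponents are
  complementary to the last one, so the same equality serves.\<close>

lemma monomial_subset_scroll_iff:
  fixes f0 :: "'k::alg_closed_field ratfun"
  assumes E: "sorted_wrt (<) (0 # b)" and f0: "f0 \<noteq> 0"
    and N: "length b = m1 + m2 + 1" and \<sigma>: "\<sigma> permutes {..length b}"
  shows "range (rat_map (map (\<lambda>e. f0 * t_rf ^ e) (0 # b))) \<subseteq> scroll [m1, m2] \<sigma> \<longleftrightarrow>
    ap_blocks m1 m2 (\<lambda>j. int ((0 # b) ! \<sigma> j))"
proof -
  let ?E = "0 # b" and ?N = "length b"
  define v where "v P i = (if i \<le> ?N then monomial_coord ?E P i else 0)" for P :: "'k option" and i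
  have range: "range (rat_map (map (\<lambda>e. f0 * t_rf ^ e) ?E)) = range (\<lambda>P. proj_pt (v P))"
    using rat_map_monomials[OF E f0] by (simp add: v_def[abs_def])
  have le: "?E ! i \<le> ?E ! ?N" if "i \<le> ?N" for i
    using sorted_wrt_nth_less[OF E, of i ?N] that by (cases "i = ?N") auto
  have \<sigma>le: "\<sigma> j \<le> ?N" if "j \<le> ?N" for j using permutes_in_image[OF \<sigma>, of j] that by simp
  have BC: "j \<le> ?N" "Suc j \<le> ?N" if "j \<in> block_columns m1 m2" for j
    using that N by (auto simp: block_columns_def)
  have proj: "proj_pt (v P) \<in> proj_space (sum_list [m1, m2] + length [m1, m2] - 1)" for P
  proof -
    have "v P 0 \<noteq> 0 \<or> v P ?N \<noteq> 0" by (cases P) (auto simp: v_def monomial_coord_def)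
    then show ?thesis unfolding proj_space_def using N
      by (intro CollectI exI[of _ "v P"]) (auto simp: v_def)
  qed
  have "range (rat_map (map (\<lambda>e. f0 * t_rf ^ e) ?E)) \<subseteq> scroll [m1, m2] \<sigma> \<longleftrightarrow>
      (\<forall>P. \<forall>x\<in>proj_pt (v P). vec.dim (scroll_columns [m1, m2] (x \<circ> \<sigma>)) < 2)"
    unfolding range scroll_def using proj by auto
  also have "\<dots> \<longleftrightarrow> (\<forall>P. \<forall>j\<in>block_columns m1 m2. \<forall>j'\<in>block_columns m1 m2.
      v P (\<sigma> j) * v P (\<sigma> (Suc j')) = v P (\<sigma> (Suc j)) * v P (\<sigma> j'))"
    by (simp only: scroll_rank_condition)
  also have "\<dots> \<longleftrightarrow> (\<forall>j\<in>block_columns m1 m2. \<forall>j'\<in>block_columns m1 m2.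
      \<forall>P. v P (\<sigma> j) * v P (\<sigma> (Suc j')) = v P (\<sigma> (Suc j)) * v P (\<sigma> j'))"
    by blast
  also have "\<dots> \<longleftrightarrow> ap_blocks m1 m2 (\<lambda>j. int (?E ! \<sigma> j))"
    unfolding ap_blocks_def
  proof (intro ball_cong refl)
    fix j j' assume j: "j \<in> block_columns m1 m2" and j': "j' \<in> block_columns m1 m2"
    have b: "\<sigma> j \<le> ?N" "\<sigma> (Suc j) \<le> ?N" "\<sigma> j' \<le> ?N" "\<sigma> (Suc j') \<le> ?N"
      using BC[OF j] BC[OF j'] \<sigma>le by auto
    have key: "(\<forall>P. v P x * v P y = v P z * v P w) \<longleftrightarrow> int (?E ! x) + int (?E ! y)
      = int (?E ! z) + int (?E ! w)"
      if "x \<le> ?N" "y \<le> ?N" "z \<le> ?N" "w \<le> ?N" for x y z w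
    proof
      assume *: "\<forall>P. v P x * v P y = v P z * v P w"
      have "c ^ (?E ! x + ?E ! y) = c ^ (?E ! z + ?E ! w)" for c :: 'k
        using *[rule_format, of "Some c"] that
          by (simp add: v_def monomial_coord_def power_add del: nth_Cons')
      then have "?E ! x + ?E ! y = ?E ! z + ?E ! w" by (rule power_eq_imp_exponent_eq)
      then show "int (?E ! x) + int (?E ! y) = int (?E ! z) + int (?E ! w)"
        by (simp only: of_nat_add[symmetric])
    next
      assume "int (?E ! x) + int (?E ! y) = int (?E ! z) + int (?E ! w)"
      then have *: "?E ! x + ?E ! y = ?E ! z + ?E ! w" by linarith
      then have **: "(?E ! ?N - ?E ! x) + (?E ! ?N - ?E ! y)
        = (?E ! ?N - ?E ! z) + (?E ! ?N - ?E ! w)"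
        using that[THEN le] by linarith
      show "\<forall>P. v P x * v P y = v P z * v P w"
      proof
        fix P show "v P x * v P y = v P z * v P w"
          using that * ** by (cases P) (simp_all add: v_def monomial_coord_def
              power_add[symmetric] del: nth_Cons')
      qed
    qed
    show "(\<forall>P. v P (\<sigma> j) * v P (\<sigma> (Suc j')) = v P (\<sigma> (Suc j)) * v P (\<sigma> j')) \<longleftrightarrow>
      int (?E ! \<sigma> j) + int (?E ! \<sigma> (Suc j')) = int (?E ! \<sigma> (Suc j)) + int (?E ! \<sigma> j')"
      by (rule key) (rule b)+
  qed
  finally show ?thesis .
qed

section \<open>Canonical model, scrolls and gonality\<close>

context monomial_one_singular begin

text \<open>Inverse to \<open>gap_exponent\<close>.\<close>

definition gap_of_exponent :: "int \<Rightarrow> int" where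
  "gap_of_exponent j = (if Q = None then j + 1 else - 1 - j)"

text \<open>\<open>\<gamma>\<close> labels each coordinate with its gap. It is affine with slope
  \<open>1\<close> or \<open>-1\<close> in the exponents, so \<open>ap_blocks\<close> is insensitive
  to the change.\<close>

lemma on_surface_scroll_iff:
  assumes b: "sorted_wrt (<) (0 # b)" and f0: "f0 \<noteq> (0 :: 'k ratfun)"
    and J: "(\<lambda>e. o0 + int e) ` set (0 # b) = canonical_exponents"
  shows "on_surface_scroll (length b) (range (rat_map (map (\<lambda>e. f0 * t_rf ^ e) (0 # b)))) \<longleftrightarrow>
    length b \<le> 2 \<or> (\<exists>r\<ge>1. card (chain_starts r (gaps S)) \<le> 2)"
proof (cases "length b \<le> 2")
  case False
  let ?E = "0 # b" and ?N = "length b"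
  define \<gamma> where "\<gamma> i = gap_of_exponent (o0 + int (?E ! i))" for i
  have dist: "distinct ?E" using b strict_sorted_iff by blast
  have inj_\<gamma>: "inj_on \<gamma> {..?N}"
  proof (rule inj_onI)
    fix x y assume xy: "x \<in> {..?N}" "y \<in> {..?N}" "\<gamma> x = \<gamma> y"
    then have "?E ! x = ?E ! y" by (simp add: \<gamma>_def gap_of_exponent_def del: nth_Cons' split:
      if_splits)
    then show "x = y" using xy dist nth_eq_iff_index_eq[OF dist, of x y]
      by (simp add: less_Suc_eq_le del: nth_Cons')
  qed
  have "\<gamma> ` {..?N} = gap_of_exponent ` (\<lambda>e. o0 + int e) ` (!) ?E ` {..?N}"
    by (simp add: \<gamma>_def image_image del: nth_Cons')
  also have "(!) ?E ` {..?N} = set ?E"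
    by (auto simp: set_conv_nth image_iff less_Suc_eq_le simp del: set_simps list.set(2) nth_Cons')
  also have "gap_of_exponent ` (\<lambda>e. o0 + int e) ` set ?E = int ` gaps S"
    unfolding J canonical_exponents_def by (simp add: image_image gap_of_exponent_def
      gap_exponent_def)
  finally have bij: "bij_betw \<gamma> {..?N} (int ` gaps S)" using inj_\<gamma> by (simp add: bij_betw_def)
  have card: "card (gaps S) = Suc ?N"
    using bij_betw_same_card[OF bij] by (simp add: card_image)
  have ap: "ap_blocks m1 m2 (\<lambda>j. int (?E ! \<sigma> j)) \<longleftrightarrow> ap_blocks m1 m2 (\<lambda>j. \<gamma> (\<sigma> j))" for m1 m2 \<sigma>
    unfolding ap_blocks_def by (intro ball_cong refl) (auto simp: \<gamma>_def gap_of_exponent_def simp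
      del: nth_Cons')
  show ?thesis
  proof
    assume "on_surface_scroll ?N (range (rat_map (map (\<lambda>e. f0 * t_rf ^ e) ?E)))"
    then obtain m1 m2 \<sigma> where m: "1 \<le> m1 + m2" "?N = m1 + m2 + 1" "\<sigma> permutes {..?N}"
      "range (rat_map (map (\<lambda>e. f0 * t_rf ^ e) ?E)) \<subseteq> scroll [m1, m2] \<sigma>"
      using False unfolding on_surface_scroll_def by blast
    have "ap_blocks m1 m2 (\<lambda>j. \<gamma> (\<sigma> j))"
      using m(4) monomial_subset_scroll_iff[OF b f0 m(2,3)] ap by blast
    moreover have "bij_betw (\<lambda>j. \<gamma> (\<sigma> j)) {..m1 + m2 + 1} (int ` gaps S)"
      using bij_betw_trans[OF permutes_imp_bij[OF m(3)] bij] by (simp add: comp_def m(2))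
    ultimately show "?N \<le> 2 \<or> (\<exists>r\<ge>1. card (chain_starts r (gaps S)) \<le> 2)"
      using ap_blocks_chain_starts m(1) by blast
  next
    assume "?N \<le> 2 \<or> (\<exists>r\<ge>1. card (chain_starts r (gaps S)) \<le> 2)"
    then obtain r where r: "1 \<le> r" "card (chain_starts r (gaps S)) \<le> 2" using False by blast
    have "1 \<le> ?N" using False by simp
    from chain_starts_ap_blocks[OF finite_gaps_S card this r]
    obtain m1 m2 x where m: "m1 + m2 + 1 = ?N" "bij_betw x {..?N} (int ` gaps S)"
      "ap_blocks m1 m2 x"
      by (elim exE conjE)
    \<comment> \<open>Position \<open>j\<close> of the scroll receives the coordinate whose gap is
      \<open>x j\<close>; the identity outside the range is required by
      \<open>permutes\<close>.\<close>
    define \<sigma> where "\<sigma> j = (if j \<in> {..?N} then inv_into {..?N} \<gamma> (x j) else j)" for j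
    have "bij_betw (\<lambda>j. inv_into {..?N} \<gamma> (x j)) {..?N} {..?N}"
      using bij_betw_trans[OF m(2) bij_betw_inv_into[OF bij]] by (simp add: comp_def)
    then have "bij_betw \<sigma> {..?N} {..?N}" by (rule bij_betw_cong[THEN iffD1, rotated]) (simp add:
      \<sigma>_def)
    then have perm: "\<sigma> permutes {..?N}" by (rule bij_imp_permutes) (simp add: \<sigma>_def)
    have "\<gamma> (\<sigma> j) = x j" if "j \<le> ?N" for j
    proof -
      have "x j \<in> \<gamma> ` {..?N}" using m(2) bij that by (auto simp: bij_betw_def)
      then show ?thesis using that by (simp add: \<sigma>_def f_inv_into_f)
    qed
    then have "ap_blocks m1 m2 (\<lambda>j. \<gamma> (\<sigma> j))"
      using m(1,3) by (auto simp: ap_blocks_def block_columns_def)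
    then have "range (rat_map (map (\<lambda>e. f0 * t_rf ^ e) ?E)) \<subseteq> scroll [m1, m2] \<sigma>"
      using monomial_subset_scroll_iff[OF b f0 m(1)[symmetric] perm] ap by blast
    moreover have "1 \<le> m1 + m2" using m(1) False by simp
    ultimately show "on_surface_scroll ?N (range (rat_map (map (\<lambda>e. f0 * t_rf ^ e) ?E)))"
      unfolding on_surface_scroll_def using m(1) perm by metis
  qed
qed (simp add: on_surface_scroll_def)

text \<open>The criterion holds for every monomial canonical basis, so the existential quantifier
  makes no choice that matters; the existence of one basis gives the direction from gonality to
  scrolls.\<close>

lemma canonical_model_on_scroll_iff:
  assumes "gaps S \<noteq> {}"
  shows "(\<exists>ws. monomial_canonical_basis (curve :: 'k ppoint set) phi ws \<and>
      on_surface_scroll (arith_genus (curve :: 'k ppoint set) phi - 1) (range (rat_map ws)))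
    \<longleftrightarrow> gonality (curve :: 'k ppoint set) phi \<le> 3"
proof -
  obtain C where C: "\<forall>k\<ge>C. k \<in> S" using semigrp_conductor by (elim exE)
  note S = zero_in_semigrp[of Q] semigrp_add[of _ Q]
  have gon: "gonality (curve :: 'k ppoint set) phi \<le> 3 \<longleftrightarrow> (\<exists>r\<ge>1. shift_defect S r \<le> 3)"
    using gonality_le_iff[of 3] by simp
  have main: "on_surface_scroll (arith_genus (curve :: 'k ppoint set) phi - 1) (range (rat_map ws))
      \<longleftrightarrow> gonality (curve :: 'k ppoint set) phi \<le> 3"
    if ws: "monomial_canonical_basis (curve :: 'k ppoint set) phi ws" for ws
  proof -
    obtain b f0 o0 where b: "f0 \<noteq> 0" "sorted_wrt (<) (0 # b)" "ws = map (\<lambda>e. f0 * t_rf ^ e) (0 # b)"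
      "(\<lambda>e. o0 + int e) ` set (0 # b) = canonical_exponents"
      using monomial_canonical_basis_exponents[OF ws] by (elim exE conjE)
    have "distinct (0 # b)" using b(2) strict_sorted_iff by blast
    have "card (gaps S) = card ((\<lambda>e. o0 + int e) ` set (0 # b))"
      by (simp only: b(4) card_canonical_exponents)
    also have "\<dots> = card (set (0 # b))" by (rule card_image) (simp add: inj_on_def)
    also have "\<dots> = Suc (length b)" using distinct_card[OF \<open>distinct (0 # b)\<close>] by simp
    finally have g: "card (gaps S) = Suc (length b)" .
    have "on_surface_scroll (arith_genus (curve :: 'k ppoint set) phi - 1) (range (rat_map ws)) \<longleftrightarrow>
        length b \<le> 2 \<or> (\<exists>r\<ge>1. card (chain_starts r (gaps S)) \<le> 2)"
      unfolding arith_genus_eq g b(3) using on_surface_scroll_iff[OF b(2,1,4)] by simp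
    \<comment> \<open>There are \<open>length b + 1\<close> gaps, so \<open>length b \<le> 2\<close>
      is the case of at most three gaps.\<close>
    also have "\<dots> \<longleftrightarrow> (\<exists>r\<ge>1. shift_defect S r \<le> 3)"
      using chain_starts_iff_shift_defect[OF S C] shift_defect_small_genus[OF S C] g by auto
    finally show ?thesis using gon by simp
  qed
  then show ?thesis using monomial_canonical_basis_exists[OF assms] by blast
qed

end

text \<open>At finite points other than \<open>0\<close> the semigroup is \<open>UNIV\<close>, so
  the singular point is the image of \<open>0\<close> or of infinity, and uniqueness makes the other
  one smooth.\<close>

lemma (in monomial_exponents) canonical_model_on_scroll_iff_gonality:
  assumes "\<exists>!P. P \<in> (curve :: 'k::alg_closed_field ppoint set) \<and> singular_at phi P"
  shows "(\<exists>ws. monomial_canonical_basis (curve :: 'k ppoint set) phi ws \<and>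
      on_surface_scroll (arith_genus (curve :: 'k ppoint set) phi - 1) (range (rat_map ws)))
    \<longleftrightarrow> gonality (curve :: 'k ppoint set) phi \<le> 3"
proof -
  obtain P0 :: "'k ppoint" where P0: "P0 \<in> curve \<and> singular_at phi P0"
    and P0_uniq: "\<forall>P. P \<in> curve \<and> singular_at phi P \<longrightarrow> P = P0"
    using assms by (rule ex1E)
  obtain Q :: "'k option" where PQ: "P0 = rat_map phi Q" using P0 by blast
  have Q: "semigrp Q \<noteq> UNIV" using conjunct2[OF P0] unfolding PQ singular_at_iff .
  have uniq: "P = Q" if "semigrp P \<noteq> UNIV" for P :: "'k option"
  proof -
    have "singular_at phi (rat_map phi P)" using that unfolding singular_at_iff .
    then have "rat_map phi P = P0" by (intro P0_uniq[rule_format] conjI rangeI)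
    then show ?thesis by (simp add: PQ)
  qed
  have "Q = None \<or> Q = Some 0" using Q semigrp_generic by (cases Q) auto
  then have "\<exists>Q' :: 'k option. Q = None \<and> Q' = Some 0 \<or> Q = Some 0 \<and> Q' = None" by auto
  then obtain Q' :: "'k option" where Q': "Q = None \<and> Q' = Some 0 \<or> Q = Some 0 \<and> Q' = None" by blast
  then have "semigrp Q' = UNIV" using uniq[of Q'] by auto
  then interpret monomial_one_singular e n Q Q'
    using Q' by unfold_locales
  show ?thesis using Q by (intro canonical_model_on_scroll_iff) (auto simp: gaps_def)
qed

section \<open>Removing a common divisor of the exponents\<close>

lemma monomial_curve_eq_range:
  fixes a :: "nat list"
  assumes "monomial_exponents e n" and g: "0 < g" and a: "0 # a = map (\<lambda>x. g * x) e"
  shows "monomial_curve a = range (rat_map (monomial_exponents.phi e :: 'k::alg_closed_field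
    ratfun list))"
proof -
  interpret monomial_exponents e n by fact
  have n: "length a = n" using arg_cong[OF a, of length] len by simp
  define A where "A = 0 # a"
  have nth: "A ! i = g * e ! i" if "i \<le> n" for i using that len by (simp add: A_def a)
  define v where "v s t i = (if i \<le> n then t ^ (A ! i) * s ^ (A ! n - A ! i) else 0)"
    for s t :: 'k and i
  have curve: "monomial_curve a = {proj_pt (v s t) | s t. (s, t) \<noteq> (0, 0)}"
    by (simp only: monomial_curve_def n v_def[abs_def] Let_def A_def)
  have Some: "proj_pt (v s t) = rat_map phi (Some ((t / s) ^ g))" if "s \<noteq> 0" for s t :: 'k
  proof -
    have "v s t = (\<lambda>i. s ^ (g * e ! n) * (if i \<le> n then ((t / s) ^ g) ^ (e ! i) else 0))"
    proof
      fix i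
      show "v s t i = s ^ (g * e ! n) * (if i \<le> n then ((t / s) ^ g) ^ (e ! i) else 0)"
      proof (cases "i \<le> n")
        case True
        then have "s ^ (g * e ! n) = s ^ (g * e ! n - g * e ! i) * s ^ (g * e ! i)"
          using e_le by (simp flip: power_add)
        then show ?thesis using True that
          by (simp add: v_def nth power_divide power_mult[symmetric])
      qed (simp add: v_def)
    qed
    then show ?thesis using that by (simp add: rat_map_phi_eq proj_pt_scale cong: if_cong)
  qed
  have None: "proj_pt (v 0 t) = rat_map phi None" if "t \<noteq> 0" for t :: 'k
  proof -
    have "v 0 t = (\<lambda>i. t ^ (g * e ! n) * (if i \<le> n then 0 ^ (e ! n - e ! i) else 0))"
    proof
      fix i
      show "v 0 t i = t ^ (g * e ! n) * (if i \<le> n then 0 ^ (e ! n - e ! i) else 0)"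
      proof (cases "i < n")
        case True
        then have "e ! i < e ! n" using e_less by simp
        then show ?thesis using True g by (simp add: v_def nth power_0_left)
      qed (auto simp: v_def nth)
    qed
    then show ?thesis using that by (simp add: rat_map_phi_eq proj_pt_scale cong: if_cong)
  qed
  show ?thesis
    unfolding curve
  proof (intro equalityI subsetI)
    fix P assume "P \<in> {proj_pt (v s t) | s t. (s, t) \<noteq> (0, 0)}"
    then obtain s t where "P = proj_pt (v s t)" "(s, t) \<noteq> (0, 0)" by blast
    then show "P \<in> range (rat_map phi)" using Some[of s t] None[of t] by (cases "s = 0") auto
  next
    fix P assume "P \<in> range (rat_map (phi :: 'k ratfun list))"
    then obtain R :: "'k option" where R: "P = rat_map phi R" by blast
    show "P \<in> {proj_pt (v s t) | s t. (s, t) \<noteq> (0, 0)}"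
    proof (cases R)
      case None
      then have "P = proj_pt (v 0 1)" using R \<open>\<And>t. t \<noteq> 0 \<Longrightarrow> proj_pt (v 0 t)
        = rat_map phi None\<close>[of 1] by simp
      then show ?thesis by (intro CollectI exI[of _ 0] exI[of _ 1]) simp
    next
      case (Some c)
      \<comment> \<open>An algebraically closed field has \<open>g\<close>-th roots, so passing from
        \<open>t\<close> to \<open>t ^ g\<close> loses no point of the curve.\<close>
      obtain t where "t ^ g = c" using nth_root_exists[of g c] g by auto
      then have "P = proj_pt (v 1 t)" using R Some \<open>\<And>s t. s \<noteq> 0 \<Longrightarrow> proj_pt (v s t) = _\<close>[of 1 t]
        by simp
      then show ?thesis by (intro CollectI exI[of _ 1] exI[of _ t]) simp
    qed
  qed
qed

lemma monomial_exponents_div_Gcd: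
  assumes "a \<noteq> []" and sorted: "sorted_wrt (<) (0 # a)"
  shows "monomial_exponents (map (\<lambda>x. x div Gcd (set a)) (0 # a)) (length a)"
    and "0 < Gcd (set a)" and "0 # a = map (\<lambda>x. Gcd (set a) * x) (map (\<lambda>x. x div Gcd (set a)) (0
      # a))"
proof -
  define g where "g = Gcd (set a)"
  have pos: "0 < x" if "x \<in> set a" for x using sorted that by simp
  have dvd: "g dvd x" if "x \<in> set (0 # a)" for x using that by (auto simp: g_def)
  have g0: "0 < g"
  proof -
    obtain x where x: "x \<in> set a" using assms(1) by (cases a) auto
    then have "g dvd x" using dvd[of x] by simp
    then show ?thesis using pos[OF x] by (auto intro: gr0I)
  qed
  show "0 < Gcd (set a)" using g0 by (simp add: g_def)
  show "0 # a = map (\<lambda>x. Gcd (set a) * x) (map (\<lambda>x. x div Gcd (set a)) (0 # a))"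
    using dvd by (simp add: g_def[symmetric] map_idI)
  show "monomial_exponents (map (\<lambda>x. x div Gcd (set a)) (0 # a)) (length a)"
    unfolding g_def[symmetric]
  proof
    show "sorted_wrt (<) (map (\<lambda>x. x div g) (0 # a))"
      unfolding sorted_wrt_map
    proof (rule sorted_wrt_mono_rel[OF _ sorted])
      fix x y assume "x \<in> set (0 # a)" "y \<in> set (0 # a)" "x < y"
      then show "x div g < y div g" using dvd[of x] dvd[of y] g0 by (auto elim!: dvdE)
    qed
    define d where "d = Gcd (set (map (\<lambda>x. x div g) (0 # a)))"
    have "d * g dvd x" if "x \<in> set a" for x
    proof -
      have "d dvd x div g" using that by (auto simp: d_def)
      then have "d * g dvd x div g * g" by (rule mult_dvd_mono) simp
      then show ?thesis using dvd[of x] that by simp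
    qed
    then have "d * g dvd g" unfolding g_def by (intro Gcd_greatest)
    then have "d = 1" using g0 by simp
    then show "Gcd (set (map (\<lambda>x. x div g) (0 # a))) = 1" by (simp only: d_def)
  qed (use assms(1) in simp_all)
qed

theorem theorem3p3:
  fixes C :: "'k::alg_closed_field ppoint set" and a :: "nat list" and \<phi> :: "'k ratfun list"
  assumes "a \<noteq> []" and "sorted_wrt (<) (0 # a)"
    and "C = monomial_curve a" and "\<phi> = monomial_normalization a"
    and "\<exists>!P. P \<in> C \<and> singular_at \<phi> P"
  shows "(\<exists>\<omega>s. monomial_canonical_basis C \<phi> \<omega>s \<and>
            on_surface_scroll (arith_genus C \<phi> - 1) (range (rat_map \<omega>s)))
         \<longleftrightarrow> gonality C \<phi> \<le> 3"
proof -
  let ?e = "map (\<lambda>x. x div Gcd (set a)) (0 # a)"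
  interpret monomial_exponents ?e "length a"
    by (rule monomial_exponents_div_Gcd[OF assms(1,2)])
  have \<phi>: "\<phi> = phi" unfolding assms(4) monomial_normalization_def phi_def by (simp only: map_map comp_def)
  have C: "C = curve"
    unfolding assms(3) by (rule monomial_curve_eq_range[OF monomial_exponents_div_Gcd[OF assms(1,2)]])
  show ?thesis
    using assms(5) unfolding \<phi> C by (rule canonical_model_on_scroll_iff_gonality)
qed

end
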